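(* Let $\mathbb{K}$ be a field, $R=\mathbb{K}[x_1,\ldots,x_n]$ the standard graded polynomial ring, and let $I,J$ be homogeneous ideals of $R$ such that there exist minimal generating sets for $I$ and $J$ in disjoint sets of variables. If subadditivity holds for $R/I$ and for $R/J$, then subadditivity holds for $R/(I+J)$.
   Context: For a finitely generated graded $R$-module $M$ with graded Betti numbers $\beta_{i,j}^R(M)$, set $t_i^R(M)=\sup\{j:\beta_{i,j}^R(M)\neq 0\}$ (with $\sup\emptyset=-\infty$). Subadditivity holds for $M$ if $t_{a+b}^R(M)\le t_a^R(M)+t_b^R(M)$ for all $a,b\ge 0$ with $a+b\le \operatorname{pd}_R(M)$, where $\operatorname{pd}$ denotes projective dimension. *)

theory Defs
  imports
    "HOL-Library.Poly_Mapping"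
    "HOL-Library.Extended_Nat"
    "HOL-Library.Extended_Real"
    "HOL-Algebra.Module"
    "HOL-Algebra.QuotRing"
begin

section \<open>Multivariate polynomial rings\<close>

text \<open>A polynomial is a finitely supported map from monomials (finitely supported exponent
  vectors) to coefficients; multiplication on this type is convolution.\<close>

type_synonym ('x, 'k) mpoly = "('x \<Rightarrow>\<^sub>0 nat) \<Rightarrow>\<^sub>0 'k"

definition vars :: "('x, 'k::zero) mpoly \<Rightarrow> 'x set" where
  "vars p = (\<Union>m \<in> Poly_Mapping.keys p. Poly_Mapping.keys m)"

definition mdeg :: "('x \<Rightarrow>\<^sub>0 nat) \<Rightarrow> nat" where
  "mdeg m = (\<Sum>x \<in> Poly_Mapping.keys m. Poly_Mapping.lookup m x)"

definition mpoly_ring :: "'x set \<Rightarrow> ('x, 'k::field) mpoly ring" where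
  "mpoly_ring V = \<lparr>carrier = {p. vars p \<subseteq> V}, mult = (*), one = 1, zero = 0, add = (+)\<rparr>"

text \<open>The homogeneous polynomials of degree \<open>d\<close>, including \<open>0\<close>.\<close>

definition mpoly_part :: "'x set \<Rightarrow> int \<Rightarrow> ('x, 'k::field) mpoly set" where
  "mpoly_part V d = {p \<in> carrier (mpoly_ring V). \<forall>m \<in> Poly_Mapping.keys p. int (mdeg m) = d}"

text \<open>The polynomials without constant term, i.e. the homogeneous maximal ideal.\<close>

definition irrelevant_ideal :: "'x set \<Rightarrow> ('x, 'k::field) mpoly set" where
  "irrelevant_ideal V = {p \<in> carrier (mpoly_ring V). Poly_Mapping.lookup p 0 = 0}"

definition homogeneous_ideal :: "'x set \<Rightarrow> ('x, 'k::field) mpoly set \<Rightarrow> bool" where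
  "homogeneous_ideal V I \<longleftrightarrow>
     (\<exists>G. G \<subseteq> (\<Union>d. mpoly_part V d) \<and> I = Idl\<^bsub>mpoly_ring V\<^esub> G)"

definition minimal_generating_set :: "('a, 'r) ring_scheme \<Rightarrow> 'a set \<Rightarrow> 'a set \<Rightarrow> bool" where
  "minimal_generating_set R G I \<longleftrightarrow>
     G \<subseteq> carrier R \<and> Idl\<^bsub>R\<^esub> G = I \<and> (\<forall>G'. G' \<subset> G \<longrightarrow> Idl\<^bsub>R\<^esub> G' \<noteq> I)"


section \<open>Resolutions and projective dimension\<close>

definition mod_hom ::
  "('a, 'r) ring_scheme \<Rightarrow> ('a, 'b, 'm) module_scheme \<Rightarrow> ('a, 'c, 'n) module_scheme \<Rightarrow> ('b \<Rightarrow> 'c) set"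
  where
  "mod_hom R M N = {f \<in> carrier M \<rightarrow> carrier N.
     (\<forall>x \<in> carrier M. \<forall>y \<in> carrier M. f (x \<oplus>\<^bsub>M\<^esub> y) = f x \<oplus>\<^bsub>N\<^esub> f y) \<and>
     (\<forall>r \<in> carrier R. \<forall>x \<in> carrier M. f (r \<odot>\<^bsub>M\<^esub> x) = r \<odot>\<^bsub>N\<^esub> f x)}"

text \<open>The exact complex
  \<open>\<dots> \<rightarrow> F 2 \<rightarrow> F 1 \<rightarrow> F 0 \<rightarrow> M \<rightarrow> 0\<close> with augmentation \<open>\<epsilon> : F 0 \<rightarrow> M\<close> and differentials
  \<open>\<delta> i : F (i + 1) \<rightarrow> F i\<close>.\<close>

definition resolution ::
  "('a, 'r) ring_scheme \<Rightarrow> ('a, 'c, 'm) module_scheme \<Rightarrow> (nat \<Rightarrow> ('a, 'b, 'n) module_scheme)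
     \<Rightarrow> ('b \<Rightarrow> 'c) \<Rightarrow> (nat \<Rightarrow> 'b \<Rightarrow> 'b) \<Rightarrow> bool" where
  "resolution R M F \<epsilon> \<delta> \<longleftrightarrow>
     \<epsilon> \<in> mod_hom R (F 0) M \<and>
     (\<forall>i. \<delta> i \<in> mod_hom R (F (Suc i)) (F i)) \<and>
     \<epsilon> ` carrier (F 0) = carrier M \<and>
     \<delta> 0 ` carrier (F (Suc 0)) = a_kernel (F 0) M \<epsilon> \<and>
     (\<forall>i. \<delta> (Suc i) ` carrier (F (Suc (Suc i))) = a_kernel (F (Suc i)) (F i) (\<delta> i))"

text \<open>The free module on the set \<open>A\<close>: finitely supported families of ring elements. The
  fields \<open>mult\<close> and \<open>one\<close> are present only because the library's module record extends
  the ring record; they play no role.\<close>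

definition free_module :: "('a, 'r) ring_scheme \<Rightarrow> 'i set \<Rightarrow> ('a, 'i \<Rightarrow> 'a) module" where
  "free_module R A =
     \<lparr>carrier = {v. range v \<subseteq> carrier R \<and> finite {k. v k \<noteq> \<zero>\<^bsub>R\<^esub>} \<and> {k. v k \<noteq> \<zero>\<^bsub>R\<^esub>} \<subseteq> A},
      mult = undefined, one = undefined,
      zero = (\<lambda>k. \<zero>\<^bsub>R\<^esub>), add = (\<lambda>v w k. v k \<oplus>\<^bsub>R\<^esub> w k),
      smult = (\<lambda>r v k. r \<otimes>\<^bsub>R\<^esub> v k)\<rparr>"

text \<open>Projective means direct summand of a free module. Indexing the basis by elements of
  the type of \<open>P\<close> is no restriction: one may always take \<open>A = carrier P\<close>.\<close>

definition projective_module :: "('a, 'r) ring_scheme \<Rightarrow> ('a, 'p, 'm) module_scheme \<Rightarrow> bool" where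
  "projective_module R P \<longleftrightarrow> module R P \<and>
     (\<exists>(A :: 'p set) \<iota> \<pi>. \<iota> \<in> mod_hom R P (free_module R A) \<and> \<pi> \<in> mod_hom R (free_module R A) P \<and>
        (\<forall>x \<in> carrier P. \<pi> (\<iota> x) = x))"

text \<open>The least length of a projective resolution, \<open>\<infinity>\<close> if there is no finite one, and
  \<open>0\<close> for the zero module. The carriers of the resolving modules live in
  \<^typ>\<open>nat \<Rightarrow> 'a\<close>, which contains a copy of every countably generated
  projective module; for finitely generated modules over a Noetherian ring, as here, this
  does not affect the value.\<close>

definition proj_dim :: "('a, 'r) ring_scheme \<Rightarrow> ('a, 'c, 'm) module_scheme \<Rightarrow> enat" where
  "proj_dim R M = Inf {enat l | l. \<exists>(P :: nat \<Rightarrow> ('a, nat \<Rightarrow> 'a) module) \<epsilon> \<delta>.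
     resolution R M P \<epsilon> \<delta> \<and> (\<forall>i. projective_module R (P i)) \<and>
     (\<forall>i > l. carrier (P i) = {\<zero>\<^bsub>P i\<^esub>})}"


section \<open>Graded modules and graded Betti numbers\<close>

text \<open>\<open>gpart M d\<close> is the homogeneous component of degree \<open>d\<close>.\<close>

record ('a, 'b) graded_module = "('a, 'b) module" +
  gpart :: "int \<Rightarrow> 'b set"

text \<open>For \<open>ds = [d\<^sub>0, \<dots>, d\<^sub>r]\<close> this is \<open>R(-d\<^sub>0) \<oplus> \<dots> \<oplus> R(-d\<^sub>r)\<close>: the basis element
  number \<open>k\<close> is homogeneous of degree \<open>ds ! k\<close>.\<close>

definition graded_free ::
  "'x set \<Rightarrow> int list \<Rightarrow> (('x, 'k::field) mpoly, nat \<Rightarrow> ('x, 'k) mpoly) graded_module" where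
  "graded_free V ds = module.extend (free_module (mpoly_ring V) {..<length ds})
     \<lparr>gpart = (\<lambda>d. {v \<in> carrier (free_module (mpoly_ring V) {..<length ds}).
        \<forall>k < length ds. v k \<in> mpoly_part V (d - ds ! k)})\<rparr>"

definition graded_map ::
  "('a, 'b, 'm) graded_module_scheme \<Rightarrow> ('a, 'c, 'n) graded_module_scheme \<Rightarrow> ('b \<Rightarrow> 'c) \<Rightarrow> bool" where
  "graded_map M N f \<longleftrightarrow> (\<forall>d. f ` gpart M d \<subseteq> gpart N d)"

definition minimal_graded_free_resolution ::
  "'x set \<Rightarrow> (('x, 'k::field) mpoly, 'c, 'm) graded_module_scheme \<Rightarrow> (nat \<Rightarrow> int list)
     \<Rightarrow> ((nat \<Rightarrow> ('x, 'k) mpoly) \<Rightarrow> 'c)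
     \<Rightarrow> (nat \<Rightarrow> (nat \<Rightarrow> ('x, 'k) mpoly) \<Rightarrow> (nat \<Rightarrow> ('x, 'k) mpoly)) \<Rightarrow> bool" where
  "minimal_graded_free_resolution V M ds \<epsilon> \<delta> \<longleftrightarrow>
     resolution (mpoly_ring V) M (\<lambda>i. graded_free V (ds i)) \<epsilon> \<delta> \<and>
     graded_map (graded_free V (ds 0)) M \<epsilon> \<and>
     (\<forall>i. graded_map (graded_free V (ds (Suc i))) (graded_free V (ds i)) (\<delta> i)) \<and>
     (\<forall>i. \<forall>v \<in> carrier (graded_free V (ds (Suc i))). \<forall>k. \<delta> i v k \<in> irrelevant_ideal V)"

text \<open>The number of summands \<open>R(-j)\<close> in homological position \<open>i\<close> of the minimal graded
  free resolution, which is unique up to isomorphism.\<close>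

definition betti ::
  "'x set \<Rightarrow> (('x, 'k::field) mpoly, 'c, 'm) graded_module_scheme \<Rightarrow> nat \<Rightarrow> int \<Rightarrow> nat" where
  "betti V M i j = (THE b. \<exists>ds \<epsilon> \<delta>. minimal_graded_free_resolution V M ds \<epsilon> \<delta> \<and>
     b = count_list (ds i) j)"

text \<open>In \<^typ>\<open>ereal\<close> the supremum of the empty set is \<open>-\<infinity>\<close>.\<close>

definition t_max ::
  "'x set \<Rightarrow> (('x, 'k::field) mpoly, 'c, 'm) graded_module_scheme \<Rightarrow> nat \<Rightarrow> ereal" where
  "t_max V M i = Sup {ereal (of_int j) | j. betti V M i j \<noteq> 0}"

definition subadditivity ::
  "'x set \<Rightarrow> (('x, 'k::field) mpoly, 'c, 'm) graded_module_scheme \<Rightarrow> bool" where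
  "subadditivity V M \<longleftrightarrow> (\<forall>a b. enat (a + b) \<le> proj_dim (mpoly_ring V) M \<longrightarrow>
     t_max V M (a + b) \<le> t_max V M a + t_max V M b)"

text \<open>The library's quotient ring \<open>R Quot I\<close>, viewed as a graded \<open>R\<close>-module.\<close>

definition quotient_module ::
  "'x set \<Rightarrow> ('x, 'k::field) mpoly set \<Rightarrow> (('x, 'k) mpoly, ('x, 'k) mpoly set) graded_module" where
  "quotient_module V I = ring.extend (mpoly_ring V Quot I)
     \<lparr>smult = (\<lambda>r C. (I +>\<^bsub>mpoly_ring V\<^esub> r) \<otimes>\<^bsub>mpoly_ring V Quot I\<^esub> C),
      gpart = (\<lambda>d. (\<lambda>p. I +>\<^bsub>mpoly_ring V\<^esub> p) ` mpoly_part V d)\<rparr>"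

end

theory Submission
  imports Defs "HOL-Library.Product_Lexorder"
begin

text \<open>If \<open>F\<close> and \<open>G\<close> are the minimal graded free resolutions of \<open>R/I\<close> and \<open>R/J\<close>, then \<open>F \<otimes> G\<close> is the one of
  \<open>R/(I + J)\<close>: its differential is again minimal, and it is exact since \<open>G\<close> may be defined over the
  polynomial ring in the variables of \<open>J\<close>, over which \<open>R/I\<close> is free. A generator of \<open>F \<otimes> G\<close> in position
  \<open>a + b\<close> is thus a product of generators in positions \<open>c\<close> and \<open>d\<close> with \<open>c + d = a + b\<close>. Splitting
  \<open>c = c\<^sub>1 + c\<^sub>2\<close> and \<open>d = d\<^sub>1 + d\<^sub>2\<close> with \<open>c\<^sub>1 + d\<^sub>1 = a\<close> and \<open>c\<^sub>2 + d\<^sub>2 = b\<close>, subadditivity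
  for \<open>R/I\<close> and \<open>R/J\<close> yields generators in positions \<open>a\<close> and \<open>b\<close> whose degrees add up to at least its
  degree. Positions of nonzero Betti numbers never exceed the projective dimension, because the minimal
  resolution is a direct summand, modulo the irrelevant ideal, of every projective resolution.\<close>

text \<open>\<open>betti\<close> is a definite description, so it is meaningful only once a minimal
  graded free resolution is known to exist and its degrees to be unique. Existence comes from
  Dickson's lemma and reduction of leading terms, uniqueness from the comparison of two resolutions.
  Resolutions may be infinite: in a position a + b without basis elements the supremum is
  -\<infinity> and there is nothing to show, so the projective dimension enters only as an upper
  bound for the nonempty positions. Resolutions are handled as families of matrices over arbitrary
  finite index sets, so that the basis of F \<otimes> G can be a set of triples; it is numbered only
  on the passage to \<open>graded_free\<close>. Position 0 is R and no matrix entry has a constant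
  term, which excludes the unit ideal; its quotient is zero and is treated separately. The
  construction is asymmetric: only J has to be resolved over fewer variables. The variables
  occurring in neither set of generators are counted on the side of J, so that two sets of variables
  partition the whole.\<close>

section \<open>Polynomials in given variables, terms and degrees\<close>

abbreviation lkp :: "('a \<Rightarrow>\<^sub>0 'b::zero) \<Rightarrow> 'a \<Rightarrow> 'b" where "lkp \<equiv> Poly_Mapping.lookup"
abbreviation mkeys :: "('a \<Rightarrow>\<^sub>0 'b::zero) \<Rightarrow> 'a set" where "mkeys \<equiv> Poly_Mapping.keys"
abbreviation mterm :: "('x \<Rightarrow>\<^sub>0 nat) \<Rightarrow> 'k \<Rightarrow> ('x, 'k::zero) mpoly" where
  "mterm \<equiv> Poly_Mapping.single"

definition polys :: "'x set \<Rightarrow> ('x, 'k::zero) mpoly set" where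
  "polys V = {p. vars p \<subseteq> V}"

lemma in_polys_iff: "p \<in> polys V \<longleftrightarrow> (\<forall>m. lkp p m \<noteq> 0 \<longrightarrow> mkeys m \<subseteq> V)"
  by (simp add: polys_def vars_def UN_subset_iff lookup_not_eq_zero_eq_in_keys Ball_def)

lemma polys_zero [simp]: "0 \<in> polys V"
  by (simp add: in_polys_iff)

lemma polys_add [intro]: "p \<in> polys V \<Longrightarrow> q \<in> polys V \<Longrightarrow> p + q \<in> polys V"
  for p q :: "('x, 'k::monoid_add) mpoly"
  unfolding in_polys_iff lookup_add by (metis add_0)

lemma polys_uminus [intro, simp]: "p \<in> polys V \<Longrightarrow> - p \<in> polys V"
  for p :: "('x, 'k::ab_group_add) mpoly"
  unfolding in_polys_iff by simp

lemma polys_diff [intro]: "p \<in> polys V \<Longrightarrow> q \<in> polys V \<Longrightarrow> p - q \<in> polys V"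
  for p q :: "('x, 'k::ab_group_add) mpoly"
  using polys_add[OF _ polys_uminus, of p V q] by simp

lemma polys_sum [intro]: "(\<And>x. x \<in> A \<Longrightarrow> f x \<in> polys V) \<Longrightarrow> sum f A \<in> polys V"
  for f :: "'a \<Rightarrow> ('x, 'k::comm_monoid_add) mpoly"
  by (induction A rule: infinite_finite_induct) auto

lemma polys_single [simp]: "mterm m c \<in> polys V \<longleftrightarrow> c = 0 \<or> mkeys m \<subseteq> V"
  by (auto simp: in_polys_iff lookup_single when_def)

lemma polys_one [simp]: "1 \<in> polys V"
  by (simp add: in_polys_iff lookup_one when_def)

lemma keys_add_nat: "mkeys (a + b) = mkeys a \<union> mkeys b"
  for a b :: "'x \<Rightarrow>\<^sub>0 nat"
  by (auto simp: in_keys_iff lookup_add)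

lemma polys_mult [intro]:
  fixes p q :: "('x, 'k::semiring_0) mpoly"
  assumes "p \<in> polys V" "q \<in> polys V" shows "p * q \<in> polys V"
  unfolding polys_def vars_def mem_Collect_eq
proof (intro UN_least)
  fix m assume "m \<in> mkeys (p * q)"
  then obtain a b where "m = a + b" "a \<in> mkeys p" "b \<in> mkeys q"
    using keys_mult[of p q] by auto
  with assms show "mkeys m \<subseteq> V"
    by (auto simp: in_polys_iff keys_add_nat in_keys_iff)
qed

lemma polys_mono: "A \<subseteq> B \<Longrightarrow> polys A \<subseteq> polys B"
  by (auto simp: polys_def)

lemma mpoly_sum_terms: "p = (\<Sum>m\<in>mkeys p. mterm m (lkp p m))"
  for p :: "('x, 'k::comm_monoid_add) mpoly"
  by (rule poly_mapping_eqI)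
     (auto simp: lookup_sum lookup_single when_def in_keys_iff)

text \<open>A polynomial is the finite sum of its terms, so a property that passes to sums need only
  be checked on terms; partial sums stay in \<open>polys V\<close> because their monomials are
  monomials of p.\<close>

lemma polys_induct [consumes 1, case_names single add]:
  fixes p :: "('x, 'k::comm_monoid_add) mpoly"
  assumes p: "p \<in> polys V"
    and t: "\<And>m c. mkeys m \<subseteq> V \<Longrightarrow> Q (mterm m c)"
    and a: "\<And>p q. p \<in> polys V \<Longrightarrow> q \<in> polys V \<Longrightarrow> Q p \<Longrightarrow> Q q \<Longrightarrow> Q (p + q)"
  shows "Q p"
proof -
  have Q0: "Q 0" using t[of 0 0] by simp
  have k: "mkeys m \<subseteq> V" if "m \<in> mkeys p" for m
    using that p by (auto simp: in_polys_iff in_keys_iff)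
  have "finite M \<Longrightarrow> M \<subseteq> mkeys p \<Longrightarrow>
      (\<Sum>m\<in>M. mterm m (lkp p m)) \<in> polys V \<and> Q (\<Sum>m\<in>M. mterm m (lkp p m))" for M
  proof (induction M rule: finite_induct)
    case (insert x F)
    then show ?case using k[of x] by (auto intro!: a t)
  qed (simp add: Q0)
  from this[of "mkeys p"] show ?thesis
    using mpoly_sum_terms[of p] by simp
qed

lemma lookup_term_mult: "lkp (mterm s c * p) (s + m) = c * lkp p m"
  for p :: "('x, 'k::semiring_0) mpoly"
proof -
  have "(\<Sum>q. lkp p q when s + m = s + q) = lkp p m" by simp
  moreover have "lkp (mterm s c) l * (\<Sum>q. lkp p q when s + m = l + q)
     = (c * (\<Sum>q. lkp p q when s + m = l + q) when l = s)" for l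
    by (auto simp: lookup_single when_def)
  ultimately show ?thesis unfolding lookup_mult by simp
qed

lemma lookup_term_mult_neq: "\<nexists>m'. m = s + m' \<Longrightarrow> lkp (mterm s c * p) m = 0"
  for p :: "('x, 'k::semiring_0) mpoly"
  using keys_mult[of "mterm s c" p] by (auto simp: in_keys_iff split: if_splits)

lemma add_eq_0_mono: "a + b = 0 \<longleftrightarrow> a = 0 \<and> b = 0" for a b :: "'x \<Rightarrow>\<^sub>0 nat"
  by (auto simp: poly_mapping_eq_iff lookup_add fun_eq_iff)

text \<open>Exponents are natural numbers, so only constant terms multiply to a constant term. Hence
  p \<mapsto> \<open>lkp p 0\<close> is a ring homomorphism to the base field with the irrelevant
  ideal as kernel, and reduction modulo that ideal is expressed by it throughout.\<close>

lemma lookup_mult_0: "lkp (p * q) 0 = lkp p 0 * lkp q 0" for p q :: "('x, 'k::semiring_0) mpoly"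
proof -
  have "(\<Sum>r. lkp q r when 0 = l + r) = (lkp q 0 when l = 0)" for l
  proof -
    have "(lkp q r when 0 = l + r) = ((lkp q 0 when l = 0) when r = 0)" for r
      by (cases "l = 0"; cases "r = 0") (auto simp: when_def add_eq_0_mono eq_commute[of 0])
    then show ?thesis by simp
  qed
  then show ?thesis by (simp add: lookup_mult mult_when)
qed

lemma mdeg_superset: "finite A \<Longrightarrow> mkeys m \<subseteq> A \<Longrightarrow> mdeg m = (\<Sum>x\<in>A. lkp m x)"
  unfolding mdeg_def by (rule sum.mono_neutral_left) (auto simp: in_keys_iff)

lemma mdeg_add: "mdeg (a + b) = mdeg a + mdeg b"
proof -
  let ?A = "mkeys a \<union> mkeys b"
  have "mdeg (a + b) = (\<Sum>x\<in>?A. lkp (a + b) x)" by (rule mdeg_superset) (auto simp: keys_add_nat)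
  also have "\<dots> = mdeg a + mdeg b"
    by (simp add: lookup_add sum.distrib mdeg_superset[of ?A])
  finally show ?thesis .
qed

lemma mdeg_zero [simp]: "mdeg 0 = 0"
  by (simp add: mdeg_def)

lemma mdeg_eq_0: "mdeg m = 0 \<longleftrightarrow> m = 0"
  by (auto simp: mdeg_def poly_mapping_eq_iff fun_eq_iff in_keys_iff)

section \<open>Homogeneous components\<close>

definition homog :: "int \<Rightarrow> ('x, 'k::zero) mpoly \<Rightarrow> bool" where
  "homog d p \<longleftrightarrow> (\<forall>m. lkp p m \<noteq> 0 \<longrightarrow> int (mdeg m) = d)"

definition hcomp :: "int \<Rightarrow> ('x, 'k::zero) mpoly \<Rightarrow> ('x, 'k) mpoly" where
  "hcomp d p = Abs_poly_mapping (\<lambda>m. lkp p m when int (mdeg m) = d)"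

lemma lookup_hcomp: "lkp (hcomp d p) m = (lkp p m when int (mdeg m) = d)"
proof -
  have "finite {m. (lkp p m when int (mdeg m) = d) \<noteq> 0}"
    by (rule finite_subset[OF _ finite_lookup[of p]]) auto
  then show ?thesis by (simp add: hcomp_def)
qed

lemma homog_zero [simp]: "homog d 0"
  by (simp add: homog_def)

lemma homog_add [intro]: "homog d p \<Longrightarrow> homog d q \<Longrightarrow> homog d (p + q)"
  for p q :: "('x, 'k::monoid_add) mpoly"
  unfolding homog_def lookup_add by (metis add_0)

lemma homog_uminus [intro, simp]: "homog d p \<Longrightarrow> homog d (- p)"
  for p :: "('x, 'k::ab_group_add) mpoly"
  by (simp add: homog_def)

lemma homog_sum [intro]: "(\<And>x. x \<in> A \<Longrightarrow> homog d (f x)) \<Longrightarrow> homog d (sum f A)"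
  for f :: "'a \<Rightarrow> ('x, 'k::comm_monoid_add) mpoly"
  by (induction A rule: infinite_finite_induct) auto

lemma homog_term: "homog d (mterm m c) \<longleftrightarrow> c = 0 \<or> d = int (mdeg m)"
  by (auto simp: homog_def lookup_single when_def)

lemma homog_one [simp]: "homog 0 1"
  by (auto simp: homog_def lookup_one when_def)

lemma homog_mult: "homog d p \<Longrightarrow> homog e q \<Longrightarrow> homog (d + e) (p * q)"
  for p q :: "('x, 'k::semiring_0) mpoly"
  using keys_mult[of p q] unfolding homog_def in_keys_iff[symmetric]
  by (fastforce simp: mdeg_add)

lemma hcomp_homog: "homog d p \<Longrightarrow> hcomp e p = (if e = d then p else 0)"
  by (rule poly_mapping_eqI) (auto simp: lookup_hcomp homog_def when_def)

lemma homog_hcomp [simp]: "homog d (hcomp d p)"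
  by (auto simp: homog_def lookup_hcomp)

lemma hcomp_zero [simp]: "hcomp d 0 = 0"
  by (rule poly_mapping_eqI) (simp add: lookup_hcomp)

lemma hcomp_add: "hcomp d (p + q) = hcomp d p + hcomp d q"
  for p q :: "('x, 'k::comm_monoid_add) mpoly"
  by (rule poly_mapping_eqI) (simp add: lookup_hcomp lookup_add when_def)

lemma hcomp_sum: "hcomp d (sum f A) = (\<Sum>x\<in>A. hcomp d (f x))"
  for f :: "'a \<Rightarrow> ('x, 'k::comm_monoid_add) mpoly"
  by (induction A rule: infinite_finite_induct) (auto simp: hcomp_add)

lemma polys_hcomp [intro]: "p \<in> polys V \<Longrightarrow> hcomp d p \<in> polys V"
  by (simp add: in_polys_iff lookup_hcomp)

lemma hcomp_mult_homog:
  fixes p q :: "('x, 'k::semiring_0) mpoly"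
  assumes "homog e p" shows "hcomp d (p * q) = p * hcomp (d - e) q"
proof -
  have "q \<in> polys UNIV" by (simp add: polys_def)
  then show ?thesis
  proof (induction q rule: polys_induct)
    case (single m c)
    have "homog (int (mdeg m)) (mterm m c)" by (simp add: homog_term)
    from hcomp_homog[OF this] hcomp_homog[OF homog_mult[OF assms this]] show ?case by auto
  qed (simp add: hcomp_add algebra_simps)
qed

lemma lookup_homog_0: "homog d p \<Longrightarrow> d \<noteq> 0 \<Longrightarrow> lkp p 0 = 0"
  by (force simp: homog_def)

lemma homog_0_const: "homog 0 p \<Longrightarrow> p = mterm 0 (lkp p 0)"
  by (rule poly_mapping_eqI) (auto simp: homog_def lookup_single when_def mdeg_eq_0)

lemma hcomp_decomp:
  fixes p :: "('x, 'k::comm_monoid_add) mpoly"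
  assumes "finite E" "(\<lambda>m. int (mdeg m)) ` mkeys p \<subseteq> E"
  shows "(\<Sum>d\<in>E. hcomp d p) = p"
proof (rule poly_mapping_eqI)
  fix m
  have "lkp (\<Sum>d\<in>E. hcomp d p) m = (if int (mdeg m) \<in> E then lkp p m else 0)"
    using assms(1) by (simp add: lookup_sum lookup_hcomp when_def)
  also have "\<dots> = lkp p m" using assms(2) by (auto simp: image_subset_iff in_keys_iff)
  finally show "lkp (\<Sum>d\<in>E. hcomp d p) m = lkp p m" .
qed

section \<open>The ring\<close>

lemma mpoly_ring_simps [simp]:
  "carrier (mpoly_ring V) = polys V" "mult (mpoly_ring V) = (*)" "one (mpoly_ring V) = 1"
  "zero (mpoly_ring V) = 0" "add (mpoly_ring V) = (+)"
  by (simp_all add: mpoly_ring_def polys_def)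

lemma cring_mpoly_ring: "cring (mpoly_ring V)"
proof (rule cringI)
  show "abelian_group (mpoly_ring V)"
  proof (rule abelian_groupI)
    fix x assume "x \<in> carrier (mpoly_ring V)"
    then show "\<exists>y\<in>carrier (mpoly_ring V). y \<oplus>\<^bsub>mpoly_ring V\<^esub> x = \<zero>\<^bsub>mpoly_ring V\<^esub>"
      by (intro bexI[of _ "- x"]) auto
  qed (auto simp: algebra_simps)
  show "Group.comm_monoid (mpoly_ring V)"
    by (rule comm_monoidI) (auto simp: algebra_simps)
qed (auto simp: algebra_simps)

lemma mpoly_part_iff: "p \<in> mpoly_part V d \<longleftrightarrow> p \<in> polys V \<and> homog d p"
  by (auto simp: mpoly_part_def homog_def in_keys_iff)

lemma irrelevant_ideal_iff: "p \<in> irrelevant_ideal V \<longleftrightarrow> p \<in> polys V \<and> lkp p 0 = 0"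
  by (auto simp: irrelevant_ideal_def)

lemma mpoly_ring_minus [simp]:
  fixes p q :: "('x, 'k::field) mpoly"
  assumes "p \<in> polys V" "q \<in> polys V"
  shows "p \<ominus>\<^bsub>mpoly_ring V\<^esub> q = p - q"
proof -
  interpret cring "mpoly_ring V :: ('x, 'k) mpoly ring" by (rule cring_mpoly_ring)
  have "\<ominus>\<^bsub>mpoly_ring V\<^esub> q = - q"
    using assms by (intro minus_equality) auto
  then show ?thesis by (simp add: a_minus_def)
qed

section \<open>Ideals and homogeneous ideals\<close>

text \<open>Ideals of \<open>mpoly_ring V\<close> through closure properties alone; negatives come
  from multiplication by -1.\<close>

definition pideal :: "'x set \<Rightarrow> ('x, 'k::field) mpoly set \<Rightarrow> bool" where
  "pideal V I \<longleftrightarrow> I \<subseteq> polys V \<and> 0 \<in> I \<and> (\<forall>p\<in>I. \<forall>q\<in>I. p + q \<in> I) \<and> (\<forall>r\<in>polys V. \<forall>p\<in>I. r * p \<in> I)"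

lemma pidealD:
  assumes "pideal V I"
  shows "p \<in> I \<Longrightarrow> p \<in> polys V" "0 \<in> I" "p \<in> I \<Longrightarrow> q \<in> I \<Longrightarrow> p + q \<in> I"
    "r \<in> polys V \<Longrightarrow> p \<in> I \<Longrightarrow> r * p \<in> I" "p \<in> I \<Longrightarrow> - p \<in> I"
    "p \<in> I \<Longrightarrow> q \<in> I \<Longrightarrow> p - q \<in> I"
proof -
  show un: "- p \<in> I" if "p \<in> I" for p
  proof -
    have "(- 1) * p \<in> I" using assms that polys_uminus[OF polys_one] unfolding pideal_def by blast
    then show ?thesis by simp
  qed
  show "p - q \<in> I" if "p \<in> I" "q \<in> I" for p q
    using assms that(1) un[OF that(2)] unfolding pideal_def by (metis add_uminus_conv_diff)
qed (use assms in \<open>auto simp: pideal_def\<close>)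

lemma pideal_sum: "pideal V I \<Longrightarrow> (\<And>x. x \<in> A \<Longrightarrow> f x \<in> I) \<Longrightarrow> sum f A \<in> I"
  by (induction A rule: infinite_finite_induct) (auto dest: pidealD)

lemma ideal_iff_pideal:
  fixes I :: "('x, 'k::field) mpoly set"
  shows "ideal I (mpoly_ring V) \<longleftrightarrow> pideal V I"
proof
  assume "ideal I (mpoly_ring V)"
  then interpret ideal I "mpoly_ring V" .
  show "pideal V I"
    using a_subset additive_subgroup.zero_closed[OF is_additive_subgroup]
      additive_subgroup.a_closed[OF is_additive_subgroup] I_l_closed by (auto simp: pideal_def)
next
  assume I: "pideal V I"
  interpret cring "mpoly_ring V :: ('x, 'k) mpoly ring" by (rule cring_mpoly_ring)
  show "ideal I (mpoly_ring V)"
  proof (rule idealI[OF ring_axioms])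
    show "subgroup I (add_monoid (mpoly_ring V))"
    proof (rule add.subgroupI)
      fix a assume "a \<in> I"
      moreover from this have "\<ominus>\<^bsub>mpoly_ring V\<^esub> a = - a"
        using pidealD[OF I] by (intro minus_equality) auto
      ultimately show "\<ominus>\<^bsub>mpoly_ring V\<^esub> a \<in> I" using pidealD[OF I] by simp
    qed (use pidealD[OF I] in auto)
  next
    fix a x assume "a \<in> I" and "x \<in> carrier (mpoly_ring V :: ('x, 'k) mpoly ring)"
    then show "x \<otimes>\<^bsub>mpoly_ring V\<^esub> a \<in> I" "a \<otimes>\<^bsub>mpoly_ring V\<^esub> x \<in> I"
      using pidealD(4)[OF I, of x a] by (simp_all add: mult.commute)
  qed
qed

text \<open>Homogeneity in the form in which it is used: closure under homogeneous components,
  without reference to generators.\<close>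

definition hideal :: "'x set \<Rightarrow> ('x, 'k::field) mpoly set \<Rightarrow> bool" where
  "hideal V I \<longleftrightarrow> pideal V I \<and> (\<forall>p\<in>I. \<forall>d. hcomp d p \<in> I)"

text \<open>The elements of I whose components all lie in I form an ideal containing the homogeneous
  generators, hence all of I. Closure under multiplication is checked term by term in the factor,
  since a term merely shifts components.\<close>

lemma homogeneous_ideal_imp_hideal:
  fixes I :: "('x, 'k::field) mpoly set"
  assumes "homogeneous_ideal V I" shows "hideal V I"
proof -
  interpret cring "mpoly_ring V :: ('x, 'k) mpoly ring" by (rule cring_mpoly_ring)
  obtain G where G: "G \<subseteq> (\<Union>d. mpoly_part V d)" and I: "I = Idl\<^bsub>mpoly_ring V\<^esub> G"
    using assms by (auto simp: homogeneous_ideal_def)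
  have GP: "G \<subseteq> carrier (mpoly_ring V :: ('x, 'k) mpoly ring)" using G by (auto simp: mpoly_part_iff)
  have pI: "pideal V I" using genideal_ideal[OF GP] I ideal_iff_pideal by blast
  let ?K = "{p \<in> I. \<forall>d. hcomp d p \<in> I}"
  have "pideal V ?K"
    unfolding pideal_def
  proof (intro conjI ballI)
    fix r p :: "('x, 'k) mpoly" assume r: "r \<in> polys V" and p: "p \<in> ?K"
    have "hcomp d (r * p) \<in> I" for d
      using r
    proof (induction r rule: polys_induct)
      case (single m c)
      have "homog (int (mdeg m)) (mterm m c)" by (simp add: homog_term)
      from hcomp_mult_homog[OF this, of d p] show ?case
        using p single pidealD(4)[OF pI, of "mterm m c"] by auto
    qed (auto simp: hcomp_add algebra_simps dest: pidealD(3)[OF pI])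
    then show "r * p \<in> ?K" using r p pidealD(4)[OF pI] by auto
  qed (use pidealD[OF pI] in \<open>auto simp: hcomp_add\<close>)
  moreover have "G \<subseteq> ?K"
  proof
    fix g assume g: "g \<in> G"
    then obtain e where "homog e g" using G mpoly_part_iff by blast
    moreover have "g \<in> I" using genideal_self[OF GP] g I by auto
    ultimately show "g \<in> ?K" using pidealD(2)[OF pI] by (auto simp: hcomp_homog)
  qed
  ultimately have "I \<subseteq> ?K" using genideal_minimal ideal_iff_pideal I by blast
  then show ?thesis using pI by (auto simp: hideal_def)
qed

section \<open>Homomorphisms of modules\<close>

lemma mod_homI:
  assumes "\<And>x. x \<in> carrier M \<Longrightarrow> f x \<in> carrier N"
    and "\<And>x y. x \<in> carrier M \<Longrightarrow> y \<in> carrier M \<Longrightarrow> f (x \<oplus>\<^bsub>M\<^esub> y) = f x \<oplus>\<^bsub>N\<^esub> f y"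
    and "\<And>r x. r \<in> carrier R \<Longrightarrow> x \<in> carrier M \<Longrightarrow> f (r \<odot>\<^bsub>M\<^esub> x) = r \<odot>\<^bsub>N\<^esub> f x"
  shows "f \<in> mod_hom R M N"
  using assms by (auto simp: mod_hom_def)

lemma mod_homD:
  assumes "f \<in> mod_hom R M N"
  shows "x \<in> carrier M \<Longrightarrow> f x \<in> carrier N"
    and "x \<in> carrier M \<Longrightarrow> y \<in> carrier M \<Longrightarrow> f (x \<oplus>\<^bsub>M\<^esub> y) = f x \<oplus>\<^bsub>N\<^esub> f y"
    and "r \<in> carrier R \<Longrightarrow> x \<in> carrier M \<Longrightarrow> f (r \<odot>\<^bsub>M\<^esub> x) = r \<odot>\<^bsub>N\<^esub> f x"
  using assms by (auto simp: mod_hom_def)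

lemma mod_hom_compose:
  "f \<in> mod_hom R L M \<Longrightarrow> g \<in> mod_hom R M N \<Longrightarrow> (\<lambda>x. g (f x)) \<in> mod_hom R L N"
  by (rule mod_homI) (simp_all add: mod_homD)

lemma mod_hom_zero:
  assumes "f \<in> mod_hom R M N" "module R M" "module R N"
  shows "f \<zero>\<^bsub>M\<^esub> = \<zero>\<^bsub>N\<^esub>"
proof -
  interpret M: module R M by fact
  interpret N: module R N by fact
  have "f (\<zero>\<^bsub>R\<^esub> \<odot>\<^bsub>M\<^esub> \<zero>\<^bsub>M\<^esub>) = \<zero>\<^bsub>R\<^esub> \<odot>\<^bsub>N\<^esub> f \<zero>\<^bsub>M\<^esub>"
    by (rule mod_homD[OF assms(1)]) auto
  then show ?thesis using mod_homD(1)[OF assms(1), of "\<zero>\<^bsub>M\<^esub>"] by simp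
qed

lemma mod_hom_diff:
  assumes f: "f \<in> mod_hom R M N" and g: "g \<in> mod_hom R M N" and M: "module R M" and N: "module R N"
  shows "(\<lambda>x. f x \<ominus>\<^bsub>N\<^esub> g x) \<in> mod_hom R M N"
proof (rule mod_homI)
  interpret N: module R N by fact
  interpret M: module R M by fact
  show "f x \<ominus>\<^bsub>N\<^esub> g x \<in> carrier N" if "x \<in> carrier M" for x
    using that mod_homD(1)[OF f] mod_homD(1)[OF g] by simp
  show "f (x \<oplus>\<^bsub>M\<^esub> y) \<ominus>\<^bsub>N\<^esub> g (x \<oplus>\<^bsub>M\<^esub> y) = (f x \<ominus>\<^bsub>N\<^esub> g x) \<oplus>\<^bsub>N\<^esub> (f y \<ominus>\<^bsub>N\<^esub> g y)"
    if "x \<in> carrier M" "y \<in> carrier M" for x y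
    using that by (simp add: mod_homD[OF f] mod_homD[OF g] a_minus_def N.minus_add N.a_ac)
  show "f (r \<odot>\<^bsub>M\<^esub> x) \<ominus>\<^bsub>N\<^esub> g (r \<odot>\<^bsub>M\<^esub> x) = r \<odot>\<^bsub>N\<^esub> (f x \<ominus>\<^bsub>N\<^esub> g x)"
    if "r \<in> carrier R" "x \<in> carrier M" for r x
    using that by (simp add: mod_homD[OF f] mod_homD[OF g] a_minus_def N.smult_r_minus N.smult_r_distr)
qed

lemma mod_hom_minus:
  assumes f: "f \<in> mod_hom R M N" and "module R M" and "module R N"
    and xy: "x \<in> carrier M" "y \<in> carrier M"
  shows "f (x \<ominus>\<^bsub>M\<^esub> y) = f x \<ominus>\<^bsub>N\<^esub> f y"
proof -
  interpret M: module R M by fact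
  interpret N: module R N by fact
  have "f (x \<ominus>\<^bsub>M\<^esub> y) \<oplus>\<^bsub>N\<^esub> f y = f x"
    using mod_homD(2)[OF f, of "x \<ominus>\<^bsub>M\<^esub> y" y] xy
    by (simp add: a_minus_def M.a_assoc M.l_neg)
  then have "f x \<ominus>\<^bsub>N\<^esub> f y = (f (x \<ominus>\<^bsub>M\<^esub> y) \<oplus>\<^bsub>N\<^esub> f y) \<ominus>\<^bsub>N\<^esub> f y" by simp
  also have "\<dots> = f (x \<ominus>\<^bsub>M\<^esub> y)"
    using xy mod_homD(1)[OF f] by (simp add: a_minus_def N.a_assoc N.r_neg)
  finally show ?thesis by simp
qed

section \<open>Free and projective modules\<close>

definition fbasis :: "('a, 'r) ring_scheme \<Rightarrow> 'i \<Rightarrow> 'i \<Rightarrow> 'a" where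
  "fbasis R k = (\<lambda>i. if i = k then \<one>\<^bsub>R\<^esub> else \<zero>\<^bsub>R\<^esub>)"

lemma free_module_simps:
  "v \<in> carrier (free_module R A) \<longleftrightarrow>
     (\<forall>k. v k \<in> carrier R) \<and> finite {k. v k \<noteq> \<zero>\<^bsub>R\<^esub>} \<and> {k. v k \<noteq> \<zero>\<^bsub>R\<^esub>} \<subseteq> A"
  "\<zero>\<^bsub>free_module R A\<^esub> = (\<lambda>k. \<zero>\<^bsub>R\<^esub>)"
  "v \<oplus>\<^bsub>free_module R A\<^esub> w = (\<lambda>k. v k \<oplus>\<^bsub>R\<^esub> w k)"
  "r \<odot>\<^bsub>free_module R A\<^esub> v = (\<lambda>k. r \<otimes>\<^bsub>R\<^esub> v k)"
  by (auto simp: free_module_def)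

lemma (in cring) fbasis_in: "k \<in> A \<Longrightarrow> fbasis R k \<in> carrier (free_module R A)"
  by (auto simp: free_module_simps fbasis_def)

lemma (in cring) free_module_smult_closed:
  assumes "r \<in> carrier R" "v \<in> carrier (free_module R A)"
  shows "r \<odot>\<^bsub>free_module R A\<^esub> v \<in> carrier (free_module R A)"
proof -
  have "{k. r \<otimes> v k \<noteq> \<zero>} \<subseteq> {k. v k \<noteq> \<zero>}" using assms by auto
  then show ?thesis using assms by (auto simp: free_module_simps intro: finite_subset)
qed

lemma (in cring) free_module_induct [consumes 1, case_names zero add]:
  assumes v: "v \<in> carrier (free_module R A)"
    and 0: "Q \<zero>\<^bsub>free_module R A\<^esub>"
    and a: "\<And>v k r. v \<in> carrier (free_module R A) \<Longrightarrow> k \<in> A \<Longrightarrow> r \<in> carrier R \<Longrightarrow> Q v \<Longrightarrow>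
        Q (v \<oplus>\<^bsub>free_module R A\<^esub> (r \<odot>\<^bsub>free_module R A\<^esub> fbasis R k))"
  shows "Q v"
proof -
  have "finite K \<Longrightarrow> v \<in> carrier (free_module R A) \<Longrightarrow> {k. v k \<noteq> \<zero>} \<subseteq> K \<Longrightarrow> Q v" for K v
  proof (induction K arbitrary: v rule: finite_induct)
    case empty
    then have "v = \<zero>\<^bsub>free_module R A\<^esub>" by (auto simp: free_module_simps)
    then show ?case using 0 by simp
  next
    case (insert k K)
    show ?case
    proof (cases "v k = \<zero>")
      case True
      then show ?thesis using insert by auto
    next
      case False
      let ?w = "v(k := \<zero>)"
      have kA: "k \<in> A" using False insert.prems by (auto simp: free_module_simps)
      have "{i. ?w i \<noteq> \<zero>} \<subseteq> {i. v i \<noteq> \<zero>}" by auto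
      then have w: "?w \<in> carrier (free_module R A)"
        using insert.prems(1) by (auto simp: free_module_simps intro: finite_subset)
      have "Q ?w" using insert.prems by (intro insert.IH w) auto
      then have "Q (?w \<oplus>\<^bsub>free_module R A\<^esub> (v k \<odot>\<^bsub>free_module R A\<^esub> fbasis R k))"
        using a[OF w kA, of "v k"] insert.prems(1) by (auto simp: free_module_simps)
      moreover have "?w \<oplus>\<^bsub>free_module R A\<^esub> (v k \<odot>\<^bsub>free_module R A\<^esub> fbasis R k) = v"
        using insert.prems(1) by (auto simp: free_module_simps fbasis_def fun_eq_iff)
      ultimately show ?thesis by simp
    qed
  qed
  from this[of "{k. v k \<noteq> \<zero>}" v] v show ?thesis by (auto simp: free_module_simps)
qed

lemma free_module_hom_eq:
  assumes "cring R" and N: "module R N"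
    and f: "f \<in> mod_hom R (free_module R A) N" and g: "g \<in> mod_hom R (free_module R A) N"
    and eq: "\<And>k. k \<in> A \<Longrightarrow> f (fbasis R k) = g (fbasis R k)"
    and v: "v \<in> carrier (free_module R A)"
  shows "f v = g v"
proof -
  interpret cring R by fact
  interpret N: module R N by fact
  let ?F = "free_module R A"
  \<comment> \<open>Only N is known to be a module here, so this follows from 0 + 0 = 0 in the free
    module and cancellation in N.\<close>
  have zero: "h \<zero>\<^bsub>?F\<^esub> = \<zero>\<^bsub>N\<^esub>" if h: "h \<in> mod_hom R ?F N" for h
  proof -
    have z: "\<zero>\<^bsub>?F\<^esub> \<in> carrier ?F" by (auto simp: free_module_simps)
    have "\<zero>\<^bsub>?F\<^esub> \<oplus>\<^bsub>?F\<^esub> \<zero>\<^bsub>?F\<^esub> = \<zero>\<^bsub>?F\<^esub>" by (simp add: free_module_simps)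
    then have "h \<zero>\<^bsub>?F\<^esub> = h \<zero>\<^bsub>?F\<^esub> \<oplus>\<^bsub>N\<^esub> h \<zero>\<^bsub>?F\<^esub>" using mod_homD(2)[OF h z z] by simp
    then show ?thesis using mod_homD(1)[OF h z] by (metis N.add.l_cancel_one')
  qed
  show ?thesis using v
  proof (induction v rule: free_module_induct)
    case (add v k r)
    let ?u = "r \<odot>\<^bsub>?F\<^esub> fbasis R k"
    have b: "fbasis R k \<in> carrier ?F" by (rule fbasis_in[OF add.hyps(2)])
    have u: "?u \<in> carrier ?F" by (rule free_module_smult_closed[OF add.hyps(3) b])
    show ?case
      unfolding  mod_homD(2)[OF f add.hyps(1) u] mod_homD(2)[OF g add.hyps(1) u]
        mod_homD(3)[OF f add.hyps(3) b] mod_homD(3)[OF g add.hyps(3) b]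
      using add.IH eq[OF add.hyps(2)] by simp
  qed (simp add: zero f g)
qed

lemma free_module_hom_ex:
  assumes "module R L" and y: "\<And>k. k \<in> A \<Longrightarrow> y k \<in> carrier L"
  shows "\<exists>\<chi>\<in>mod_hom R (free_module R A) L. \<forall>k\<in>A. \<chi> (fbasis R k) = y k"
proof -
  interpret L: module R L by fact
  let ?F = "free_module R A"
  define \<chi> where "\<chi> v = finsum L (\<lambda>k. v k \<odot>\<^bsub>L\<^esub> y k) {k. v k \<noteq> \<zero>\<^bsub>R\<^esub>}" for v
  \<comment> \<open>A sum or a multiple may have smaller support than its ingredients, so \<chi> has
    to be evaluated over any finite set containing the support.\<close>
  have ext: "\<chi> v = finsum L (\<lambda>k. v k \<odot>\<^bsub>L\<^esub> y k) B"
    if "v \<in> carrier ?F" "finite B" "{k. v k \<noteq> \<zero>\<^bsub>R\<^esub>} \<subseteq> B" "B \<subseteq> A" for v B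
    unfolding \<chi>_def using that y
    by (intro L.add.finprod_mono_neutral_cong_left) (auto simp: free_module_simps)
  have "\<chi> \<in> mod_hom R ?F L"
  proof (rule mod_homI)
    show "\<chi> v \<in> carrier L" if "v \<in> carrier ?F" for v
      unfolding \<chi>_def using that y by (intro L.finsum_closed) (auto simp: free_module_simps)
  next
    fix v w assume v: "v \<in> carrier ?F" and w: "w \<in> carrier ?F"
    let ?B = "{k. v k \<noteq> \<zero>\<^bsub>R\<^esub>} \<union> {k. w k \<noteq> \<zero>\<^bsub>R\<^esub>}"
    have B: "finite ?B" "?B \<subseteq> A" using v w by (auto simp: free_module_simps)
    have sub: "{k. v k \<oplus>\<^bsub>R\<^esub> w k \<noteq> \<zero>\<^bsub>R\<^esub>} \<subseteq> ?B" by auto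
    have vw: "v \<oplus>\<^bsub>?F\<^esub> w \<in> carrier ?F"
      using v w finite_subset[OF sub B(1)] sub B(2) by (auto simp: free_module_simps)
    have "\<chi> (v \<oplus>\<^bsub>?F\<^esub> w) = finsum L (\<lambda>k. (v \<oplus>\<^bsub>?F\<^esub> w) k \<odot>\<^bsub>L\<^esub> y k) ?B"
      using sub by (intro ext vw B) (auto simp: free_module_simps)
    also have "\<dots> = finsum L (\<lambda>k. v k \<odot>\<^bsub>L\<^esub> y k \<oplus>\<^bsub>L\<^esub> w k \<odot>\<^bsub>L\<^esub> y k) ?B"
      using v w y B by (intro L.finsum_cong') (auto simp: free_module_simps L.smult_l_distr)
    also have "\<dots> = \<chi> v \<oplus>\<^bsub>L\<^esub> \<chi> w"
      using v w y B by (subst L.finsum_addf) (auto simp: free_module_simps ext[OF v B(1) _ B(2)] ext[OF w B(1) _ B(2)])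
    finally show "\<chi> (v \<oplus>\<^bsub>?F\<^esub> w) = \<chi> v \<oplus>\<^bsub>L\<^esub> \<chi> w" .
  next
    fix r v assume r: "r \<in> carrier R" and v: "v \<in> carrier ?F"
    let ?B = "{k. v k \<noteq> \<zero>\<^bsub>R\<^esub>}"
    have B: "finite ?B" "?B \<subseteq> A" using v by (auto simp: free_module_simps)
    have "\<chi> (r \<odot>\<^bsub>?F\<^esub> v) = finsum L (\<lambda>k. (r \<odot>\<^bsub>?F\<^esub> v) k \<odot>\<^bsub>L\<^esub> y k) ?B"
      using L.free_module_smult_closed[OF r v] r v B by (intro ext) (auto simp: free_module_simps)
    also have "\<dots> = finsum L (\<lambda>k. r \<odot>\<^bsub>L\<^esub> (v k \<odot>\<^bsub>L\<^esub> y k)) ?B"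
      using r v y B by (intro L.finsum_cong') (auto simp: free_module_simps L.smult_assoc1)
    also have "\<dots> = r \<odot>\<^bsub>L\<^esub> \<chi> v"
      unfolding \<chi>_def using r v y B by (subst L.finsum_smult_ldistr) (auto simp: free_module_simps)
    finally show "\<chi> (r \<odot>\<^bsub>?F\<^esub> v) = r \<odot>\<^bsub>L\<^esub> \<chi> v" .
  qed
  moreover have "\<chi> (fbasis R k) = y k" if "k \<in> A" for k
  proof -
    have "\<chi> (fbasis R k) = finsum L (\<lambda>i. fbasis R k i \<odot>\<^bsub>L\<^esub> y i) {k}"
      using that L.fbasis_in by (intro ext) (auto simp: fbasis_def)
    also have "\<dots> = y k" using y that by (simp add: fbasis_def)
    finally show ?thesis .
  qed
  ultimately show ?thesis by blast
qed

text \<open>Preimages may be chosen freely on the basis; the two maps into N then agree on the basis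
  and hence everywhere.\<close>

lemma free_module_lift:
  assumes "module R L" "module R N"
    and \<phi>: "\<phi> \<in> mod_hom R (free_module R A) N" and \<psi>: "\<psi> \<in> mod_hom R L N"
    and im: "\<And>x. x \<in> carrier (free_module R A) \<Longrightarrow> \<phi> x \<in> \<psi> ` carrier L"
  shows "\<exists>\<chi>\<in>mod_hom R (free_module R A) L. \<forall>x\<in>carrier (free_module R A). \<psi> (\<chi> x) = \<phi> x"
proof -
  interpret L: module R L by fact
  have "\<forall>k\<in>A. \<exists>y\<in>carrier L. \<psi> y = \<phi> (fbasis R k)"
    using im L.fbasis_in by (metis imageE)
  then obtain y where y: "\<And>k. k \<in> A \<Longrightarrow> y k \<in> carrier L \<and> \<psi> (y k) = \<phi> (fbasis R k)"
    by metis
  obtain \<chi> where \<chi>: "\<chi> \<in> mod_hom R (free_module R A) L" "\<forall>k\<in>A. \<chi> (fbasis R k) = y k"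
    using free_module_hom_ex[OF assms(1), of A y] y by blast
  have "\<psi> (\<chi> x) = \<phi> x" if "x \<in> carrier (free_module R A)" for x
    using free_module_hom_eq[OF L.is_cring assms(2) mod_hom_compose[OF \<chi>(1) \<psi>] \<phi> _ that] \<chi>(2) y by simp
  then show ?thesis using \<chi>(1) by blast
qed

text \<open>The lift of \<phi> \<circ> \<pi> on the free module, composed with \<iota>, lifts \<phi>
  because \<pi> \<circ> \<iota> is the identity.\<close>

lemma projective_module_lift:
  fixes P :: "('a, 'p, 'm) module_scheme"
  assumes "projective_module R P" "module R L" "module R N"
    and \<phi>: "\<phi> \<in> mod_hom R P N" and \<psi>: "\<psi> \<in> mod_hom R L N"
    and im: "\<And>x. x \<in> carrier P \<Longrightarrow> \<phi> x \<in> \<psi> ` carrier L"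
  shows "\<exists>\<chi>\<in>mod_hom R P L. \<forall>x\<in>carrier P. \<psi> (\<chi> x) = \<phi> x"
proof -
  obtain A :: "'p set" and \<iota> \<pi> where \<iota>: "\<iota> \<in> mod_hom R P (free_module R A)" and \<pi>: "\<pi> \<in> mod_hom R (free_module R A) P"
    and \<pi>\<iota>: "\<And>x. x \<in> carrier P \<Longrightarrow> \<pi> (\<iota> x) = x"
    using assms(1) by (auto simp: projective_module_def)
  obtain \<chi> where \<chi>: "\<chi> \<in> mod_hom R (free_module R A) L"
      "\<forall>x\<in>carrier (free_module R A). \<psi> (\<chi> x) = \<phi> (\<pi> x)"
    using free_module_lift[OF assms(2,3) mod_hom_compose[OF \<pi> \<phi>] \<psi>] im mod_homD(1)[OF \<pi>] by blast
  show ?thesis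
    using mod_hom_compose[OF \<iota> \<chi>(1)] \<chi>(2) mod_homD(1)[OF \<iota>] \<pi>\<iota>
    by (intro bexI[of _ "\<lambda>x. \<chi> (\<iota> x)"]) auto
qed

section \<open>Comparison of resolutions\<close>

lemma resolutionD:
  assumes "resolution R M F \<epsilon> \<delta>"
  shows "\<epsilon> \<in> mod_hom R (F 0) M" "\<delta> i \<in> mod_hom R (F (Suc i)) (F i)"
    "\<epsilon> ` carrier (F 0) = carrier M"
    "x \<in> carrier (F (Suc 0)) \<Longrightarrow> \<epsilon> (\<delta> 0 x) = \<zero>\<^bsub>M\<^esub>"
    "y \<in> carrier (F 0) \<Longrightarrow> \<epsilon> y = \<zero>\<^bsub>M\<^esub> \<Longrightarrow> y \<in> \<delta> 0 ` carrier (F (Suc 0))"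
    "z \<in> carrier (F (Suc (Suc i))) \<Longrightarrow> \<delta> i (\<delta> (Suc i) z) = \<zero>\<^bsub>F i\<^esub>"
    "w \<in> carrier (F (Suc i)) \<Longrightarrow> \<delta> i w = \<zero>\<^bsub>F i\<^esub> \<Longrightarrow> w \<in> \<delta> (Suc i) ` carrier (F (Suc (Suc i)))"
proof -
  have ker0: "\<delta> 0 ` carrier (F (Suc 0)) = {x \<in> carrier (F 0). \<epsilon> x = \<zero>\<^bsub>M\<^esub>}"
    and ker: "\<delta> (Suc i) ` carrier (F (Suc (Suc i))) = {x \<in> carrier (F (Suc i)). \<delta> i x = \<zero>\<^bsub>F i\<^esub>}"
    using assms unfolding resolution_def a_kernel_def' by simp_all
  show "\<epsilon> \<in> mod_hom R (F 0) M" "\<delta> i \<in> mod_hom R (F (Suc i)) (F i)"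
    "\<epsilon> ` carrier (F 0) = carrier M"
    using assms unfolding resolution_def by simp_all
  show "x \<in> carrier (F (Suc 0)) \<Longrightarrow> \<epsilon> (\<delta> 0 x) = \<zero>\<^bsub>M\<^esub>"
    using imageI[of x "carrier (F (Suc 0))" "\<delta> 0"] unfolding ker0 by simp
  show "y \<in> carrier (F 0) \<Longrightarrow> \<epsilon> y = \<zero>\<^bsub>M\<^esub> \<Longrightarrow> y \<in> \<delta> 0 ` carrier (F (Suc 0))"
    unfolding ker0 by simp
  show "z \<in> carrier (F (Suc (Suc i))) \<Longrightarrow> \<delta> i (\<delta> (Suc i) z) = \<zero>\<^bsub>F i\<^esub>"
    using imageI[of z "carrier (F (Suc (Suc i)))" "\<delta> (Suc i)"] unfolding ker by simp
  show "w \<in> carrier (F (Suc i)) \<Longrightarrow> \<delta> i w = \<zero>\<^bsub>F i\<^esub> \<Longrightarrow> w \<in> \<delta> (Suc i) ` carrier (F (Suc (Suc i)))"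
    unfolding ker by simp
qed

text \<open>The sets \<open>H i\<close> allow for chain maps with extra structure, such as degree-preserving ones.\<close>

lemma chain_map_ex:
  assumes P: "resolution R M P \<epsilon> \<delta>" and Q: "resolution R M Q \<epsilon>' \<delta>'"
    and mods: "\<And>i. module R (P i)" "\<And>i. module R (Q i)"
    and H: "\<And>i. H i \<subseteq> mod_hom R (P i) (Q i)"
    and lift_0: "\<exists>\<chi>\<in>H 0. \<forall>x\<in>carrier (P 0). \<epsilon>' (\<chi> x) = \<epsilon> x"
    and lift_Suc: "\<And>i \<phi>. \<phi> \<in> H i \<Longrightarrow>
      (\<And>x. x \<in> carrier (P (Suc i)) \<Longrightarrow> \<phi> (\<delta> i x) \<in> \<delta>' i ` carrier (Q (Suc i))) \<Longrightarrow>
      \<exists>\<chi>\<in>H (Suc i). \<forall>x\<in>carrier (P (Suc i)). \<delta>' i (\<chi> x) = \<phi> (\<delta> i x)"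
  obtains f where "\<And>i. f i \<in> H i" "\<And>x. x \<in> carrier (P 0) \<Longrightarrow> \<epsilon>' (f 0 x) = \<epsilon> x"
    "\<And>i x. x \<in> carrier (P (Suc i)) \<Longrightarrow> \<delta>' i (f (Suc i) x) = f i (\<delta> i x)"
proof -
  \<comment> \<open>The last conjunct is exactly what \<open>lift_Suc\<close> asks for, so each step
    of the dependent choice looks only at the map just constructed.\<close>
  let ?Good = "\<lambda>i \<phi>. \<phi> \<in> H i \<and> (i = 0 \<longrightarrow> (\<forall>x\<in>carrier (P 0). \<epsilon>' (\<phi> x) = \<epsilon> x)) \<and>
    (\<forall>x\<in>carrier (P (Suc i)). \<phi> (\<delta> i x) \<in> \<delta>' i ` carrier (Q (Suc i)))"
  let ?Step = "\<lambda>i \<phi> \<chi>. \<forall>x\<in>carrier (P (Suc i)). \<delta>' i (\<chi> x) = \<phi> (\<delta> i x)"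
  have "\<exists>f. \<forall>i. ?Good i (f i) \<and> ?Step i (f i) (f (Suc i))"
  proof (rule dependent_nat_choice)
    obtain \<chi> where \<chi>: "\<chi> \<in> H 0" "\<forall>x\<in>carrier (P 0). \<epsilon>' (\<chi> x) = \<epsilon> x" using lift_0 by blast
    have "\<chi> (\<delta> 0 x) \<in> \<delta>' 0 ` carrier (Q (Suc 0))" if x: "x \<in> carrier (P (Suc 0))" for x
    proof (rule resolutionD(5)[OF Q])
      have d: "\<delta> 0 x \<in> carrier (P 0)" using mod_homD(1)[OF resolutionD(2)[OF P]] x by blast
      then show "\<chi> (\<delta> 0 x) \<in> carrier (Q 0)" using mod_homD(1)[OF subsetD[OF H \<chi>(1)]] by blast
      show "\<epsilon>' (\<chi> (\<delta> 0 x)) = \<zero>\<^bsub>M\<^esub>" using \<chi>(2) d resolutionD(4)[OF P x] by simp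
    qed
    then show "\<exists>\<phi>. ?Good 0 \<phi>" using \<chi> by blast
  next
    fix \<phi> i assume good: "?Good i \<phi>"
    then obtain \<chi> where \<chi>: "\<chi> \<in> H (Suc i)" "?Step i \<phi> \<chi>" using lift_Suc[of \<phi> i] by blast
    have "\<chi> (\<delta> (Suc i) x) \<in> \<delta>' (Suc i) ` carrier (Q (Suc (Suc i)))"
      if x: "x \<in> carrier (P (Suc (Suc i)))" for x
    proof (rule resolutionD(7)[OF Q])
      have d: "\<delta> (Suc i) x \<in> carrier (P (Suc i))" using mod_homD(1)[OF resolutionD(2)[OF P]] x by blast
      then show "\<chi> (\<delta> (Suc i) x) \<in> carrier (Q (Suc i))" using mod_homD(1)[OF subsetD[OF H \<chi>(1)]] by blast
      have "\<phi> \<in> mod_hom R (P i) (Q i)" using good H by blast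
      from mod_hom_zero[OF this mods]
      show "\<delta>' i (\<chi> (\<delta> (Suc i) x)) = \<zero>\<^bsub>Q i\<^esub>" using \<chi>(2) d resolutionD(6)[OF P x] by simp
    qed
    then show "\<exists>\<chi>. ?Good (Suc i) \<chi> \<and> ?Step i \<phi> \<chi>" using \<chi> by blast
  qed
  then obtain f where "\<forall>i. ?Good i (f i) \<and> ?Step i (f i) (f (Suc i))" ..
  then show ?thesis by (intro that[of f]) simp_all
qed

text \<open>The usual homotopy: h (i + 1) lifts \<theta> (i + 1) - h i \<circ> \<delta> i, whose
  values are cycles. The assumption \<open>lift\<close> stands for projectivity of the modules F
  i.\<close>

lemma null_homotopy_ex:
  assumes F: "resolution R M F \<epsilon> \<delta>"
    and mods: "\<And>i. module R (F i)"
    and \<theta>: "\<And>i. \<theta> i \<in> mod_hom R (F i) (F i)"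
    and \<theta>0: "\<And>x. x \<in> carrier (F 0) \<Longrightarrow> \<epsilon> (\<theta> 0 x) = \<zero>\<^bsub>M\<^esub>"
    and \<theta>S: "\<And>i x. x \<in> carrier (F (Suc i)) \<Longrightarrow> \<delta> i (\<theta> (Suc i) x) = \<theta> i (\<delta> i x)"
    and lift: "\<And>i \<phi>. \<phi> \<in> mod_hom R (F i) (F i) \<Longrightarrow>
      (\<And>x. x \<in> carrier (F i) \<Longrightarrow> \<phi> x \<in> \<delta> i ` carrier (F (Suc i))) \<Longrightarrow>
      \<exists>\<chi>\<in>mod_hom R (F i) (F (Suc i)). \<forall>x\<in>carrier (F i). \<delta> i (\<chi> x) = \<phi> x"
  obtains h where "\<And>i. h i \<in> mod_hom R (F i) (F (Suc i))"
    "\<And>x. x \<in> carrier (F 0) \<Longrightarrow> \<theta> 0 x = \<delta> 0 (h 0 x)"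
    "\<And>i x. x \<in> carrier (F (Suc i)) \<Longrightarrow>
       \<theta> (Suc i) x = \<delta> (Suc i) (h (Suc i) x) \<oplus>\<^bsub>F (Suc i)\<^esub> h i (\<delta> i x)"
proof -
  \<comment> \<open>The last conjunct is the homotopy identity for i evaluated on boundaries, where
    its second summand vanishes; it makes the values of \<theta> (i + 1) - h i \<circ> \<delta> i
    cycles.\<close>
  let ?Good = "\<lambda>i h. h \<in> mod_hom R (F i) (F (Suc i)) \<and> (i = 0 \<longrightarrow> (\<forall>x\<in>carrier (F 0). \<theta> 0 x = \<delta> 0 (h x))) \<and>
    (\<forall>x\<in>carrier (F (Suc i)). \<delta> i (h (\<delta> i x)) = \<theta> i (\<delta> i x))"
  let ?Step = "\<lambda>i h h'. \<forall>x\<in>carrier (F (Suc i)).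
    \<theta> (Suc i) x \<ominus>\<^bsub>F (Suc i)\<^esub> h (\<delta> i x) = \<delta> (Suc i) (h' x)"
  have \<delta>c: "\<delta> i x \<in> carrier (F i)" if "x \<in> carrier (F (Suc i))" for i x
    using mod_homD(1)[OF resolutionD(2)[OF F]] that by blast
  have "\<exists>h. \<forall>i. ?Good i (h i) \<and> ?Step i (h i) (h (Suc i))"
  proof (rule dependent_nat_choice)
    have "\<theta> 0 x \<in> \<delta> 0 ` carrier (F (Suc 0))" if "x \<in> carrier (F 0)" for x
      using resolutionD(5)[OF F mod_homD(1)[OF \<theta> that] \<theta>0[OF that]] .
    then obtain \<chi> where "\<chi> \<in> mod_hom R (F 0) (F (Suc 0))" "\<forall>x\<in>carrier (F 0). \<delta> 0 (\<chi> x) = \<theta> 0 x"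
      using lift[OF \<theta>[of 0]] by blast
    then show "\<exists>h. ?Good 0 h" using \<delta>c by (intro exI[of _ \<chi>]) simp
  next
    fix h i assume good: "?Good i h"
    interpret Fi: module R "F i" by (rule mods)
    interpret FSi: module R "F (Suc i)" by (rule mods)
    interpret FSSi: module R "F (Suc (Suc i))" by (rule mods)
    let ?\<phi> = "\<lambda>x. \<theta> (Suc i) x \<ominus>\<^bsub>F (Suc i)\<^esub> h (\<delta> i x)"
    have hd: "(\<lambda>x. h (\<delta> i x)) \<in> mod_hom R (F (Suc i)) (F (Suc i))"
      using mod_hom_compose[OF resolutionD(2)[OF F]] good by blast
    have \<phi>: "?\<phi> \<in> mod_hom R (F (Suc i)) (F (Suc i))"
      using mod_hom_diff[OF \<theta> hd mods mods] .
    have "?\<phi> x \<in> \<delta> (Suc i) ` carrier (F (Suc (Suc i)))" if x: "x \<in> carrier (F (Suc i))" for x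
    proof (rule resolutionD(7)[OF F])
      show "?\<phi> x \<in> carrier (F (Suc i))" using mod_homD(1)[OF \<phi> x] .
      have "\<delta> i (?\<phi> x) = \<delta> i (\<theta> (Suc i) x) \<ominus>\<^bsub>F i\<^esub> \<delta> i (h (\<delta> i x))"
        using mod_homD(1)[OF \<theta> x] mod_homD(1)[OF hd x]
        by (intro mod_hom_minus[OF resolutionD(2)[OF F] mods mods])
      also have "\<dots> = \<theta> i (\<delta> i x) \<ominus>\<^bsub>F i\<^esub> \<theta> i (\<delta> i x)" using \<theta>S good x by simp
      also have "\<dots> = \<zero>\<^bsub>F i\<^esub>" using mod_homD(1)[OF \<theta> \<delta>c[OF x]] by (simp add: Fi.M.r_neg a_minus_def)
      finally show "\<delta> i (?\<phi> x) = \<zero>\<^bsub>F i\<^esub>" .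
    qed
    then obtain \<chi> where \<chi>: "\<chi> \<in> mod_hom R (F (Suc i)) (F (Suc (Suc i)))"
        "\<forall>x\<in>carrier (F (Suc i)). \<delta> (Suc i) (\<chi> x) = ?\<phi> x"
      using lift[OF \<phi>] by blast
    have "\<delta> (Suc i) (\<chi> (\<delta> (Suc i) x)) = \<theta> (Suc i) (\<delta> (Suc i) x)"
      if x: "x \<in> carrier (F (Suc (Suc i)))" for x
    proof -
      have "h \<zero>\<^bsub>F i\<^esub> = \<zero>\<^bsub>F (Suc i)\<^esub>" using mod_hom_zero[of h] mods good by blast
      then show ?thesis
        using \<chi>(2) \<delta>c[OF x] resolutionD(6)[OF F x] mod_homD(1)[OF \<theta> \<delta>c[OF x]]
        by (simp add: a_minus_def)
    qed
    then show "\<exists>h'. ?Good (Suc i) h' \<and> ?Step i h h'" using \<chi> by (intro exI[of _ \<chi>]) simp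
  qed
  then obtain h where "\<forall>i. ?Good i (h i) \<and> ?Step i (h i) (h (Suc i))" ..
  then have h: "\<And>i. ?Good i (h i)" "\<And>i. ?Step i (h i) (h (Suc i))" by simp_all
  show ?thesis
  proof (rule that)
    fix i x assume x: "x \<in> carrier (F (Suc i))"
    interpret FSi: module R "F (Suc i)" by (rule mods)
    have "h i (\<delta> i x) \<in> carrier (F (Suc i))" 
      using mod_homD(1)[OF conjunct1[OF h(1)] \<delta>c[OF x]] .
    moreover have "\<theta> (Suc i) x \<in> carrier (F (Suc i))" using mod_homD(1)[OF \<theta> x] .
    ultimately have "\<theta> (Suc i) x = (\<theta> (Suc i) x \<ominus>\<^bsub>F (Suc i)\<^esub> h i (\<delta> i x)) \<oplus>\<^bsub>F (Suc i)\<^esub> h i (\<delta> i x)"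
      by (simp add: a_minus_def FSi.M.a_assoc FSi.M.l_neg)
    then show "\<theta> (Suc i) x = \<delta> (Suc i) (h (Suc i) x) \<oplus>\<^bsub>F (Suc i)\<^esub> h i (\<delta> i x)"
      using h(2)[of i] x by simp
  qed (use h in auto)
qed

section \<open>The modules of the statement\<close>

definition bvec :: "nat \<Rightarrow> ('x, 'k::zero) mpoly \<Rightarrow> nat \<Rightarrow> ('x, 'k) mpoly" where
  "bvec k p = (\<lambda>i. if i = k then p else 0)"

lemma carrier_graded_free:
  "v \<in> carrier (graded_free V ds) \<longleftrightarrow> (\<forall>k. v k \<in> polys V) \<and> (\<forall>k\<ge>length ds. v k = 0)"
proof -
  have "finite {k. v k \<noteq> 0} \<and> {k. v k \<noteq> 0} \<subseteq> {..<length ds} \<longleftrightarrow> {k. v k \<noteq> 0} \<subseteq> {..<length ds}"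
    using finite_subset[of "{k. v k \<noteq> 0}" "{..<length ds}"] by blast
  moreover have "{k. v k \<noteq> 0} \<subseteq> {..<length ds} \<longleftrightarrow> (\<forall>k\<ge>length ds. v k = 0)"
    by (auto simp: subset_iff) (meson not_le)
  ultimately show ?thesis
    by (simp add: graded_free_def module.extend_def free_module_def image_subset_iff)
qed

lemma graded_free_simps [simp]:
  "\<zero>\<^bsub>graded_free V ds\<^esub> = (\<lambda>k. 0)"
  "v \<oplus>\<^bsub>graded_free V ds\<^esub> w = (\<lambda>k. v k + w k)"
  "r \<odot>\<^bsub>graded_free V ds\<^esub> v = (\<lambda>k. r * v k)"
  by (simp_all add: graded_free_def module.extend_def free_module_def)

lemma gpart_graded_free:
  "v \<in> gpart (graded_free V ds) d \<longleftrightarrow>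
     v \<in> carrier (graded_free V ds) \<and> (\<forall>k<length ds. homog (d - ds ! k) (v k))"
proof -
  have "v \<in> gpart (graded_free V ds) d \<longleftrightarrow>
     v \<in> carrier (graded_free V ds) \<and> (\<forall>k<length ds. v k \<in> mpoly_part V (d - ds ! k))"
    by (simp add: graded_free_def module.extend_def)
  then show ?thesis by (auto simp: mpoly_part_iff carrier_graded_free)
qed

text \<open>The additional field \<open>gpart\<close> is invisible to \<open>mod_hom\<close>, so the
  results on free modules transfer.\<close>

lemma graded_free_eq_free_module:
  "carrier (graded_free V ds) = carrier (free_module (mpoly_ring V) {..<length ds})"
  "mod_hom R (graded_free V ds) N = mod_hom R (free_module (mpoly_ring V) {..<length ds}) N"
  by (simp_all add: graded_free_def module.extend_def mod_hom_def)

lemma module_graded_free: "module (mpoly_ring V) (graded_free V ds)"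
proof (rule moduleI[OF cring_mpoly_ring])
  show "abelian_group (graded_free V ds)"
  proof (rule abelian_groupI)
    fix x assume "x \<in> carrier (graded_free V ds)"
    then show "\<exists>y\<in>carrier (graded_free V ds). y \<oplus>\<^bsub>graded_free V ds\<^esub> x = \<zero>\<^bsub>graded_free V ds\<^esub>"
      by (intro bexI[of _ "\<lambda>k. - x k"]) (auto simp: carrier_graded_free)
  qed (auto simp: carrier_graded_free algebra_simps)
qed (auto simp: carrier_graded_free algebra_simps)

lemma graded_free_minus:
  assumes "v \<in> carrier (graded_free V ds)" "w \<in> carrier (graded_free V ds)"
  shows "v \<ominus>\<^bsub>graded_free V ds\<^esub> w = (\<lambda>k. v k - w k)"
proof -
  interpret module "mpoly_ring V" "graded_free V ds" by (rule module_graded_free)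
  have "\<ominus>\<^bsub>graded_free V ds\<^esub> w = (\<lambda>k. - w k)"
    using assms by (intro M.minus_equality) (auto simp: carrier_graded_free)
  then show ?thesis by (simp add: M.minus_eq)
qed

lemma fbasis_mpoly_ring: "fbasis (mpoly_ring V) k = bvec k 1"
  by (auto simp: fbasis_def bvec_def)

lemma bvec_in [simp]: "k < length ds \<Longrightarrow> p \<in> polys V \<Longrightarrow> bvec k p \<in> carrier (graded_free V ds)"
  by (auto simp: carrier_graded_free bvec_def)

lemma bvec_gpart: "k < length ds \<Longrightarrow> p \<in> polys V \<Longrightarrow> homog d p \<Longrightarrow>
    bvec k p \<in> gpart (graded_free V ds) (d + ds ! k)"
  by (auto simp: gpart_graded_free) (auto simp: bvec_def)

lemma graded_free_induct [consumes 1, case_names zero add]: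
  assumes v: "v \<in> carrier (graded_free V ds)"
    and 0: "Q (\<lambda>k. 0)"
    and a: "\<And>v k p. v \<in> carrier (graded_free V ds) \<Longrightarrow> k < length ds \<Longrightarrow> p \<in> polys V \<Longrightarrow> Q v \<Longrightarrow>
        Q (\<lambda>i. v i + bvec k p i)"
  shows "Q v"
proof -
  interpret cring "mpoly_ring V" by (rule cring_mpoly_ring)
  have v': "v \<in> carrier (free_module (mpoly_ring V) {..<length ds})"
    using v by (simp add: graded_free_eq_free_module)
  show ?thesis
    using v'
  proof (induction v rule: free_module_induct)
    case (add v k r)
    then show ?case using a[of v k r]
      by (auto simp: graded_free_eq_free_module[symmetric] free_module_simps fbasis_def bvec_def
        if_distrib[of "(*) r"] cong: if_cong)
  qed (use 0 in \<open>simp add: free_module_simps\<close>)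
qed

text \<open>Homomorphisms become matrices, whose entries can be reduced modulo the irrelevant ideal
  one by one.\<close>

lemma graded_free_hom_matrix:
  assumes f: "f \<in> mod_hom (mpoly_ring V) (graded_free V ds) (graded_free V es)"
    and v: "v \<in> carrier (graded_free V ds)"
  shows "f v l = (\<Sum>k<length ds. v k * f (bvec k 1) l)"
  using v
proof (induction v rule: graded_free_induct)
  case zero
  show ?case using mod_hom_zero[OF f module_graded_free module_graded_free] by simp
next
  case (add v k p)
  have b: "bvec k 1 \<in> carrier (graded_free V ds)" using add by simp
  have "bvec k p = p \<odot>\<^bsub>graded_free V ds\<^esub> bvec k 1" by (auto simp: bvec_def)
  then have "f (bvec k p) = (\<lambda>i. p * f (bvec k 1) i)"
    using mod_homD(3)[OF f _ b, of p] add by simp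
  moreover have "f (\<lambda>i. v i + bvec k p i) = (\<lambda>i. f v i + f (bvec k p) i)"
    using mod_homD(2)[OF f add.hyps(1) bvec_in[OF add.hyps(2,3)]] by simp
  moreover have "(\<Sum>j<length ds. bvec k p j * f (bvec j 1) l) = (\<Sum>j<length ds. if j = k then p * f (bvec k 1) l else 0)"
    by (intro sum.cong) (auto simp: bvec_def)
  ultimately show ?case using add by (simp add: algebra_simps sum.distrib)
qed

section \<open>The quotient by an ideal as a module\<close>

abbreviation coset :: "'x set \<Rightarrow> ('x, 'k::field) mpoly set \<Rightarrow> ('x, 'k) mpoly \<Rightarrow> ('x, 'k) mpoly set" where
  "coset V I p \<equiv> I +>\<^bsub>mpoly_ring V\<^esub> p"

lemma quotient_module_simps:
  fixes I :: "('x, 'k::field) mpoly set"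
  assumes I: "pideal V I"
  shows "carrier (quotient_module V I) = coset V I ` polys V"
    and "\<zero>\<^bsub>quotient_module V I\<^esub> = coset V I 0"
    and "p \<in> polys V \<Longrightarrow> q \<in> polys V \<Longrightarrow>
      coset V I p \<oplus>\<^bsub>quotient_module V I\<^esub> coset V I q = coset V I (p + q)"
    and "r \<in> polys V \<Longrightarrow> q \<in> polys V \<Longrightarrow>
      r \<odot>\<^bsub>quotient_module V I\<^esub> coset V I q = coset V I (r * q)"
    and "gpart (quotient_module V I) d = coset V I ` mpoly_part V d"
    and "p \<in> polys V \<Longrightarrow> q \<in> polys V \<Longrightarrow> coset V I p = coset V I q \<longleftrightarrow> p - q \<in> I"
    and "p \<in> polys V \<Longrightarrow> coset V I p = \<zero>\<^bsub>quotient_module V I\<^esub> \<longleftrightarrow> p \<in> I"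
proof -
  interpret cring "mpoly_ring V :: ('x, 'k) mpoly ring" by (rule cring_mpoly_ring)
  interpret ideal I "mpoly_ring V :: ('x, 'k) mpoly ring" using I ideal_iff_pideal by blast
  note defs = quotient_module_def ring.extend_def FactRing_def
  show z: "\<zero>\<^bsub>quotient_module V I\<^esub> = coset V I 0"
    using a_rcos_zero[OF is_ideal, of 0] pidealD[OF I] by (simp add: defs)
  show "carrier (quotient_module V I) = coset V I ` polys V"
    by (auto simp: defs A_RCOSETS_def' a_r_coset_def')
  show "p \<in> polys V \<Longrightarrow> q \<in> polys V \<Longrightarrow>
      coset V I p \<oplus>\<^bsub>quotient_module V I\<^esub> coset V I q = coset V I (p + q)"
    using a_rcos_sum[of p q] by (simp add: defs)
  show "r \<in> polys V \<Longrightarrow> q \<in> polys V \<Longrightarrow>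
      r \<odot>\<^bsub>quotient_module V I\<^esub> coset V I q = coset V I (r * q)"
    using rcoset_mult_add[of r q] by (simp add: defs)
  show "gpart (quotient_module V I) d = coset V I ` mpoly_part V d"
    by (simp add: defs)
  show eq: "p \<in> polys V \<Longrightarrow> q \<in> polys V \<Longrightarrow> coset V I p = coset V I q \<longleftrightarrow> p - q \<in> I" for p q
    using quotient_eq_iff_same_a_r_cos[OF is_ideal, of p q] by simp
  show "p \<in> polys V \<Longrightarrow> coset V I p = \<zero>\<^bsub>quotient_module V I\<^esub> \<longleftrightarrow> p \<in> I"
    using eq[of p 0] z by simp
qed

lemma module_quotient_module:
  fixes I :: "('x, 'k::field) mpoly set"
  assumes I: "pideal V I"
  shows "module (mpoly_ring V) (quotient_module V I)"
proof (rule moduleI[OF cring_mpoly_ring])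
  note simps = quotient_module_simps[OF I] pidealD[OF I] polys_add polys_mult
  show "abelian_group (quotient_module V I)"
  proof (rule abelian_groupI)
    fix x assume "x \<in> carrier (quotient_module V I)"
    then obtain p where p: "p \<in> polys V" "x = coset V I p" by (auto simp: simps)
    then show "\<exists>y\<in>carrier (quotient_module V I). y \<oplus>\<^bsub>quotient_module V I\<^esub> x = \<zero>\<^bsub>quotient_module V I\<^esub>"
      by (intro bexI[of _ "coset V I (- p)"]) (auto simp: simps)
  qed (auto simp: simps algebra_simps)
next
  note simps = quotient_module_simps[OF I] pidealD[OF I] polys_add polys_mult
  fix x assume x: "x \<in> carrier (quotient_module V I)"
  then obtain p where p: "p \<in> polys V" "x = coset V I p" by (auto simp: simps)
  show "\<one>\<^bsub>mpoly_ring V\<^esub> \<odot>\<^bsub>quotient_module V I\<^esub> x = x"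
    using p by (auto simp: simps)
  fix a b y
  assume a: "a \<in> carrier (mpoly_ring V :: ('x, 'k) mpoly ring)"
  show "a \<odot>\<^bsub>quotient_module V I\<^esub> x \<in> carrier (quotient_module V I)"
    using a p by (auto simp: simps)
  show "(a \<oplus>\<^bsub>mpoly_ring V\<^esub> b) \<odot>\<^bsub>quotient_module V I\<^esub> x =
      a \<odot>\<^bsub>quotient_module V I\<^esub> x \<oplus>\<^bsub>quotient_module V I\<^esub> b \<odot>\<^bsub>quotient_module V I\<^esub> x"
    and "a \<otimes>\<^bsub>mpoly_ring V\<^esub> b \<odot>\<^bsub>quotient_module V I\<^esub> x =
      a \<odot>\<^bsub>quotient_module V I\<^esub> (b \<odot>\<^bsub>quotient_module V I\<^esub> x)"
    if "b \<in> carrier (mpoly_ring V)"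
    using that a p by (auto simp: simps algebra_simps)
  show "a \<odot>\<^bsub>quotient_module V I\<^esub> (x \<oplus>\<^bsub>quotient_module V I\<^esub> y) =
      a \<odot>\<^bsub>quotient_module V I\<^esub> x \<oplus>\<^bsub>quotient_module V I\<^esub> a \<odot>\<^bsub>quotient_module V I\<^esub> y"
    if y: "y \<in> carrier (quotient_module V I)"
  proof -
    from y obtain q where "q \<in> polys V" "y = coset V I q" by (auto simp: simps)
    then show ?thesis using a p by (auto simp: simps algebra_simps)
  qed
qed

section \<open>Projections onto homogeneous components\<close>

text \<open>The record \<open>graded_module\<close> lists components without demanding a direct sum.
  Additive projections are the part of that decomposition that lifting uses, and they make free
  modules and quotients accessible to the same argument.\<close>

definition gproj :: "('a, 'b, 'm) graded_module_scheme \<Rightarrow> (int \<Rightarrow> 'b \<Rightarrow> 'b) \<Rightarrow> bool" where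
  "gproj M \<pi> \<longleftrightarrow>
     (\<forall>d. \<pi> d \<in> carrier M \<rightarrow> carrier M \<and>
       (\<forall>x\<in>carrier M. \<forall>y\<in>carrier M. \<pi> d (x \<oplus>\<^bsub>M\<^esub> y) = \<pi> d x \<oplus>\<^bsub>M\<^esub> \<pi> d y)) \<and>
     (\<forall>d e x. x \<in> gpart M e \<longrightarrow> x \<in> carrier M \<and> \<pi> d x = (if d = e then x else \<zero>\<^bsub>M\<^esub>)) \<and>
     (\<forall>d. \<zero>\<^bsub>M\<^esub> \<in> gpart M d)"

definition vcomp :: "int list \<Rightarrow> int \<Rightarrow> (nat \<Rightarrow> ('x, 'k::zero) mpoly) \<Rightarrow> nat \<Rightarrow> ('x, 'k) mpoly" where
  "vcomp ds d v = (\<lambda>k. hcomp (d - ds ! k) (v k))"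

lemma vcomp_in: "v \<in> carrier (graded_free V ds) \<Longrightarrow> vcomp ds d v \<in> gpart (graded_free V ds) d"
  by (auto simp: gpart_graded_free carrier_graded_free vcomp_def)

lemma gproj_graded_free: "gproj (graded_free V ds) (vcomp ds)"
  unfolding gproj_def
proof (intro conjI allI ballI impI)
  fix d e and x :: "nat \<Rightarrow> ('a, 'b) mpoly"
  assume x: "x \<in> gpart (graded_free V ds) e"
  show "x \<in> carrier (graded_free V ds)" using x by (simp add: gpart_graded_free)
  have "vcomp ds d x k = (if d = e then x k else 0)" for k
  proof (cases "k < length ds")
    case True
    with x have "homog (e - ds ! k) (x k)" by (simp add: gpart_graded_free)
    from hcomp_homog[OF this, of "d - ds ! k"] show ?thesis by (auto simp: vcomp_def)
  next
    case False
    with x show ?thesis by (auto simp: gpart_graded_free carrier_graded_free vcomp_def)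
  qed
  then show "vcomp ds d x = (if d = e then x else \<zero>\<^bsub>graded_free V ds\<^esub>)" by auto
qed (auto simp: vcomp_def hcomp_add carrier_graded_free gpart_graded_free polys_hcomp)

lemma gproj_quotient_module:
  assumes "hideal V I" shows "\<exists>\<pi>. gproj (quotient_module V I) \<pi>"
proof -
  have I: "pideal V I" and h: "\<And>p d. p \<in> I \<Longrightarrow> hcomp d p \<in> I" using assms by (auto simp: hideal_def)
  note simps = quotient_module_simps[OF I]
  \<comment> \<open>The projection acts on an arbitrary representative; representatives differ by an
    element of I, whose components lie in I again.\<close>
  define \<pi> where "\<pi> d C = coset V I (hcomp d (SOME p. p \<in> polys V \<and> coset V I p = C))" for d C
  have \<pi>: "\<pi> d (coset V I p) = coset V I (hcomp d p)" if p: "p \<in> polys V" for d p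
  proof -
    define q where "q = (SOME q. q \<in> polys V \<and> coset V I q = coset V I p)"
    have "q \<in> polys V \<and> coset V I q = coset V I p"
      unfolding q_def using p by (intro someI[of "\<lambda>q. q \<in> polys V \<and> coset V I q = coset V I p" p]) simp
    then have q: "q \<in> polys V" "q - p \<in> I" using simps(6) p by auto
    have "hcomp d q = hcomp d (q - p) + hcomp d p" by (simp flip: hcomp_add)
    then have "hcomp d q - hcomp d p \<in> I" using h[OF q(2), of d] by simp
    then show ?thesis unfolding \<pi>_def q_def[symmetric] using simps(6) q(1) p by auto
  qed
  have "gproj (quotient_module V I) \<pi>"
    unfolding gproj_def
  proof (intro conjI allI ballI impI)
    fix d e x assume "x \<in> gpart (quotient_module V I) e"
    then obtain p where p: "p \<in> polys V" "homog e p" "x = coset V I p"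
      unfolding simps mpoly_part_iff[abs_def] image_iff by (auto simp: mpoly_part_iff)
    then show "x \<in> carrier (quotient_module V I)" by (auto simp: simps)
    show "\<pi> d x = (if d = e then x else \<zero>\<^bsub>quotient_module V I\<^esub>)"
      using p by (auto simp: \<pi> hcomp_homog simps)
  next
    fix d show "\<zero>\<^bsub>quotient_module V I\<^esub> \<in> gpart (quotient_module V I) d"
      by (auto simp: simps mpoly_part_iff)
  qed (auto simp: simps \<pi> hcomp_add polys_add polys_hcomp)
  then show ?thesis by blast
qed

text \<open>Both sides are additive, and on a vector with a single term, which is homogeneous, they
  agree because f preserves degrees.\<close>

lemma gproj_hom:
  fixes N :: "(('x, 'k::field) mpoly, 'c, 'm) graded_module_scheme"
  assumes N: "module (mpoly_ring V) N" and \<pi>: "gproj N \<pi>"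
    and f: "f \<in> mod_hom (mpoly_ring V) (graded_free V ds) N"
    and gr: "graded_map (graded_free V ds) N f"
    and w: "w \<in> carrier (graded_free V ds)"
  shows "f (vcomp ds d w) = \<pi> d (f w)"
proof -
  let ?F = "graded_free V ds :: (('x, 'k) mpoly, _) graded_module"
  have \<pi>D: "\<And>x. x \<in> carrier N \<Longrightarrow> \<pi> d x \<in> carrier N"
    "\<And>x y. x \<in> carrier N \<Longrightarrow> y \<in> carrier N \<Longrightarrow> \<pi> d (x \<oplus>\<^bsub>N\<^esub> y) = \<pi> d x \<oplus>\<^bsub>N\<^esub> \<pi> d y"
    "\<And>x e. x \<in> gpart N e \<Longrightarrow> \<pi> d x = (if d = e then x else \<zero>\<^bsub>N\<^esub>)"
    "\<zero>\<^bsub>N\<^esub> \<in> gpart N d"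
    using \<pi> by (auto simp: gproj_def)
  have fzero: "f (\<lambda>k. 0) = \<zero>\<^bsub>N\<^esub>" using mod_hom_zero[OF f module_graded_free N] by simp
  have add: "f (\<lambda>i. v i + w i) = f v \<oplus>\<^bsub>N\<^esub> f w" if "v \<in> carrier ?F" "w \<in> carrier ?F" for v w
    using mod_homD(2)[OF f that] by simp
  let ?Q = "\<lambda>w. f (vcomp ds d w) = \<pi> d (f w)"
  have sum: "?Q (\<lambda>i. v i + w i)" if v: "v \<in> carrier ?F" and w: "w \<in> carrier ?F" and "?Q v" "?Q w" for v w
  proof -
    have "vcomp ds d (\<lambda>i. v i + w i) = (\<lambda>i. vcomp ds d v i + vcomp ds d w i)"
      by (simp add: vcomp_def hcomp_add)
    moreover have "vcomp ds d v \<in> carrier ?F" "vcomp ds d w \<in> carrier ?F"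
      using vcomp_in[OF v] vcomp_in[OF w] by (auto simp: gpart_graded_free)
    ultimately show ?thesis using that mod_homD(1)[OF f] by (simp add: add \<pi>D)
  qed
  have single: "?Q (bvec k p)" if k: "k < length ds" and p: "p \<in> polys V" for k p
    using p
  proof (induction p rule: polys_induct)
    case (single m c)
    have hom: "bvec k (mterm m c) \<in> gpart ?F (int (mdeg m) + ds ! k)"
      using single k by (intro bvec_gpart) (auto simp: homog_term)
    then have "f (bvec k (mterm m c)) \<in> gpart N (int (mdeg m) + ds ! k)"
      using gr by (auto simp: graded_map_def)
    moreover have "vcomp ds d (bvec k (mterm m c))
       = (if d = int (mdeg m) + ds ! k then bvec k (mterm m c) else (\<lambda>k. 0))"
      using hom gproj_graded_free[of V ds] unfolding gproj_def graded_free_simps(1) by blast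
    ultimately show ?case by (simp add: \<pi>D fzero)
  next
    case (add p q)
    have "bvec k (p + q) = (\<lambda>i. bvec k p i + bvec k q i)" by (auto simp: bvec_def)
    then show ?case using sum[of "bvec k p" "bvec k q"] add k by simp
  qed
  show ?thesis
    using w
  proof (induction w rule: graded_free_induct)
    case zero
    have "\<pi> d \<zero>\<^bsub>N\<^esub> = \<zero>\<^bsub>N\<^esub>" using \<pi>D(3)[OF \<pi>D(4)] by simp
    moreover have "vcomp ds d (\<lambda>k. 0) = (\<lambda>k. 0 :: ('x, 'k) mpoly)" by (simp add: vcomp_def)
    ultimately show ?case by (simp add: fzero)
  qed (use sum single in auto)
qed

text \<open>A preimage of \<phi> at a basis element may be replaced by its component in the degree
  of that element: by \<open>gproj_hom\<close> this component is still a preimage. The matrix of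
  \<chi> then has homogeneous entries of the right degrees.\<close>

lemma graded_lift:
  fixes N :: "(('x, 'k::field) mpoly, 'c, 'm) graded_module_scheme"
  assumes N: "module (mpoly_ring V) N" and \<pi>: "gproj N \<pi>"
    and \<phi>: "\<phi> \<in> mod_hom (mpoly_ring V) (graded_free V ds) N" "graded_map (graded_free V ds) N \<phi>"
    and \<psi>: "\<psi> \<in> mod_hom (mpoly_ring V) (graded_free V es) N" "graded_map (graded_free V es) N \<psi>"
    and im: "\<And>x. x \<in> carrier (graded_free V ds) \<Longrightarrow> \<phi> x \<in> \<psi> ` carrier (graded_free V es)"
  shows "\<exists>\<chi>\<in>mod_hom (mpoly_ring V) (graded_free V ds) (graded_free V es).
     graded_map (graded_free V ds) (graded_free V es) \<chi> \<and> (\<forall>x\<in>carrier (graded_free V ds). \<psi> (\<chi> x) = \<phi> x)"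
proof -
  let ?R = "mpoly_ring V :: ('x, 'k) mpoly ring"
  let ?F = "graded_free V ds :: (('x, 'k) mpoly, _) graded_module"
  let ?G = "graded_free V es :: (('x, 'k) mpoly, _) graded_module"
  have "\<exists>y\<in>gpart ?G (ds ! k). \<psi> y = \<phi> (bvec k 1)" if k: "k < length ds" for k
  proof -
    obtain w where w: "w \<in> carrier ?G" "\<psi> w = \<phi> (bvec k 1)"
      using im[of "bvec k 1"] k by auto
    have "bvec k 1 \<in> gpart ?F (ds ! k)" using bvec_gpart[OF k, of 1 V 0] by simp
    then have "\<phi> (bvec k 1) \<in> gpart N (ds ! k)" using \<phi>(2) by (auto simp: graded_map_def)
    then have "\<psi> (vcomp es (ds ! k) w) = \<phi> (bvec k 1)"
      using gproj_hom[OF N \<pi> \<psi> w(1)] w(2) \<pi> by (simp add: gproj_def)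
    then show ?thesis using vcomp_in[OF w(1)] by blast
  qed
  then obtain y where y: "\<And>k. k < length ds \<Longrightarrow> y k \<in> gpart ?G (ds ! k) \<and> \<psi> (y k) = \<phi> (bvec k 1)"
    by metis
  obtain \<chi> where \<chi>: "\<chi> \<in> mod_hom ?R ?F ?G" "\<forall>k<length ds. \<chi> (bvec k 1) = y k"
    using free_module_hom_ex[OF module_graded_free, of "{..<length ds}" y V es] y
    by (auto simp: graded_free_eq_free_module(2) gpart_graded_free fbasis_mpoly_ring)
  have "\<psi> (\<chi> x) = \<phi> x" if "x \<in> carrier ?F" for x
    using free_module_hom_eq[OF cring_mpoly_ring N, of "\<lambda>x. \<psi> (\<chi> x)" "{..<length ds}" \<phi> x]
      mod_hom_compose[OF \<chi>(1) \<psi>(1)] \<phi>(1) that y \<chi>(2)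
    by (simp add: graded_free_eq_free_module fbasis_mpoly_ring)
  moreover have "graded_map ?F ?G \<chi>"
    unfolding graded_map_def
  proof (intro allI subsetI, elim imageE)
    fix d u v assume v: "v \<in> gpart ?F d" and u: "u = \<chi> v"
    have vc: "v \<in> carrier ?F" using v by (simp add: gpart_graded_free)
    have "homog (d - es ! l) (\<chi> v l)" if l: "l < length es" for l
    proof -
      have "homog (d - es ! l) (v k * y k l)" if k: "k < length ds" for k
        using homog_mult[of "d - ds ! k" "v k" "ds ! k - es ! l" "y k l"] v y[OF k] k l
        by (simp add: gpart_graded_free)
      then show ?thesis
        using graded_free_hom_matrix[OF \<chi>(1) vc, of l] \<chi>(2) by (auto intro!: homog_sum)
    qed
    then show "u \<in> gpart ?G d" using mod_homD(1)[OF \<chi>(1) vc] u by (simp add: gpart_graded_free)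
  qed
  ultimately show ?thesis using \<chi>(1) by blast
qed

section \<open>Uniqueness of minimal graded free resolutions\<close>

text \<open>Gaussian elimination: each equation is either zero or uses up one unknown.\<close>

lemma homogeneous_system_nontrivial:
  fixes a :: "'l \<Rightarrow> 'i \<Rightarrow> 'k::field"
  assumes "finite B" "finite A" "card B < card A"
  shows "\<exists>c. (\<exists>k\<in>A. c k \<noteq> 0) \<and> (\<forall>l\<in>B. (\<Sum>k\<in>A. a l k * c k) = 0)"
  using assms
proof (induction B arbitrary: A a rule: finite_induct)
  case empty
  then have "A \<noteq> {}" by auto
  then show ?case by (intro exI[of _ "\<lambda>_. 1"]) auto
next
  case (insert l B)
  show ?case
  proof (cases "\<forall>k\<in>A. a l k = 0")
    case True
    from insert.IH[of A a] insert.prems insert.hyps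
    obtain c where "\<exists>k\<in>A. c k \<noteq> 0" "\<forall>l\<in>B. (\<Sum>k\<in>A. a l k * c k) = 0" by auto
    then show ?thesis using True by (intro exI[of _ c]) auto
  next
    case False
    then obtain k0 where k0: "k0 \<in> A" "a l k0 \<noteq> 0" by auto
    let ?A = "A - {k0}"
    \<comment> \<open>The remaining system after \<open>k0\<close> has been eliminated with equation
      l; \<open>c'\<close> restores \<open>k0\<close> by back substitution, so that equation l holds
      as well.\<close>
    define a' where "a' l' k = a l' k - a l' k0 * a l k / a l k0" for l' k
    have "card B < card ?A" using insert.prems insert.hyps k0 by simp
    from insert.IH[OF _ this, of a'] insert.prems
    obtain c where c: "\<exists>k\<in>?A. c k \<noteq> 0" "\<forall>l'\<in>B. (\<Sum>k\<in>?A. a' l' k * c k) = 0" by auto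
    define s where "s = (\<Sum>k\<in>?A. a l k * c k)"
    define c' where "c' = c(k0 := - s / a l k0)"
    have split: "(\<Sum>k\<in>A. a l' k * c' k) = a l' k0 * (- s / a l k0) + (\<Sum>k\<in>?A. a l' k * c k)" for l'
    proof -
      have "(\<Sum>k\<in>?A. a l' k * c' k) = (\<Sum>k\<in>?A. a l' k * c k)"
        by (intro sum.cong) (auto simp: c'_def)
      then show ?thesis using insert.prems k0 by (simp add: sum.remove[of A k0] c'_def)
    qed
    have "(\<Sum>k\<in>A. a l' k * c' k) = 0" if "l' \<in> B" for l'
    proof -
      have "(\<Sum>k\<in>?A. a' l' k * c k) = (\<Sum>k\<in>?A. a l' k * c k) - (\<Sum>k\<in>?A. a l' k0 / a l k0 * (a l k * c k))"
        by (simp add: a'_def sum_subtractf[symmetric] algebra_simps)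
      also have "\<dots> = (\<Sum>k\<in>?A. a l' k * c k) - a l' k0 / a l k0 * s"
        by (simp only: s_def sum_distrib_left)
      finally show ?thesis using c(2) that unfolding split by simp
    qed
    moreover have "(\<Sum>k\<in>A. a l k * c' k) = 0"
      unfolding split s_def[symmetric] using k0 by simp
    moreover have "\<exists>k\<in>A. c' k \<noteq> 0" using c(1) by (auto simp: c'_def)
    ultimately show ?thesis by (intro exI[of _ c']) auto
  qed
qed

text \<open>A left inverse forbids nonzero vectors killed by a, which more columns than rows would
  provide.\<close>

lemma left_inverse_card_le:
  fixes a :: "'l \<Rightarrow> 'i \<Rightarrow> 'k::field"
  assumes "finite A" "finite B"
    and inv: "\<And>k k'. k \<in> A \<Longrightarrow> k' \<in> A \<Longrightarrow> (\<Sum>l\<in>B. b k' l * a l k) = (if k' = k then 1 else 0)"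
  shows "card A \<le> card B"
proof (rule ccontr)
  assume "\<not> ?thesis"
  then obtain c k' where k': "k' \<in> A" "c k' \<noteq> 0" and c: "\<forall>l\<in>B. (\<Sum>k\<in>A. a l k * c k) = 0"
    using homogeneous_system_nontrivial[OF assms(2,1), of a] by auto
  have "c k' = (\<Sum>k\<in>A. (if k' = k then 1 else 0) * c k)"
    using assms(1) k'(1) by (simp add: if_distrib[of "\<lambda>x. x * _"] cong: if_cong)
  also have "\<dots> = (\<Sum>k\<in>A. (\<Sum>l\<in>B. b k' l * a l k) * c k)"
    using inv k' by (intro sum.cong) auto
  also have "\<dots> = (\<Sum>k\<in>A. \<Sum>l\<in>B. b k' l * (a l k * c k))"
    by (simp add: sum_distrib_right mult.assoc)
  also have "\<dots> = (\<Sum>l\<in>B. b k' l * (\<Sum>k\<in>A. a l k * c k))"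
    by (subst sum.swap) (simp add: sum_distrib_left)
  also have "\<dots> = 0" using c by simp
  finally show False using k' by simp
qed

section \<open>Comparison of resolutions modulo the irrelevant ideal\<close>

lemma lookup_0_sum: "lkp (\<Sum>k\<in>A. p k * q k) 0 = (\<Sum>k\<in>A. lkp (p k) 0 * lkp (q k) 0)"
  for p q :: "'i \<Rightarrow> ('x, 'k::semiring_0) mpoly"
  by (simp add: lookup_sum lookup_mult_0)

text \<open>The difference between \<chi> and the identity induces zero on M, so it is
  null-homotopic. Both summands \<delta> h and h \<delta> of the homotopy identity have values
  without constant terms, because \<delta> is minimal.\<close>

lemma minimal_resolution_endo:
  fixes M :: "(('x, 'k::field) mpoly, 'c, 'm) graded_module_scheme"
  assumes min: "minimal_graded_free_resolution V M ds \<epsilon> \<delta>"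
    and M: "module (mpoly_ring V) M"
    and \<chi>: "\<And>i. \<chi> i \<in> mod_hom (mpoly_ring V) (graded_free V (ds i)) (graded_free V (ds i))"
    and \<chi>0: "\<And>x. x \<in> carrier (graded_free V (ds 0)) \<Longrightarrow> \<epsilon> (\<chi> 0 x) = \<epsilon> x"
    and \<chi>S: "\<And>i x. x \<in> carrier (graded_free V (ds (Suc i))) \<Longrightarrow> \<delta> i (\<chi> (Suc i) x) = \<chi> i (\<delta> i x)"
    and x: "x \<in> carrier (graded_free V (ds i))"
  shows "lkp (\<chi> i x l) 0 = lkp (x l) 0"
proof -
  let ?R = "mpoly_ring V :: ('x, 'k) mpoly ring"
  let ?F = "\<lambda>i. graded_free V (ds i) :: (('x, 'k) mpoly, _) graded_module"
  have res: "resolution ?R M ?F \<epsilon> \<delta>" using min by (simp add: minimal_graded_free_resolution_def)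
  have \<delta>0: "lkp (\<delta> i v k) 0 = 0" if "v \<in> carrier (?F (Suc i))" for i v k
    using min that by (auto simp: minimal_graded_free_resolution_def irrelevant_ideal_iff)
  have mods: "module ?R (?F i)" for i by (rule module_graded_free)
  have \<delta>: "\<delta> i \<in> mod_hom ?R (?F (Suc i)) (?F i)" for i using resolutionD(2)[OF res] .
  define \<theta> where "\<theta> i x = \<chi> i x \<ominus>\<^bsub>?F i\<^esub> x" for i x
  have \<theta>: "\<theta> i \<in> mod_hom ?R (?F i) (?F i)" for i
    using mod_hom_diff[OF \<chi> _ mods mods, of "\<lambda>x. x"] by (simp add: \<theta>_def[abs_def] mod_homI)
  have "\<epsilon> (\<theta> 0 x) = \<zero>\<^bsub>M\<^esub>" if x: "x \<in> carrier (?F 0)" for x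
  proof -
    interpret M: module ?R M by (rule M)
    show ?thesis
      unfolding \<theta>_def mod_hom_minus[OF resolutionD(1)[OF res] mods M mod_homD(1)[OF \<chi> x] x] \<chi>0[OF x]
      using mod_homD(1)[OF resolutionD(1)[OF res] x] by (simp add: M.M.minus_eq M.M.r_neg)
  qed
  moreover have "\<delta> i (\<theta> (Suc i) x) = \<theta> i (\<delta> i x)" if x: "x \<in> carrier (?F (Suc i))" for i x
    unfolding \<theta>_def mod_hom_minus[OF \<delta> mods mods mod_homD(1)[OF \<chi> x] x] \<chi>S[OF x] ..
  moreover have "\<exists>\<chi>\<in>mod_hom ?R (?F i) (?F (Suc i)). \<forall>x\<in>carrier (?F i). \<delta> i (\<chi> x) = \<phi> x"
    if "\<phi> \<in> mod_hom ?R (?F i) (?F i)"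
      and "\<And>x. x \<in> carrier (?F i) \<Longrightarrow> \<phi> x \<in> \<delta> i ` carrier (?F (Suc i))" for i \<phi>
    using free_module_lift[OF mods[of "Suc i"] mods[of i] _ \<delta>, of \<phi>] that
    by (simp add: graded_free_eq_free_module(2)[of _ _ "ds i"] graded_free_eq_free_module(1)[of _ "ds i"])
  ultimately obtain h where h: "\<And>i. h i \<in> mod_hom ?R (?F i) (?F (Suc i))"
    "\<And>x. x \<in> carrier (?F 0) \<Longrightarrow> \<theta> 0 x = \<delta> 0 (h 0 x)"
    "\<And>i x. x \<in> carrier (?F (Suc i)) \<Longrightarrow>
       \<theta> (Suc i) x = \<delta> (Suc i) (h (Suc i) x) \<oplus>\<^bsub>?F (Suc i)\<^esub> h i (\<delta> i x)"
    using null_homotopy_ex[OF res mods \<theta>] by blast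
  have "lkp (\<theta> i x l) 0 = 0"
  proof (cases i)
    case 0
    then show ?thesis using h(2) \<delta>0 mod_homD(1)[OF h(1)] x by simp
  next
    case (Suc j)
    have dx: "\<delta> j x \<in> carrier (?F j)" using mod_homD(1)[OF \<delta>] x Suc by simp
    have "lkp (h j (\<delta> j x) l) 0 = 0"
      unfolding graded_free_hom_matrix[OF h(1) dx] lookup_0_sum using \<delta>0 x Suc by simp
    then show ?thesis using h(3) \<delta>0 mod_homD(1)[OF h(1)] x Suc by (simp add: lookup_add)
  qed
  then show ?thesis
    using graded_free_minus[OF mod_homD(1)[OF \<chi> x] x] by (simp add: \<theta>_def lookup_minus)
qed

lemma count_list_eq_card: "count_list xs y = card {k. k < length xs \<and> xs ! k = y}"
  by (auto simp: count_list_eq_length_filter length_filter_conv_card intro!: arg_cong[where f = card])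

text \<open>Comparison maps f and g in both directions compose to the identity modulo the irrelevant
  ideal. They preserve degrees, so their constant terms split into one block for each degree, and
  the block for j has a left inverse.\<close>

lemma minimal_resolution_count_le:
  fixes M :: "(('x, 'k::field) mpoly, 'c, 'm) graded_module_scheme"
  assumes P: "minimal_graded_free_resolution V M ds \<epsilon> \<delta>"
    and Q: "minimal_graded_free_resolution V M es \<epsilon>' \<delta>'"
    and M: "module (mpoly_ring V) M" and \<pi>: "gproj M \<pi>"
  shows "count_list (ds i) j \<le> count_list (es i) j"
proof -
  let ?R = "mpoly_ring V :: ('x, 'k) mpoly ring"
  let ?F = "\<lambda>ds i. graded_free V (ds i) :: (('x, 'k) mpoly, _) graded_module"
  have ex: "\<exists>f. (\<forall>i. f i \<in> mod_hom ?R (?F ds i) (?F es i) \<and> graded_map (?F ds i) (?F es i) (f i)) \<and>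
      (\<forall>x\<in>carrier (?F ds 0). \<epsilon>' (f 0 x) = \<epsilon> x) \<and>
      (\<forall>i. \<forall>x\<in>carrier (?F ds (Suc i)). \<delta>' i (f (Suc i) x) = f i (\<delta> i x))"
    if P: "minimal_graded_free_resolution V M ds \<epsilon> \<delta>"
      and Q: "minimal_graded_free_resolution V M es \<epsilon>' \<delta>'" for ds es \<epsilon> \<epsilon>' \<delta> \<delta>'
  proof -
    have res: "resolution ?R M (?F ds) \<epsilon> \<delta>" "resolution ?R M (?F es) \<epsilon>' \<delta>'"
      and gr: "graded_map (?F ds 0) M \<epsilon>" "graded_map (?F es 0) M \<epsilon>'"
        "\<And>i. graded_map (?F ds (Suc i)) (?F ds i) (\<delta> i)" "\<And>i. graded_map (?F es (Suc i)) (?F es i) (\<delta>' i)"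
      using P Q by (simp_all add: minimal_graded_free_resolution_def)
    let ?H = "\<lambda>i. {f \<in> mod_hom ?R (?F ds i) (?F es i). graded_map (?F ds i) (?F es i) f}"
    have im0: "\<epsilon> x \<in> \<epsilon>' ` carrier (?F es 0)" if "x \<in> carrier (?F ds 0)" for x
      using resolutionD(3)[OF res(2)] mod_homD(1)[OF resolutionD(1)[OF res(1)] that] by simp
    have l0: "\<exists>\<chi>\<in>?H 0. \<forall>x\<in>carrier (?F ds 0). \<epsilon>' (\<chi> x) = \<epsilon> x"
      using graded_lift[OF M \<pi> resolutionD(1)[OF res(1)] gr(1) resolutionD(1)[OF res(2)] gr(2) im0] by blast
    have lS: "\<exists>\<chi>\<in>?H (Suc i). \<forall>x\<in>carrier (?F ds (Suc i)). \<delta>' i (\<chi> x) = \<phi> (\<delta> i x)"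
      if \<phi>: "\<phi> \<in> ?H i" and im: "\<And>x. x \<in> carrier (?F ds (Suc i)) \<Longrightarrow> \<phi> (\<delta> i x) \<in> \<delta>' i ` carrier (?F es (Suc i))" for i \<phi>
    proof -
      have "(\<lambda>x. \<phi> (\<delta> i x)) \<in> mod_hom ?R (?F ds (Suc i)) (?F es i)"
        using mod_hom_compose[OF resolutionD(2)[OF res(1)]] \<phi> by blast
      moreover have "graded_map (?F ds (Suc i)) (?F es i) (\<lambda>x. \<phi> (\<delta> i x))"
        using gr(3)[of i] \<phi> unfolding graded_map_def by blast
      ultimately have "\<exists>\<chi>\<in>mod_hom ?R (?F ds (Suc i)) (?F es (Suc i)). graded_map (?F ds (Suc i)) (?F es (Suc i)) \<chi> \<and>
          (\<forall>x\<in>carrier (?F ds (Suc i)). \<delta>' i (\<chi> x) = \<phi> (\<delta> i x))"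
        by (rule graded_lift[OF module_graded_free gproj_graded_free _ _ resolutionD(2)[OF res(2)] gr(4) im])
      then show ?thesis by blast
    qed
    show ?thesis
    proof (rule chain_map_ex[where H = ?H, OF res module_graded_free module_graded_free _ l0 lS])
      fix f assume "\<And>i. f i \<in> ?H i" "\<And>x. x \<in> carrier (?F ds 0) \<Longrightarrow> \<epsilon>' (f 0 x) = \<epsilon> x"
        "\<And>i x. x \<in> carrier (?F ds (Suc i)) \<Longrightarrow> \<delta>' i (f (Suc i) x) = f i (\<delta> i x)"
      then show ?thesis by (intro exI[of _ f]) simp
    qed auto
  qed
  obtain f where f: "\<And>i. f i \<in> mod_hom ?R (?F ds i) (?F es i)" "\<And>i. graded_map (?F ds i) (?F es i) (f i)"
      "\<And>x. x \<in> carrier (?F ds 0) \<Longrightarrow> \<epsilon>' (f 0 x) = \<epsilon> x"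
      "\<And>i x. x \<in> carrier (?F ds (Suc i)) \<Longrightarrow> \<delta>' i (f (Suc i) x) = f i (\<delta> i x)"
    using ex[OF P Q] by blast
  obtain g where g: "\<And>i. g i \<in> mod_hom ?R (?F es i) (?F ds i)" "\<And>i. graded_map (?F es i) (?F ds i) (g i)"
      "\<And>x. x \<in> carrier (?F es 0) \<Longrightarrow> \<epsilon> (g 0 x) = \<epsilon>' x"
      "\<And>i x. x \<in> carrier (?F es (Suc i)) \<Longrightarrow> \<delta> i (g (Suc i) x) = g i (\<delta>' i x)"
    using ex[OF Q P] by blast
  let ?A = "{k. k < length (ds i) \<and> ds i ! k = j}"
  let ?B = "{k. k < length (es i) \<and> es i ! k = j}"
  define a where "a l k = lkp (f i (bvec k 1) l) 0" for l k
  define b where "b k l = lkp (g i (bvec l 1) k) 0" for k l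
  have "card ?A \<le> card ?B"
  proof (rule left_inverse_card_le[where a = a and b = b])
    fix k k' assume k: "k \<in> ?A" and k': "k' \<in> ?A"
    have bk: "bvec k 1 \<in> carrier (?F ds i)" using k by simp
    have fk: "f i (bvec k 1) \<in> carrier (?F es i)" using mod_homD(1)[OF f(1) bk] .
    have "bvec k 1 \<in> gpart (?F ds i) j" using bvec_gpart[of k "ds i" 1 V 0] k by simp
    then have fg: "f i (bvec k 1) \<in> gpart (?F es i) j" using f(2)[of i] by (auto simp: graded_map_def)
    \<comment> \<open>The entry is homogeneous of degree j - \<open>es i ! l\<close>, so its
      constant term survives only when this degree is 0.\<close>
    have a0: "a l k = 0" if "l < length (es i)" "l \<notin> ?B" for l
      unfolding a_def using fg that by (intro lookup_homog_0[of "j - es i ! l"]) (auto simp: gpart_graded_free)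
    have "lkp (g i (f i (bvec k 1)) k') 0 = lkp (bvec k 1 k') (0 :: 'x \<Rightarrow>\<^sub>0 nat)"
    proof (rule minimal_resolution_endo[OF P M mod_hom_compose[OF f(1) g(1)], where i = i])
      show "\<epsilon> (g 0 (f 0 x)) = \<epsilon> x" if "x \<in> carrier (?F ds 0)" for x
        using that f(3) g(3) mod_homD(1)[OF f(1)] by simp
      show "\<delta> i (g (Suc i) (f (Suc i) x)) = g i (f i (\<delta> i x))" if "x \<in> carrier (?F ds (Suc i))" for i x
        using that f(4) g(4) mod_homD(1)[OF f(1)] by simp
    qed (rule bk)
    moreover have "lkp (g i (f i (bvec k 1)) k') 0 = (\<Sum>l<length (es i). a l k * b k' l)"
      unfolding graded_free_hom_matrix[OF g(1) fk] lookup_0_sum a_def b_def ..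
    moreover have "(\<Sum>l<length (es i). a l k * b k' l) = (\<Sum>l\<in>?B. a l k * b k' l)"
      using a0 by (intro sum.mono_neutral_right) auto
    ultimately have "(\<Sum>l\<in>?B. b k' l * a l k) = lkp (bvec k 1 k') (0 :: 'x \<Rightarrow>\<^sub>0 nat)"
      by (simp add: mult.commute)
    then show "(\<Sum>l\<in>?B. b k' l * a l k) = (if k' = k then 1 else 0)"
      by (simp add: bvec_def)
  qed auto
  then show ?thesis by (simp add: count_list_eq_card)
qed

lemma betti_eq_count:
  fixes I :: "('x, 'k::field) mpoly set"
  assumes I: "hideal V I"
    and P: "minimal_graded_free_resolution V (quotient_module V I) ds \<epsilon> \<delta>"
  shows "betti V (quotient_module V I) i j = count_list (ds i) j"
  unfolding betti_def
proof (rule the_equality)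
  obtain \<pi> where \<pi>: "gproj (quotient_module V I) \<pi>" using gproj_quotient_module[OF I] ..
  have M: "module (mpoly_ring V) (quotient_module V I)" using I by (simp add: hideal_def module_quotient_module)
  fix b assume "\<exists>ds \<epsilon> \<delta>. minimal_graded_free_resolution V (quotient_module V I) ds \<epsilon> \<delta> \<and> b = count_list (ds i) j"
  then show "b = count_list (ds i) j"
    using minimal_resolution_count_le[OF P _ M \<pi>] minimal_resolution_count_le[OF _ P M \<pi>]
    by (metis order_antisym)
qed (use P in blast)

section \<open>A lower bound for the projective dimension\<close>

text \<open>Maps to P and back compose to the identity modulo the irrelevant ideal. If P i were
  zero, they would send a basis element to 0, although its coefficient 1 is nonzero modulo that
  ideal.\<close>

lemma le_proj_dim:
  fixes M :: "(('x, 'k::field) mpoly, 'c, 'm) graded_module_scheme"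
  assumes min: "minimal_graded_free_resolution V M ds \<epsilon> \<delta>"
    and M: "module (mpoly_ring V) M" and i: "ds i \<noteq> []"
  shows "enat i \<le> proj_dim (mpoly_ring V) M"
  unfolding proj_dim_def
proof (rule Inf_greatest, elim CollectE exE conjE)
  let ?R = "mpoly_ring V :: ('x, 'k) mpoly ring"
  let ?F = "\<lambda>i. graded_free V (ds i) :: (('x, 'k) mpoly, _) graded_module"
  fix x l and P :: "nat \<Rightarrow> (('x, 'k) mpoly, nat \<Rightarrow> ('x, 'k) mpoly) module" and \<epsilon>' \<delta>'
  assume x: "x = enat l" and resP: "resolution ?R M P \<epsilon>' \<delta>'" and proj: "\<forall>i. projective_module ?R (P i)"
    and fin: "\<forall>i>l. carrier (P i) = {\<zero>\<^bsub>P i\<^esub>}"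
  have res: "resolution ?R M ?F \<epsilon> \<delta>" using min by (simp add: minimal_graded_free_resolution_def)
  have modF: "module ?R (?F i)" for i by (rule module_graded_free)
  have modP: "module ?R (P i)" for i using proj by (simp add: projective_module_def)
  obtain f where f: "\<And>i. f i \<in> mod_hom ?R (?F i) (P i)"
      "\<And>x. x \<in> carrier (?F 0) \<Longrightarrow> \<epsilon>' (f 0 x) = \<epsilon> x"
      "\<And>i x. x \<in> carrier (?F (Suc i)) \<Longrightarrow> \<delta>' i (f (Suc i) x) = f i (\<delta> i x)"
  proof (rule chain_map_ex[where H = "\<lambda>i. mod_hom ?R (?F i) (P i)", OF res resP modF modP order_refl])
    have "\<epsilon> x \<in> \<epsilon>' ` carrier (P 0)" if "x \<in> carrier (?F 0)" for x
      using resolutionD(3)[OF resP] mod_homD(1)[OF resolutionD(1)[OF res] that] by simp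
    then show "\<exists>\<chi>\<in>mod_hom ?R (?F 0) (P 0). \<forall>x\<in>carrier (?F 0). \<epsilon>' (\<chi> x) = \<epsilon> x"
      using free_module_lift[OF modP[of 0] M _ resolutionD(1)[OF resP], of \<epsilon> "{..<length (ds 0)}"]
        resolutionD(1)[OF res] by (simp add: graded_free_eq_free_module)
  next
    fix i \<phi> assume \<phi>: "\<phi> \<in> mod_hom ?R (?F i) (P i)"
      and "\<And>x. x \<in> carrier (?F (Suc i)) \<Longrightarrow> \<phi> (\<delta> i x) \<in> \<delta>' i ` carrier (P (Suc i))"
    then show "\<exists>\<chi>\<in>mod_hom ?R (?F (Suc i)) (P (Suc i)). \<forall>x\<in>carrier (?F (Suc i)). \<delta>' i (\<chi> x) = \<phi> (\<delta> i x)"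
      using free_module_lift[OF modP[of "Suc i"] modP[of i] _ resolutionD(2)[OF resP],
          of "\<lambda>x. \<phi> (\<delta> i x)" "{..<length (ds (Suc i))}"] mod_hom_compose[OF resolutionD(2)[OF res] \<phi>]
      by (simp add: graded_free_eq_free_module(2)[of _ _ "ds (Suc i)"] graded_free_eq_free_module(1)[of _ "ds (Suc i)"])
  qed (rule that)
  obtain g where g: "\<And>i. g i \<in> mod_hom ?R (P i) (?F i)"
      "\<And>x. x \<in> carrier (P 0) \<Longrightarrow> \<epsilon> (g 0 x) = \<epsilon>' x"
      "\<And>i x. x \<in> carrier (P (Suc i)) \<Longrightarrow> \<delta> i (g (Suc i) x) = g i (\<delta>' i x)"
  proof (rule chain_map_ex[where H = "\<lambda>i. mod_hom ?R (P i) (?F i)", OF resP res modP modF order_refl])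
    have "\<epsilon>' x \<in> \<epsilon> ` carrier (?F 0)" if "x \<in> carrier (P 0)" for x
      using resolutionD(3)[OF res] mod_homD(1)[OF resolutionD(1)[OF resP] that] by simp
    then show "\<exists>\<chi>\<in>mod_hom ?R (P 0) (?F 0). \<forall>x\<in>carrier (P 0). \<epsilon> (\<chi> x) = \<epsilon>' x"
      using projective_module_lift[OF _ modF M resolutionD(1)[OF resP] resolutionD(1)[OF res]] proj by blast
  next
    fix i \<phi> assume \<phi>: "\<phi> \<in> mod_hom ?R (P i) (?F i)"
      and "\<And>x. x \<in> carrier (P (Suc i)) \<Longrightarrow> \<phi> (\<delta>' i x) \<in> \<delta> i ` carrier (?F (Suc i))"
    then show "\<exists>\<chi>\<in>mod_hom ?R (P (Suc i)) (?F (Suc i)). \<forall>x\<in>carrier (P (Suc i)). \<delta> i (\<chi> x) = \<phi> (\<delta>' i x)"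
      using projective_module_lift[OF _ modF modF mod_hom_compose[OF resolutionD(2)[OF resP] \<phi>] resolutionD(2)[OF res]] proj
      by blast
  qed (rule that)
  show "enat i \<le> x"
  proof (rule ccontr)
    assume "\<not> enat i \<le> x"
    then have "carrier (P i) = {\<zero>\<^bsub>P i\<^esub>}" using fin x by auto
    moreover have b: "bvec 0 1 \<in> carrier (?F i)" using i by simp
    ultimately have "f i (bvec 0 1) = \<zero>\<^bsub>P i\<^esub>" using mod_homD(1)[OF f(1) b] by simp
    then have "g i (f i (bvec 0 1)) = (\<lambda>k. 0)" using mod_hom_zero[OF g(1) modP modF] by simp
    moreover have "lkp (g i (f i (bvec 0 1)) 0) 0 = lkp (bvec 0 1 0) (0 :: 'x \<Rightarrow>\<^sub>0 nat)"
    proof (rule minimal_resolution_endo[OF min M mod_hom_compose[OF f(1) g(1)], where i = i])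
      show "\<epsilon> (g 0 (f 0 x)) = \<epsilon> x" if "x \<in> carrier (?F 0)" for x
        using that f(2) g(2) mod_homD(1)[OF f(1)] by simp
      show "\<delta> i (g (Suc i) (f (Suc i) x)) = g i (f i (\<delta> i x))" if "x \<in> carrier (?F (Suc i))" for i x
        using that f(3) g(3) mod_homD(1)[OF f(1)] by simp
    qed (rule b)
    ultimately show False by (simp add: bvec_def)
  qed
qed

section \<open>Minimal graded free resolutions in matrix form\<close>

text \<open>Vectors are not restricted to an index set. All sums run over index sets, so the
  coordinates elsewhere do not matter, and one set of vectors serves every position.\<close>

definition pvecs :: "'x set \<Rightarrow> ('i \<Rightarrow> ('x, 'k::zero) mpoly) set" where
  "pvecs V = {v. \<forall>i. v i \<in> polys V}"

text \<open>\<open>S n\<close> indexes a basis of the free module in homological position \<open>n\<close>, \<open>dg n s\<close> is the degree of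
  the basis element \<open>s\<close>, and \<open>D n\<close> is the matrix of the differential from position \<open>n + 1\<close> to
  position \<open>n\<close>, whose columns are indexed by \<open>S (n + 1)\<close>. Position \<open>0\<close> is \<open>R\<close> itself, and the
  image of the first differential is \<open>I\<close>.\<close>

definition mat_res ::
  "'x set \<Rightarrow> ('x, 'k::field) mpoly set \<Rightarrow> (nat \<Rightarrow> 'i set) \<Rightarrow> (nat \<Rightarrow> 'i \<Rightarrow> int) \<Rightarrow>
     (nat \<Rightarrow> 'i \<Rightarrow> 'i \<Rightarrow> ('x, 'k) mpoly) \<Rightarrow> bool" where
  "mat_res V I S dg D \<longleftrightarrow>
     (\<forall>n. finite (S n)) \<and>
     (\<exists>o'. S 0 = {o'} \<and> dg 0 o' = 0 \<and> I = (\<lambda>w. \<Sum>t\<in>S 1. D 0 o' t * w t) ` pvecs V) \<and>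
     (\<forall>n. \<forall>s\<in>S n. \<forall>t\<in>S (Suc n). D n s t \<in> polys V \<and> homog (dg (Suc n) t - dg n s) (D n s t) \<and>
        lkp (D n s t) 0 = 0) \<and>
     (\<forall>n. \<forall>v\<in>pvecs V. (\<forall>s\<in>S n. (\<Sum>t\<in>S (Suc n). D n s t * v t) = 0) \<longleftrightarrow>
        (\<exists>w\<in>pvecs V. \<forall>t\<in>S (Suc n). v t = (\<Sum>u\<in>S (Suc (Suc n)). D (Suc n) t u * w u)))"

lemma mat_resD:
  assumes "mat_res V I S dg D"
  shows "finite (S n)"
    and "\<exists>o'. S 0 = {o'} \<and> dg 0 o' = 0 \<and> I = (\<lambda>w. \<Sum>t\<in>S 1. D 0 o' t * w t) ` pvecs V"
    and "s \<in> S n \<Longrightarrow> t \<in> S (Suc n) \<Longrightarrow> D n s t \<in> polys V"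
    and "s \<in> S n \<Longrightarrow> t \<in> S (Suc n) \<Longrightarrow> homog (dg (Suc n) t - dg n s) (D n s t)"
    and "s \<in> S n \<Longrightarrow> t \<in> S (Suc n) \<Longrightarrow> lkp (D n s t) 0 = 0"
    and "v \<in> pvecs V \<Longrightarrow> (\<And>s. s \<in> S n \<Longrightarrow> (\<Sum>t\<in>S (Suc n). D n s t * v t) = 0) \<Longrightarrow>
      \<exists>w\<in>pvecs V. \<forall>t\<in>S (Suc n). v t = (\<Sum>u\<in>S (Suc (Suc n)). D (Suc n) t u * w u)"
    and "w \<in> pvecs V \<Longrightarrow> s \<in> S n \<Longrightarrow>
      (\<Sum>t\<in>S (Suc n). D n s t * (\<Sum>u\<in>S (Suc (Suc n)). D (Suc n) t u * w u)) = 0"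
proof -
  show fin: "finite (S n)" for n using assms unfolding mat_res_def by blast
  show "\<exists>o'. S 0 = {o'} \<and> dg 0 o' = 0 \<and> I = (\<lambda>w. \<Sum>t\<in>S 1. D 0 o' t * w t) ` pvecs V"
    using assms unfolding mat_res_def by blast
  show D: "s \<in> S n \<Longrightarrow> t \<in> S (Suc n) \<Longrightarrow> D n s t \<in> polys V"
    and "s \<in> S n \<Longrightarrow> t \<in> S (Suc n) \<Longrightarrow> homog (dg (Suc n) t - dg n s) (D n s t)"
    and "s \<in> S n \<Longrightarrow> t \<in> S (Suc n) \<Longrightarrow> lkp (D n s t) 0 = 0" for n s t
    using assms unfolding mat_res_def by blast+
  have ex: "(\<forall>s\<in>S n. (\<Sum>t\<in>S (Suc n). D n s t * v t) = 0) \<longleftrightarrow>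
        (\<exists>w\<in>pvecs V. \<forall>t\<in>S (Suc n). v t = (\<Sum>u\<in>S (Suc (Suc n)). D (Suc n) t u * w u))"
    if "v \<in> pvecs V" for n v
    using assms that unfolding mat_res_def by blast
  show "v \<in> pvecs V \<Longrightarrow> (\<And>s. s \<in> S n \<Longrightarrow> (\<Sum>t\<in>S (Suc n). D n s t * v t) = 0) \<Longrightarrow>
      \<exists>w\<in>pvecs V. \<forall>t\<in>S (Suc n). v t = (\<Sum>u\<in>S (Suc (Suc n)). D (Suc n) t u * w u)"
    using ex by blast
  assume w: "w \<in> pvecs V" and s: "s \<in> S n"
  \<comment> \<open>Entries of D outside the index sets are arbitrary, so v is cut off in order to
    have all its coordinates in \<open>polys V\<close>.\<close>
  define v where "v t = (if t \<in> S (Suc n) then (\<Sum>u\<in>S (Suc (Suc n)). D (Suc n) t u * w u) else 0)" for t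
  have "v \<in> pvecs V" using w D by (auto simp: v_def pvecs_def intro!: polys_sum polys_mult)
  from ex[OF this, of n] have "(\<Sum>t\<in>S (Suc n). D n s t * v t) = 0"
    using w s by (auto simp: v_def)
  then show "(\<Sum>t\<in>S (Suc n). D n s t * (\<Sum>u\<in>S (Suc (Suc n)). D (Suc n) t u * w u)) = 0"
    by (simp add: v_def)
qed

text \<open>Bases in \<open>graded_free\<close> are indexed by initial segments of the naturals,
  whereas a tensor product has triples as basis. Vectors are carried over by b and by its inverse
  c.\<close>

lemma mat_res_reindex:
  fixes D :: "nat \<Rightarrow> 'i \<Rightarrow> 'i \<Rightarrow> ('x, 'k::field) mpoly" and b :: "nat \<Rightarrow> 'j \<Rightarrow> 'i"
  assumes res: "mat_res V I S dg D" and b: "\<And>n. bij_betw (b n) (T n) (S n)"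
  shows "mat_res V I T (\<lambda>n j. dg n (b n j)) (\<lambda>n j l. D n (b n j) (b (Suc n) l))"
proof -
  have bT: "b n j \<in> S n" if "j \<in> T n" for n j using b[of n] that by (auto simp: bij_betw_def)
  define c where "c n = the_inv_into (T n) (b n)" for n
  have cS: "c n s \<in> T n" "b n (c n s) = s" if "s \<in> S n" for n s
    using b[of n] that bij_betw_the_inv_into[OF b[of n]] f_the_inv_into_f_bij_betw[OF b[of n]]
    by (auto simp: c_def bij_betw_def)
  have cT: "c n (b n j) = j" if "j \<in> T n" for n j
    using b[of n] that by (simp add: c_def bij_betw_def the_inv_into_f_f)
  have sumS: "(\<Sum>j\<in>T n. f (b n j)) = sum f (S n)" for n and f :: "'i \<Rightarrow> ('x, 'k) mpoly"
    by (rule sum.reindex_bij_betw[OF b])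
  have sumT: "(\<Sum>j\<in>T n. f (b n j) * v j) = (\<Sum>s\<in>S n. f s * v (c n s))"
    for n and f :: "'i \<Rightarrow> ('x, 'k) mpoly" and v
    by (subst sumS[symmetric]) (auto simp: cT intro: sum.cong)
  have comp: "(\<lambda>i. v (f i)) \<in> pvecs V" if "v \<in> pvecs V" for v and f :: "'c \<Rightarrow> 'd"
    using that by (simp add: pvecs_def)
  obtain o' where o': "S 0 = {o'}" "dg 0 o' = 0" "I = (\<lambda>w. \<Sum>t\<in>S 1. D 0 o' t * w t) ` pvecs V"
    using mat_resD(2)[OF res] by blast
  have T0: "T 0 = {c 0 o'}"
  proof (intro equalityI subsetI)
    fix j assume "j \<in> T 0"
    then show "j \<in> {c 0 o'}" using cT[of j 0] bT[of j 0] o'(1) by simp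
  qed (use cS(1)[of o' 0] o'(1) in simp)
  have bo: "b 0 (c 0 o') = o'" using cS(2)[of o' 0] o'(1) by simp
  have "I = (\<lambda>w. \<Sum>j\<in>T 1. D 0 (b 0 (c 0 o')) (b (Suc 0) j) * w j) ` pvecs V"
    unfolding o'(3) bo
  proof (intro equalityI subsetI)
    fix p assume "p \<in> (\<lambda>w. \<Sum>t\<in>S 1. D 0 o' t * w t) ` pvecs V"
    then obtain w where p: "p = (\<Sum>t\<in>S 1. D 0 o' t * w t)" and w: "w \<in> pvecs V" ..
    have "p = (\<Sum>j\<in>T 1. D 0 o' (b (Suc 0) j) * w (b (Suc 0) j))"
      unfolding p using sumS[of "\<lambda>t. D 0 o' t * w t" "Suc 0"] by simp
    then show "p \<in> (\<lambda>w. \<Sum>j\<in>T 1. D 0 o' (b (Suc 0) j) * w j) ` pvecs V"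
      using comp[OF w, of "b (Suc 0)"] by (rule image_eqI)
  next
    fix p assume "p \<in> (\<lambda>w. \<Sum>j\<in>T 1. D 0 o' (b (Suc 0) j) * w j) ` pvecs V"
    then obtain w where p: "p = (\<Sum>j\<in>T 1. D 0 o' (b (Suc 0) j) * w j)" and w: "w \<in> pvecs V" ..
    have "p = (\<Sum>t\<in>S 1. D 0 o' t * w (c (Suc 0) t))"
      unfolding p using sumT[of "D 0 o'" "Suc 0" w] by simp
    then show "p \<in> (\<lambda>w. \<Sum>t\<in>S 1. D 0 o' t * w t) ` pvecs V"
      using comp[OF w, of "c (Suc 0)"] by (rule image_eqI)
  qed
  moreover have "(\<forall>j\<in>T n. (\<Sum>l\<in>T (Suc n). D n (b n j) (b (Suc n) l) * v l) = 0) \<longleftrightarrow>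
        (\<exists>w\<in>pvecs V. \<forall>l\<in>T (Suc n). v l = (\<Sum>u\<in>T (Suc (Suc n)). D (Suc n) (b (Suc n) l) (b (Suc (Suc n)) u) * w u))"
    if v: "v \<in> pvecs V" for n v
  proof
    assume "\<forall>j\<in>T n. (\<Sum>l\<in>T (Suc n). D n (b n j) (b (Suc n) l) * v l) = 0"
    then have "(\<Sum>t\<in>S (Suc n). D n s t * v (c (Suc n) t)) = 0" if "s \<in> S n" for s
      using cS[OF that] sumT[of "D n s" "Suc n" v] by auto
    from mat_resD(6)[OF res comp[OF v] this] obtain w where w: "w \<in> pvecs V"
      "\<And>t. t \<in> S (Suc n) \<Longrightarrow> v (c (Suc n) t) = (\<Sum>u\<in>S (Suc (Suc n)). D (Suc n) t u * w u)" by blast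
    have "v l = (\<Sum>u\<in>T (Suc (Suc n)). D (Suc n) (b (Suc n) l) (b (Suc (Suc n)) u) * w (b (Suc (Suc n)) u))"
      if "l \<in> T (Suc n)" for l
      using w(2)[OF bT[OF that]] cT[OF that] sumS[of "\<lambda>u. D (Suc n) (b (Suc n) l) u * w u" "Suc (Suc n)"] by simp
    then show "\<exists>w\<in>pvecs V. \<forall>l\<in>T (Suc n). v l =
        (\<Sum>u\<in>T (Suc (Suc n)). D (Suc n) (b (Suc n) l) (b (Suc (Suc n)) u) * w u)"
      using comp[OF w(1), of "b (Suc (Suc n))"] by (intro bexI[of _ "\<lambda>u. w (b (Suc (Suc n)) u)"]) auto
  next
    assume "\<exists>w\<in>pvecs V. \<forall>l\<in>T (Suc n). v l =
        (\<Sum>u\<in>T (Suc (Suc n)). D (Suc n) (b (Suc n) l) (b (Suc (Suc n)) u) * w u)"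
    then obtain w where w: "w \<in> pvecs V" "\<And>l. l \<in> T (Suc n) \<Longrightarrow> v l =
        (\<Sum>u\<in>T (Suc (Suc n)). D (Suc n) (b (Suc n) l) (b (Suc (Suc n)) u) * w u)" by blast
    show "\<forall>j\<in>T n. (\<Sum>l\<in>T (Suc n). D n (b n j) (b (Suc n) l) * v l) = 0"
    proof
      fix j assume j: "j \<in> T n"
      have "(\<Sum>l\<in>T (Suc n). D n (b n j) (b (Suc n) l) * v l) =
        (\<Sum>l\<in>T (Suc n). D n (b n j) (b (Suc n) l) *
          (\<Sum>u\<in>S (Suc (Suc n)). D (Suc n) (b (Suc n) l) u * w (c (Suc (Suc n)) u)))"
        using w(2) by (intro sum.cong) (auto simp: sumT)
      also have "\<dots> = (\<Sum>t\<in>S (Suc n). D n (b n j) t *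
          (\<Sum>u\<in>S (Suc (Suc n)). D (Suc n) t u * w (c (Suc (Suc n)) u)))"
        by (rule sumS)
      also have "\<dots> = 0" by (rule mat_resD(7)[OF res comp[OF w(1)] bT[OF j]])
      finally show "(\<Sum>l\<in>T (Suc n). D n (b n j) (b (Suc n) l) * v l) = 0" .
    qed
  qed
  moreover have "finite (T n)" for n using mat_resD(1)[OF res] bij_betw_finite[OF b] by blast
  ultimately show ?thesis
    unfolding mat_res_def using mat_resD(3-5)[OF res] bT T0 o' cS(2)[of o' 0] by auto
qed

text \<open>The passage from matrices to modules. Elements of \<open>graded_free\<close> vanish
  beyond the length of the list, so vectors are truncated on the way; the sums defining the
  differential do not see the difference.\<close>

lemma mat_res_minimal_resolution:
  fixes I :: "('x, 'k::field) mpoly set" and r :: "nat \<Rightarrow> nat"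
  assumes res: "mat_res V I (\<lambda>n. {..<r n}) dg D" and I: "pideal V I"
  shows "minimal_graded_free_resolution V (quotient_module V I) (\<lambda>n. map (dg n) [0..<r n])
    (\<lambda>v. coset V I (v 0)) (\<lambda>n v k. if k < r n then \<Sum>l<r (Suc n). D n k l * v l else 0)"
proof -
  let ?F = "\<lambda>n. graded_free V (map (dg n) [0..<r n]) :: (('x, 'k) mpoly, _) graded_module"
  let ?M = "quotient_module V I"
  let ?\<delta> = "\<lambda>n v k. if k < r n then \<Sum>l<r (Suc n). D n k l * v l else 0"
  note q = quotient_module_simps[OF I]
  note D = mat_resD(3-5)[OF res, simplified]
  have r0: "r 0 = 1" and dg0: "dg 0 0 = 0" and Iim: "I = (\<lambda>w. \<Sum>t<r 1. D 0 0 t * w t) ` pvecs V"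
  proof -
    obtain o' where o': "{..<r 0} = {o'}" "dg 0 o' = 0" "I = (\<lambda>w. \<Sum>t<r 1. D 0 o' t * w t) ` pvecs V"
      using mat_resD(2)[OF res] by blast
    from o'(1) have "card {..<r 0} = 1" by simp
    then show r0: "r 0 = 1" by simp
    with o'(1) have "o' = 0" by auto
    with o' show "dg 0 0 = 0" "I = (\<lambda>w. \<Sum>t<r 1. D 0 0 t * w t) ` pvecs V" by auto
  qed
  have car: "v \<in> carrier (?F n) \<longleftrightarrow> v \<in> pvecs V \<and> (\<forall>k\<ge>r n. v k = 0)" for n v
    by (simp add: carrier_graded_free pvecs_def)
  have trunc: "(\<lambda>l. if l < r n then w l else 0) \<in> carrier (?F n)" if "w \<in> pvecs V" for w n
    using that by (auto simp: car pvecs_def)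
  have \<delta>c: "?\<delta> n v \<in> carrier (?F n)" if "v \<in> carrier (?F (Suc n))" for n v
    using that D(1) by (auto simp: car pvecs_def intro!: polys_sum polys_mult)
  have trunc_eq: "?\<delta> n (\<lambda>l. if l < r (Suc n) then w l else 0) = ?\<delta> n w" for n w
    by (auto intro!: sum.cong)
  have \<epsilon>h: "(\<lambda>v. coset V I (v 0)) \<in> mod_hom (mpoly_ring V) (?F 0) ?M"
    by (rule mod_homI) (auto simp: q carrier_graded_free)
  have \<delta>h: "?\<delta> n \<in> mod_hom (mpoly_ring V) (?F (Suc n)) (?F n)" for n
  proof (rule mod_homI)
    show "?\<delta> n v \<in> carrier (?F n)" if "v \<in> carrier (?F (Suc n))" for v using \<delta>c that .
  qed (auto simp: fun_eq_iff sum.distrib algebra_simps sum_distrib_left)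
  have "resolution (mpoly_ring V) ?M ?F (\<lambda>v. coset V I (v 0)) ?\<delta>"
    unfolding resolution_def a_kernel_def'
  proof (intro conjI allI \<epsilon>h \<delta>h)
    have "coset V I p \<in> (\<lambda>v. coset V I (v 0)) ` carrier (?F 0)" if "p \<in> polys V" for p
      using that r0 by (intro image_eqI[of _ _ "bvec 0 p"] bvec_in) (auto simp: bvec_def)
    then show "(\<lambda>v. coset V I (v 0)) ` carrier (?F 0) = carrier ?M"
      by (auto simp: q carrier_graded_free)
  next
    show "?\<delta> 0 ` carrier (?F (Suc 0)) = {x \<in> carrier (?F 0). coset V I (x 0) = \<zero>\<^bsub>?M\<^esub>}"
    proof (intro equalityI subsetI)
      fix v assume "v \<in> ?\<delta> 0 ` carrier (?F (Suc 0))"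
      then obtain w where w: "w \<in> carrier (?F (Suc 0))" and v: "v = ?\<delta> 0 w" ..
      have "v 0 \<in> I" unfolding Iim v using w r0 by (auto simp: car)
      moreover have "v \<in> carrier (?F 0)" using \<delta>c[OF w] v by simp
      ultimately show "v \<in> {x \<in> carrier (?F 0). coset V I (x 0) = \<zero>\<^bsub>?M\<^esub>}"
        using q(7) by (auto simp: carrier_graded_free)
    next
      fix v assume "v \<in> {x \<in> carrier (?F 0). coset V I (x 0) = \<zero>\<^bsub>?M\<^esub>}"
      then have v: "v \<in> carrier (?F 0)" and "coset V I (v 0) = \<zero>\<^bsub>?M\<^esub>" by auto
      then have "v 0 \<in> I" using q(7) by (auto simp: carrier_graded_free)
      then obtain w where w: "w \<in> pvecs V" "v 0 = (\<Sum>t<r 1. D 0 0 t * w t)" using Iim by blast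
      have "v = ?\<delta> 0 w" using w(2) v[unfolded car] r0 by (auto simp: fun_eq_iff)
      then show "v \<in> ?\<delta> 0 ` carrier (?F (Suc 0))"
        using trunc[OF w(1), of "Suc 0"] unfolding trunc_eq[of 0 w, symmetric] by (rule image_eqI)
    qed
  next
    fix n
    show "?\<delta> (Suc n) ` carrier (?F (Suc (Suc n))) = {x \<in> carrier (?F (Suc n)). ?\<delta> n x = \<zero>\<^bsub>?F n\<^esub>}"
    proof (intro equalityI subsetI)
      fix v assume "v \<in> ?\<delta> (Suc n) ` carrier (?F (Suc (Suc n)))"
      then obtain w where w: "w \<in> carrier (?F (Suc (Suc n)))" and v: "v = ?\<delta> (Suc n) w" ..
      have "(\<Sum>l<r (Suc n). D n k l * v l) = 0" if "k < r n" for k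
        unfolding v using mat_resD(7)[OF res, of w k n] w that by (simp add: car)
      then have "?\<delta> n v = \<zero>\<^bsub>?F n\<^esub>" by auto
      moreover have "v \<in> carrier (?F (Suc n))" using \<delta>c[OF w] unfolding v .
      ultimately show "v \<in> {x \<in> carrier (?F (Suc n)). ?\<delta> n x = \<zero>\<^bsub>?F n\<^esub>}" by blast
    next
      fix v assume "v \<in> {x \<in> carrier (?F (Suc n)). ?\<delta> n x = \<zero>\<^bsub>?F n\<^esub>}"
      then have v: "v \<in> carrier (?F (Suc n))" and 0: "?\<delta> n v = \<zero>\<^bsub>?F n\<^esub>" by auto
      have "(\<Sum>l<r (Suc n). D n k l * v l) = 0" if "k \<in> {..<r n}" for k
        using fun_cong[OF 0, of k] that by simp
      then obtain w where w: "w \<in> pvecs V" "\<forall>t\<in>{..<r (Suc n)}. v t = (\<Sum>u<r (Suc (Suc n)). D (Suc n) t u * w u)"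
        using mat_resD(6)[OF res, of v n] v by (auto simp: car)
      have "v = ?\<delta> (Suc n) w" using w(2) v by (auto simp: fun_eq_iff car not_less)
      then show "v \<in> ?\<delta> (Suc n) ` carrier (?F (Suc (Suc n)))"
        using trunc[OF w(1), of "Suc (Suc n)"] unfolding trunc_eq[of "Suc n" w, symmetric] by (rule image_eqI)
    qed
  qed
  moreover have "graded_map (?F 0) ?M (\<lambda>v. coset V I (v 0))"
    using r0 dg0 by (auto simp: graded_map_def gpart_graded_free q mpoly_part_iff carrier_graded_free)
  moreover have "graded_map (?F (Suc n)) (?F n) (?\<delta> n)" for n
    unfolding graded_map_def
  proof (intro allI subsetI, elim imageE)
    fix d u v assume v: "v \<in> gpart (?F (Suc n)) d" and u: "u = ?\<delta> n v"
    have "homog (d - dg n k) (D n k l * v l)" if "k < r n" "l < r (Suc n)" for k l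
      using homog_mult[OF D(2)[OF that], of "d - dg (Suc n) l" "v l"] v that by (simp add: gpart_graded_free)
    then show "u \<in> gpart (?F n) d"
      using v \<delta>c u by (auto simp: gpart_graded_free intro!: homog_sum)
  qed
  moreover have "?\<delta> n v k \<in> irrelevant_ideal V" if "v \<in> carrier (?F (Suc n))" for n v k
    using \<delta>c[OF that] D(3) by (auto simp: irrelevant_ideal_iff car pvecs_def lookup_0_sum)
  ultimately show ?thesis by (simp add: minimal_graded_free_resolution_def)
qed

text \<open>Here the definite description is traded for a count in an index set, where all later
  arguments about degrees take place.\<close>

lemma mat_res_betti:
  fixes I :: "('x, 'k::field) mpoly set" and S :: "nat \<Rightarrow> 'i set"
  assumes res: "mat_res V I S dg D" and I: "hideal V I"
  shows "betti V (quotient_module V I) n j = card {s \<in> S n. dg n s = j}"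
    and "S n \<noteq> {} \<Longrightarrow> enat n \<le> proj_dim (mpoly_ring V) (quotient_module V I)"
proof -
  have "\<exists>b. bij_betw b {..<card (S n)} (S n)" for n
    using ex_bij_betw_nat_finite[OF mat_resD(1)[OF res]] by (auto simp: atLeast0LessThan)
  then obtain b where b: "\<And>n. bij_betw (b n) {..<card (S n)} (S n)" by metis
  have pI: "pideal V I" using I by (simp add: hideal_def)
  note min = mat_res_minimal_resolution[OF mat_res_reindex[OF res b] pI]
  let ?A = "{k. k < card (S n) \<and> dg n (b n k) = j}"
  have "card {s \<in> S n. dg n s = j} = card (b n ` ?A)"
    using b[of n] by (intro arg_cong[where f = card]) (auto simp: bij_betw_def)
  also have "\<dots> = card ?A"
    using b[of n] by (intro card_image) (auto simp: bij_betw_def inj_on_def)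
  also have "\<dots> = count_list (map (\<lambda>k. dg n (b n k)) [0..<card (S n)]) j"
    unfolding count_list_eq_card by (intro arg_cong[where f = card]) auto
  also have "\<dots> = betti V (quotient_module V I) n j"
    using betti_eq_count[OF I min] by simp
  finally show "betti V (quotient_module V I) n j = card {s \<in> S n. dg n s = j}" by simp
  show "S n \<noteq> {} \<Longrightarrow> enat n \<le> proj_dim (mpoly_ring V) (quotient_module V I)"
    using le_proj_dim[OF min module_quotient_module[OF pI], of n] mat_resD(1)[OF res] by (auto simp: card_gt_0_iff)
qed

section \<open>Dickson's lemma\<close>

text \<open>There is always a monotone subsequence; a decreasing one in the naturals becomes
  constant at its minimum, and that tail is increasing as well.\<close>

lemma nat_seq_incseq_subseq:
  fixes u :: "nat \<Rightarrow> nat"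
  shows "\<exists>\<phi>. strict_mono \<phi> \<and> incseq (\<lambda>n. u (\<phi> n))"
proof -
  obtain \<phi> where \<phi>: "strict_mono \<phi>" "monoseq (\<lambda>n. u (\<phi> n))"
    using seq_monosub[of u] by (auto simp: strict_mono_def)
  show ?thesis
  proof (cases "incseq (\<lambda>n. u (\<phi> n))")
    case False
    then have dec: "decseq (\<lambda>n. u (\<phi> n))" using \<phi>(2) by (simp add: monoseq_iff)
    obtain N where N: "\<And>n. u (\<phi> N) \<le> u (\<phi> n)"
      using ex_has_least_nat[of "\<lambda>_. True" 0 "\<lambda>n. u (\<phi> n)"] by auto
    have "u (\<phi> (n + N)) = u (\<phi> N)" for n
      using N[of "n + N"] decseqD[OF dec, of N "n + N"] by simp
    then show ?thesis
      using \<phi>(1) by (intro exI[of _ "\<lambda>n. \<phi> (n + N)"]) (auto simp: strict_mono_def incseq_def)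
  qed (use \<phi> in blast)
qed

lemma nat_family_incseq_subseq:
  fixes u :: "nat \<Rightarrow> 'x \<Rightarrow> nat"
  assumes "finite V"
  shows "\<exists>\<phi>. strict_mono \<phi> \<and> (\<forall>x\<in>V. incseq (\<lambda>n. u (\<phi> n) x))"
  using assms
proof (induction V rule: finite_induct)
  case empty
  show ?case by (intro exI[of _ id]) (auto simp: strict_mono_def)
next
  case (insert x V)
  then obtain \<phi> where \<phi>: "strict_mono \<phi>" "\<forall>x\<in>V. incseq (\<lambda>n. u (\<phi> n) x)" by blast
  obtain \<psi> where \<psi>: "strict_mono \<psi>" "incseq (\<lambda>n. u (\<phi> (\<psi> n)) x)"
    using nat_seq_incseq_subseq[of "\<lambda>n. u (\<phi> n) x"] by blast
  have "incseq (\<lambda>n. u (\<phi> (\<psi> n)) y)" if "y \<in> V" for y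
    using \<phi>(2) that \<psi>(1) by (auto simp: incseq_def strict_mono_less_eq)
  then show ?case using \<phi>(1) \<psi> by (intro exI[of _ "\<lambda>n. \<phi> (\<psi> n)"]) (auto simp: strict_mono_def)
qed

lemma le_monomial_iff: "(\<exists>s. a = b + s) \<longleftrightarrow> (\<forall>x. lkp b x \<le> lkp a x)" for a b :: "'x \<Rightarrow>\<^sub>0 nat"
proof
  assume "\<forall>x. lkp b x \<le> lkp a x"
  then have "a = b + (a - b)" by (intro poly_mapping_eqI) (simp add: lookup_add lookup_minus)
  then show "\<exists>s. a = b + s" ..
qed (auto simp: lookup_add)

text \<open>B consists of the elements of A that are minimal for divisibility. Infinitely many of
  them would contain a sequence with weakly increasing exponents, in which one divides another,
  against minimality.\<close>

lemma dickson:
  fixes A :: "('x \<Rightarrow>\<^sub>0 nat) set"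
  assumes V: "finite V" and A: "\<And>a. a \<in> A \<Longrightarrow> mkeys a \<subseteq> V"
  shows "\<exists>B\<subseteq>A. finite B \<and> (\<forall>a\<in>A. \<exists>b\<in>B. \<exists>s. a = b + s)"
proof (intro exI conjI)
  let ?B = "{b \<in> A. \<forall>c\<in>A. (\<exists>s. b = c + s) \<longrightarrow> c = b}"
  show "?B \<subseteq> A" by blast
  show "finite ?B"
  proof (rule ccontr)
    assume "infinite ?B"
    then obtain f :: "nat \<Rightarrow> _" where f: "inj f" "range f \<subseteq> ?B"
      using infinite_countable_subset by blast
    obtain \<phi> where \<phi>: "strict_mono \<phi>" "\<And>x. x \<in> V \<Longrightarrow> incseq (\<lambda>n. lkp (f (\<phi> n)) x)"
      using nat_family_incseq_subseq[OF V, of "\<lambda>n. lkp (f n)"] by blast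
    have "lkp (f (\<phi> 0)) x \<le> lkp (f (\<phi> 1)) x" for x
    proof (cases "x \<in> V")
      case True
      then show ?thesis using \<phi>(2) by (simp add: incseq_def)
    next
      case False
      moreover have "f (\<phi> 0) \<in> A" using f(2) by blast
      ultimately have "x \<notin> mkeys (f (\<phi> 0))" using A by blast
      then show ?thesis by (simp add: in_keys_iff)
    qed
    then have "f (\<phi> 0) = f (\<phi> 1)" using f(2) le_monomial_iff[of "f (\<phi> 1)" "f (\<phi> 0)"] by blast
    then have "\<phi> 0 = \<phi> 1" using f(1) by (simp add: inj_eq)
    then show False using strict_monoD[OF \<phi>(1), of 0 1] by simp
  qed
  show "\<forall>a\<in>A. \<exists>b\<in>?B. \<exists>s. a = b + s"
  proof
    fix a assume a: "a \<in> A"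
    \<comment> \<open>Among the divisors of a in A, one of least total degree is minimal for
      divisibility.\<close>
    let ?P = "\<lambda>c. c \<in> A \<and> (\<exists>s. a = c + s)"
    have "?P a" using a by (auto intro: exI[of _ 0])
    from ex_has_least_nat[of ?P, OF this, of mdeg]
    obtain b where "?P b \<and> (\<forall>c. ?P c \<longrightarrow> mdeg b \<le> mdeg c)" ..
    then have b: "?P b" and min: "\<And>c. ?P c \<Longrightarrow> mdeg b \<le> mdeg c" by simp_all
    have "\<forall>c\<in>A. (\<exists>s. b = c + s) \<longrightarrow> c = b"
    proof (intro ballI impI, elim exE)
      fix c s assume that: "c \<in> A" "b = c + s"
      have "?P c" using b that by (auto simp: add.assoc)
      then have "mdeg s = 0" using min[of c] that(2) by (simp add: mdeg_add)
      then show "c = b" using that(2) by (simp add: mdeg_eq_0)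
    qed
    then have "b \<in> ?B" using b by simp
    then show "\<exists>b\<in>?B. \<exists>s. a = b + s" using b by (intro bexI[of _ b]) simp_all
  qed
qed

lemma finite_monomials_mdeg:
  assumes "finite V" shows "finite {m :: 'x \<Rightarrow>\<^sub>0 nat. mkeys m \<subseteq> V \<and> mdeg m = n}"
proof (rule inj_on_finite)
  show "inj_on lkp {m :: 'x \<Rightarrow>\<^sub>0 nat. mkeys m \<subseteq> V \<and> mdeg m = n}"
    by (rule inj_onI) (rule poly_mapping_eqI, simp)
  show "lkp ` {m :: 'x \<Rightarrow>\<^sub>0 nat. mkeys m \<subseteq> V \<and> mdeg m = n}
      \<subseteq> {f. \<forall>x. (x \<in> V \<longrightarrow> f x \<in> {..n}) \<and> (x \<notin> V \<longrightarrow> f x = 0)}"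
  proof (clarsimp, intro conjI impI)
    fix m :: "'x \<Rightarrow>\<^sub>0 nat" and x
    assume m: "mkeys m \<subseteq> V" "n = mdeg m"
    show "x \<in> V \<Longrightarrow> lkp m x \<le> mdeg m"
      unfolding mdeg_superset[OF assms m(1)] using assms by (intro member_le_sum) auto
    show "x \<notin> V \<Longrightarrow> lkp m x = 0" using m by (auto simp: in_keys_iff)
  qed
  show "finite {f :: 'x \<Rightarrow> nat. \<forall>x. (x \<in> V \<longrightarrow> f x \<in> {..n}) \<and> (x \<notin> V \<longrightarrow> f x = 0)}"
    by (intro finite_set_of_finite_funs assms) auto
qed

section \<open>Graded submodules of free modules are finitely generated\<close>

definition vhomog :: "(nat \<Rightarrow> int) \<Rightarrow> int \<Rightarrow> (nat \<Rightarrow> ('x, 'k::zero) mpoly) \<Rightarrow> bool" where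
  "vhomog e d v \<longleftrightarrow> (\<forall>k. homog (d - e k) (v k))"

text \<open>The graded submodules of the free module with basis S whose basis element k has degree e
  k.\<close>

definition gsub :: "'x set \<Rightarrow> nat set \<Rightarrow> (nat \<Rightarrow> int) \<Rightarrow> (nat \<Rightarrow> ('x, 'k::field) mpoly) set \<Rightarrow> bool" where
  "gsub V S e N \<longleftrightarrow> N \<subseteq> pvecs V \<and> (\<forall>v\<in>N. \<forall>k. k \<notin> S \<longrightarrow> v k = 0) \<and> (\<lambda>k. 0) \<in> N \<and>
     (\<forall>v\<in>N. \<forall>w\<in>N. (\<lambda>k. v k + w k) \<in> N) \<and> (\<forall>r\<in>polys V. \<forall>v\<in>N. (\<lambda>k. r * v k) \<in> N) \<and>
     (\<forall>v\<in>N. \<forall>d. (\<lambda>k. hcomp (d - e k) (v k)) \<in> N)"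

lemma gsubD:
  assumes "gsub V S e N"
  shows "v \<in> N \<Longrightarrow> v \<in> pvecs V" "v \<in> N \<Longrightarrow> k \<notin> S \<Longrightarrow> v k = 0" "(\<lambda>k. 0) \<in> N"
    "v \<in> N \<Longrightarrow> w \<in> N \<Longrightarrow> (\<lambda>k. v k + w k) \<in> N"
    "r \<in> polys V \<Longrightarrow> v \<in> N \<Longrightarrow> (\<lambda>k. r * v k) \<in> N"
    "v \<in> N \<Longrightarrow> (\<lambda>k. hcomp (d - e k) (v k)) \<in> N"
  using assms unfolding gsub_def by blast+

lemma gsub_sum:
  assumes "gsub V S e N" "\<And>i. i \<in> K \<Longrightarrow> f i \<in> N"
  shows "(\<lambda>k. \<Sum>i\<in>K. f i k) \<in> N"
  using assms(2)
proof (induction K rule: infinite_finite_induct)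
  case (insert x F)
  then show ?case using gsubD(4)[OF assms(1), of "f x" "\<lambda>k. \<Sum>i\<in>F. f i k"] by simp
qed (simp_all add: gsubD(3)[OF assms(1)])

text \<open>A vector is the sum of its homogeneous components, all of which lie in N; only finitely
  many are nonzero since S is finite.\<close>

lemma gsub_homog_induct [consumes 3, case_names homog add]:
  fixes N :: "(nat \<Rightarrow> ('x, 'k::field) mpoly) set"
  assumes N: "gsub V S e N" and v: "v \<in> N" and S: "finite S"
    and Q: "\<And>v d. v \<in> N \<Longrightarrow> vhomog e d v \<Longrightarrow> Q v"
    and add: "\<And>v w. v \<in> N \<Longrightarrow> w \<in> N \<Longrightarrow> Q v \<Longrightarrow> Q w \<Longrightarrow> Q (\<lambda>k. v k + w k)"
  shows "Q v"
proof -
  define E where "E = (\<Union>k\<in>S. (\<lambda>m. int (mdeg m) + e k) ` mkeys (v k))"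
  have E: "finite E" using S by (simp add: E_def)
  let ?c = "\<lambda>d k. hcomp (d - e k) (v k)"
  have eq: "(\<Sum>d\<in>E. ?c d k) = v k" for k
  proof (cases "k \<in> S")
    case True
    have "(\<Sum>d\<in>E. ?c d k) = (\<Sum>d\<in>(\<lambda>d. d - e k) ` E. hcomp d (v k))"
      by (subst sum.reindex) (auto simp: inj_on_def)
    also have "\<dots> = v k"
      using E True by (intro hcomp_decomp) (force simp: E_def image_iff)+
    finally show ?thesis .
  next
    case False
    then show ?thesis using gsubD(2)[OF N v] by simp
  qed
  have "Q (\<lambda>k. \<Sum>d\<in>F. ?c d k)" if "finite F" for F
    using that
  proof (induction F rule: finite_induct)
    case empty
    have "vhomog e 0 (\<lambda>k. 0 :: ('x, 'k) mpoly)" by (simp add: vhomog_def)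
    then show ?case using Q[OF gsubD(3)[OF N]] by simp
  next
    case (insert d F)
    have "Q (\<lambda>k. ?c d k + (\<Sum>d\<in>F. ?c d k))"
    proof (rule add)
      show "(\<lambda>k. \<Sum>d\<in>F. ?c d k) \<in> N" by (intro gsub_sum[OF N] gsubD(6)[OF N v])
      show "Q (?c d)" using Q[OF gsubD(6)[OF N v], of d d] by (simp add: vhomog_def)
    qed (use insert.IH gsubD(6)[OF N v] in auto)
    then show ?case using insert.hyps by simp
  qed
  from this[OF E] show ?thesis unfolding eq .
qed

text \<open>Pairs are ordered lexicographically, by coordinate and then by the linear order on
  exponent vectors, which is compatible with addition. The maximum of this set is the leading
  position for a position-over-term order.\<close>

definition vsupp :: "nat set \<Rightarrow> (nat \<Rightarrow> ('x, 'k::zero) mpoly) \<Rightarrow> (nat \<times> ('x \<Rightarrow>\<^sub>0 nat)) set" where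
  "vsupp S v = (SIGMA k:S. mkeys (v k))"

lemma finite_vsupp: "finite S \<Longrightarrow> finite (vsupp S v)"
  by (simp add: vsupp_def)

definition gens :: "'x set \<Rightarrow> (nat \<Rightarrow> int) \<Rightarrow> (nat \<Rightarrow> ('x, 'k::field) mpoly) set \<Rightarrow>
    'i set \<Rightarrow> ('i \<Rightarrow> nat \<Rightarrow> ('x, 'k) mpoly) \<Rightarrow> ('i \<Rightarrow> int) \<Rightarrow> bool" where
  "gens V e N K w f \<longleftrightarrow> finite K \<and> (\<forall>i\<in>K. w i \<in> N \<and> vhomog e (f i) (w i)) \<and>
     (\<forall>v\<in>N. \<exists>c\<in>pvecs V. \<forall>k. v k = (\<Sum>i\<in>K. c i * w i k))"

text \<open>A Groebner basis argument: the leading positions \<open>(k, m)\<close> of homogeneous elements have finitely many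
  minimal elements by Dickson's lemma, and reducing modulo elements with these leading positions terminates
  since there are only finitely many positions of each degree.\<close>

lemma gens_ex:
  fixes N :: "(nat \<Rightarrow> ('x::linorder, 'k::field) mpoly) set"
  assumes V: "finite V" and S: "finite S" and N: "gsub V S e N"
  shows "\<exists>K (w :: nat \<times> ('x \<Rightarrow>\<^sub>0 nat) \<Rightarrow> _) f. gens V e N K w f"
proof -
  define L where "L = {Max (vsupp S v) | v. v \<in> N \<and> (\<exists>d. vhomog e d v) \<and> vsupp S v \<noteq> {}}"
  define A where "A k = {m. (k, m) \<in> L}" for k
  have Ld: "\<exists>v d. v \<in> N \<and> vhomog e d v \<and> vsupp S v \<noteq> {} \<and> Max (vsupp S v) = p" if "p \<in> L" for p
    using that by (auto simp: L_def)
  \<comment> \<open>One homogeneous element u p is fixed for each leading position p; f p is its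
    degree.\<close>
  then obtain u f where u: "\<And>p. p \<in> L \<Longrightarrow> u p \<in> N \<and> vhomog e (f p) (u p) \<and> vsupp S (u p) \<noteq> {} \<and>
      Max (vsupp S (u p)) = p" by metis
  have lead: "p \<in> vsupp S (u p)" "q \<in> vsupp S (u p) \<Longrightarrow> q \<le> p" if "p \<in> L" for p q
    using u[OF that] Max_in[OF finite_vsupp[OF S], of "u p"] Max_ge[OF finite_vsupp[OF S], of q "u p"] by auto
  have keysV: "mkeys m \<subseteq> V" if "v \<in> N" "m \<in> mkeys (v k)" for v k m
    using gsubD(1)[OF N that(1)] that(2) by (auto simp: pvecs_def in_polys_iff in_keys_iff)
  have "\<exists>B\<subseteq>A k. finite B \<and> (\<forall>a\<in>A k. \<exists>b\<in>B. \<exists>s. a = b + s)" for k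
  proof (rule dickson[OF V])
    fix m assume "m \<in> A k"
    then have "(k, m) \<in> L" by (simp add: A_def)
    then show "mkeys m \<subseteq> V"
      using lead(1)[of "(k, m)"] u[of "(k, m)"] keysV by (auto simp: vsupp_def)
  qed
  then obtain B where B: "\<And>k. B k \<subseteq> A k" "\<And>k. finite (B k)" "\<And>k a. a \<in> A k \<Longrightarrow> \<exists>b\<in>B k. \<exists>s. a = b + s"
    by metis
  define K where "K = (SIGMA k:S. B k)"
  have K: "finite K" "K \<subseteq> L" using S B by (auto simp: K_def A_def)
  let ?Q = "\<lambda>v. \<exists>c\<in>pvecs V. \<forall>k. v k = (\<Sum>i\<in>K. c i * u i k)"
  have Qadd: "?Q (\<lambda>k. v k + w k)" if Qv: "?Q v" and Qw: "?Q w" for v w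
  proof -
    obtain c c' where "c \<in> pvecs V" "c' \<in> pvecs V" "\<forall>k. v k = (\<Sum>i\<in>K. c i * u i k)" "\<forall>k. w k = (\<Sum>i\<in>K. c' i * u i k)"
      using Qv Qw by blast
    then show ?thesis
      by (intro bexI[of _ "\<lambda>i. c i + c' i"]) (auto simp: pvecs_def sum.distrib algebra_simps)
  qed
  have Qu: "?Q (\<lambda>k. p * u i k)" if "i \<in> K" "p \<in> polys V" for i p
  proof -
    have "(\<Sum>j\<in>K. (if j = i then p else 0) * u j k) = p * u i k" for k
      using that K(1) by (simp add: if_distrib[of "\<lambda>x. x * _"] cong: if_cong)
    then show ?thesis using that by (intro bexI[of _ "\<lambda>j. if j = i then p else 0"]) (auto simp: pvecs_def)
  qed
  have hom: "?Q v" if v: "v \<in> N" "vhomog e d v" for v d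
  proof -
    define Mon where "Mon = (SIGMA k:S. {m :: 'x \<Rightarrow>\<^sub>0 nat. mkeys m \<subseteq> V \<and> mdeg m = nat (d - e k)})"
    have Mon: "finite Mon" using finite_monomials_mdeg[OF V] S by (auto simp: Mon_def)
    have sMon: "vsupp S v \<subseteq> Mon" if "v \<in> N" "vhomog e d v" for v
      using that keysV[OF that(1)] by (fastforce simp: vsupp_def Mon_def vhomog_def homog_def in_keys_iff)
    from v show ?thesis
    \<comment> \<open>The measure counts the positions in \<open>Mon\<close> up to the leading
      position of v; cancelling the leading term removes at least that position from the
      count.\<close>
    proof (induction "card {p \<in> Mon. \<exists>q\<in>vsupp S v. p \<le> q}" arbitrary: v rule: less_induct)
      case less
      show ?case
      proof (cases "vsupp S v = {}")
        case True
        have "v k = 0" for k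
        proof (cases "k \<in> S")
          case kS: True
          have "lkp (v k) m = 0" for m
          proof (rule ccontr)
            assume "lkp (v k) m \<noteq> 0"
            then have "(k, m) \<in> vsupp S v" using kS by (simp add: vsupp_def in_keys_iff)
            then show False using True by simp
          qed
          then show ?thesis by (intro poly_mapping_eqI) simp
        qed (use gsubD(2)[OF N less.prems(1)] in simp)
        then show ?thesis by (intro bexI[of _ "\<lambda>_. 0"]) (auto simp: pvecs_def)
      next
        case False
        obtain k m where km: "Max (vsupp S v) = (k, m)" by fastforce
        have vle: "q \<le> (k, m)" if "q \<in> vsupp S v" for q
          using Max_ge[OF finite_vsupp[OF S] that] km by simp
        have kmv: "(k, m) \<in> vsupp S v" using Max_in[OF finite_vsupp[OF S] False] km by simp
        have "(k, m) \<in> L" using less.prems False km by (force simp: L_def)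
        then obtain b s where b: "b \<in> B k" "m = b + s" using B(3)[of m k] by (auto simp: A_def)
        have kb: "(k, b) \<in> K" "(k, b) \<in> L" using b B(1) kmv by (auto simp: K_def A_def vsupp_def)
        define w where "w = u (k, b)"
        have w: "w \<in> N" "vhomog e (f (k, b)) w" using u[OF kb(2)] by (auto simp: w_def)
        have kbw: "(k, b) \<in> vsupp S w" and wle: "\<And>q. q \<in> vsupp S w \<Longrightarrow> q \<le> (k, b)"
          using lead[OF kb(2)] by (auto simp: w_def)
        \<comment> \<open>The leading coefficient of v divided by that of the reducer w: subtracting
          c times the monomial s times w cancels position (k, m).\<close>
        define c where "c = lkp (v k) m / lkp (w k) b"
        have wkb: "lkp (w k) b \<noteq> 0" using kbw by (simp add: vsupp_def in_keys_iff)
        have sV: "mkeys s \<subseteq> V"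
          using keysV[OF less.prems(1), of m k] kmv b(2) by (auto simp: vsupp_def keys_add_nat)
        have deg: "d = int (mdeg s) + f (k, b)"
        proof -
          have "int (mdeg m) = d - e k" using less.prems(2) kmv by (simp add: vhomog_def homog_def vsupp_def in_keys_iff)
          moreover have "int (mdeg b) = f (k, b) - e k" using w(2) wkb by (simp add: vhomog_def homog_def)
          ultimately show ?thesis using b(2) by (simp add: mdeg_add)
        qed
        define v' where "v' = (\<lambda>j. v j + mterm s (- c) * w j)"
        have v'N: "v' \<in> N"
          unfolding v'_def using sV by (intro gsubD(4,5)[OF N] less.prems w) auto
        have v'h: "vhomog e d v'"
          unfolding vhomog_def v'_def
        proof
          fix j
          have "homog (int (mdeg s) + (f (k, b) - e j)) (mterm s (- c) * w j)"
            using w(2) by (intro homog_mult) (auto simp: vhomog_def homog_term)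
          then show "homog (d - e j) (v j + mterm s (- c) * w j)"
            using less.prems(2) deg by (intro homog_add) (auto simp: vhomog_def algebra_simps)
        qed
        have v'lt: "q < (k, m)" if q: "q \<in> vsupp S v'" for q
        proof -
          obtain j l where jl: "q = (j, l)" "j \<in> S" "lkp (v' j) l \<noteq> 0"
            using q by (auto simp: vsupp_def in_keys_iff)
          have "lkp (v' k) m = 0"
            using wkb lookup_term_mult[of s "- c" "w k" b]
            by (simp add: v'_def lookup_add b(2) add.commute[of b] c_def)
          then have ne: "q \<noteq> (k, m)" using jl by auto
          have "q \<le> (k, m)"
          proof (cases "lkp (v j) l = 0")
            case False
            then show ?thesis using vle[of q] jl by (simp add: vsupp_def in_keys_iff)
          next
            case True
            then have "lkp (mterm s (- c) * w j) l \<noteq> 0" using jl(3) by (simp add: v'_def lookup_add)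
            then obtain l' where l': "l = s + l'" using lookup_term_mult_neq by blast
            with \<open>lkp (mterm s (- c) * w j) l \<noteq> 0\<close> have "lkp (w j) l' \<noteq> 0" by (auto simp: lookup_term_mult)
            then have "(j, l') \<le> (k, b)" using jl(2) by (intro wle) (simp add: vsupp_def in_keys_iff)
            \<comment> \<open>Shifting exponents by s preserves the order, so s times w has no
              position beyond (k, s + b) = (k, m).\<close>
            then show ?thesis using jl(1) l' b(2) by (auto simp: less_eq_prod_def add.commute[of b] add_left_mono)
          qed
          with ne show ?thesis by simp
        qed
        have "{p \<in> Mon. \<exists>q\<in>vsupp S v'. p \<le> q} \<subset> {p \<in> Mon. \<exists>q\<in>vsupp S v. p \<le> q}"
        proof
          show "{p \<in> Mon. \<exists>q\<in>vsupp S v'. p \<le> q} \<subseteq> {p \<in> Mon. \<exists>q\<in>vsupp S v. p \<le> q}"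
            using v'lt kmv by (blast intro: order_trans less_imp_le)
          have "(k, m) \<in> {p \<in> Mon. \<exists>q\<in>vsupp S v. p \<le> q}" using sMon[OF less.prems] kmv by blast
          moreover have "(k, m) \<notin> {p \<in> Mon. \<exists>q\<in>vsupp S v'. p \<le> q}" using v'lt by (auto simp: not_le)
          ultimately show "{p \<in> Mon. \<exists>q\<in>vsupp S v'. p \<le> q} \<noteq> {p \<in> Mon. \<exists>q\<in>vsupp S v. p \<le> q}" by blast
        qed
        then have "card {p \<in> Mon. \<exists>q\<in>vsupp S v'. p \<le> q} < card {p \<in> Mon. \<exists>q\<in>vsupp S v. p \<le> q}"
          using Mon by (intro psubset_card_mono) auto
        from less.hyps[OF this v'N v'h] have "?Q v'" .
        moreover have "?Q (\<lambda>j. mterm s c * w j)" unfolding w_def using kb(1) sV by (intro Qu) auto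
        ultimately have "?Q (\<lambda>j. v' j + mterm s c * w j)" by (rule Qadd)
        moreover have "v' j + mterm s c * w j = v j" for j
          by (simp add: v'_def single_uminus)
        ultimately show ?thesis by simp
      qed
    qed
  qed
  have "?Q v" if "v \<in> N" for v
    using N that S
  proof (induction v rule: gsub_homog_induct)
    case (add v w)
    then show ?case by (intro Qadd)
  next
    case (homog v d)
    then show ?case by (rule hom)
  qed
  then have "gens V e N K u f" using K u by (auto simp: gens_def)
  then show ?thesis by blast
qed

text \<open>A generating family of least size will do. If a relation had a coefficient with nonzero
  constant term, the generator belonging to it would be a combination of the others: the graded form
  of Nakayama's lemma.\<close>

lemma minimal_gens_ex:
  fixes N :: "(nat \<Rightarrow> ('x::linorder, 'k::field) mpoly) set"
  assumes V: "finite V" and S: "finite S" and N: "gsub V S e N"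
  shows "\<exists>(K :: nat set) w f. gens V e N K w f \<and>
    (\<forall>c\<in>pvecs V. (\<forall>k. (\<Sum>i\<in>K. c i * w i k) = 0) \<longrightarrow> (\<forall>i\<in>K. lkp (c i) 0 = 0))"
proof -
  let ?P = "\<lambda>(K :: nat set, w, f). gens V e N K w f"
  have "\<exists>x. ?P x"
  proof -
    obtain K and w :: "nat \<times> ('x \<Rightarrow>\<^sub>0 nat) \<Rightarrow> _" and f where g: "gens V e N K w f"
      using gens_ex[OF assms] by blast
    then obtain b where b: "bij_betw b {..<card K} K"
      using ex_bij_betw_nat_finite[of K] by (auto simp: gens_def atLeast0LessThan)
    have "\<exists>c\<in>pvecs V. \<forall>k. v k = (\<Sum>i<card K. c i * w (b i) k)" if "v \<in> N" for v
    proof -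
      obtain c where "c \<in> pvecs V" "\<forall>k. v k = (\<Sum>i\<in>K. c i * w i k)" using g \<open>v \<in> N\<close> unfolding gens_def by blast
      then show ?thesis
        using sum.reindex_bij_betw[OF b, of "\<lambda>i. c i * w i _"]
        by (intro bexI[of _ "\<lambda>i. c (b i)"]) (simp_all add: pvecs_def del: split_paired_All)
    qed
    then have "gens V e N {..<card K} (\<lambda>i. w (b i)) (\<lambda>i. f (b i))"
      using g b by (auto simp: gens_def bij_betw_def)
    then show ?thesis by (intro exI[of _ "({..<card K}, \<lambda>i. w (b i), \<lambda>i. f (b i))"]) simp
  qed
  then obtain x where "?P x" by blast
  from ex_has_least_nat[of ?P, OF this, of "\<lambda>(K, w, f). card K"]
  obtain y where y: "?P y \<and> (\<forall>z. ?P z \<longrightarrow> (\<lambda>(K, w, f). card K) y \<le> (\<lambda>(K, w, f). card K) z)" ..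
  obtain K w f where Kwf: "y = (K, w, f)" by (cases y)
  have g: "gens V e N K w f" using y unfolding Kwf by simp
  have min: "card K \<le> card K'" if "gens V e N K' w' f'" for K' :: "nat set" and w' f'
    using conjunct2[OF y, rule_format, of "(K', w', f')"] that unfolding Kwf by simp
  have K: "finite K" and w: "\<And>i. i \<in> K \<Longrightarrow> w i \<in> N" "\<And>i. i \<in> K \<Longrightarrow> vhomog e (f i) (w i)"
    and gen: "\<And>v. v \<in> N \<Longrightarrow> \<exists>c\<in>pvecs V. \<forall>k. v k = (\<Sum>i\<in>K. c i * w i k)"
    using g by (auto simp: gens_def)
  have "lkp (c i0) 0 = 0" if c: "c \<in> pvecs V" and rel: "\<And>k. (\<Sum>i\<in>K. c i * w i k) = 0" and i0: "i0 \<in> K" for c i0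
  proof (rule ccontr)
    assume nz: "lkp (c i0) 0 \<noteq> 0"
    \<comment> \<open>The component of the relation in total degree \<open>f i0\<close>. Its
      coefficient at \<open>i0\<close> has degree 0, hence is a nonzero constant and can be
      inverted.\<close>
    define c' where "c' i = hcomp (f i0 - f i) (c i)" for i
    have c': "c' \<in> pvecs V" using c by (auto simp: pvecs_def c'_def)
    have rel': "(\<Sum>i\<in>K. c' i * w i k) = 0" for k
    proof -
      have "hcomp (f i0 - e k) (c i * w i k) = c' i * w i k" if "i \<in> K" for i
        using hcomp_mult_homog[of "f i - e k" "w i k" "f i0 - e k" "c i"] w(2)[OF that]
        by (simp add: vhomog_def c'_def mult.commute)
      then have "(\<Sum>i\<in>K. c' i * w i k) = hcomp (f i0 - e k) (\<Sum>i\<in>K. c i * w i k)"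
        by (simp add: hcomp_sum)
      then show ?thesis using rel by simp
    qed
    define a where "a = lkp (c i0) 0"
    have "c' i0 = mterm 0 a"
      using homog_0_const[of "c' i0"] by (simp add: c'_def lookup_hcomp a_def)
    then have inv: "mterm 0 (inverse a) * c' i0 = 1"
      using nz by (simp add: mult_single a_def)
    let ?K = "K - {i0}"
    let ?d = "\<lambda>i. - (mterm 0 (inverse a) * c' i)"
    have wi0: "w i0 k = (\<Sum>i\<in>?K. ?d i * w i k)" for k
    proof -
      have "0 = mterm 0 (inverse a) * (\<Sum>i\<in>K. c' i * w i k)" using rel' by simp
      also have "\<dots> = (\<Sum>i\<in>K. mterm 0 (inverse a) * c' i * w i k)"
        by (simp add: sum_distrib_left mult.assoc)
      also have "\<dots> = w i0 k + (\<Sum>i\<in>?K. mterm 0 (inverse a) * c' i * w i k)"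
        using K i0 inv by (simp add: sum.remove[of K i0])
      finally show ?thesis by (simp add: sum_negf eq_neg_iff_add_eq_0)
    qed
    have "gens V e N ?K w f"
      unfolding gens_def
    proof (intro conjI ballI)
      fix v assume "v \<in> N"
      then obtain b where b: "b \<in> pvecs V" "\<forall>k. v k = (\<Sum>i\<in>K. b i * w i k)" using gen by blast
      have "v k = (\<Sum>i\<in>?K. (b i + b i0 * ?d i) * w i k)" for k
      proof -
        have "v k = b i0 * w i0 k + (\<Sum>i\<in>?K. b i * w i k)" using b(2) K i0 by (simp add: sum.remove[of K i0])
        also have "\<dots> = (\<Sum>i\<in>?K. b i0 * (?d i * w i k)) + (\<Sum>i\<in>?K. b i * w i k)"
          unfolding wi0[of k] by (simp only: sum_distrib_left)
        also have "\<dots> = (\<Sum>i\<in>?K. (b i + b i0 * ?d i) * w i k)"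
          unfolding sum.distrib[symmetric] by (intro sum.cong) (simp_all add: algebra_simps)
        finally show ?thesis .
      qed
      moreover have "(\<lambda>i. b i + b i0 * ?d i) \<in> pvecs V"
        using b(1) c' by (auto simp: pvecs_def intro!: polys_add polys_mult polys_uminus)
      ultimately show "\<exists>c\<in>pvecs V. \<forall>k. v k = (\<Sum>i\<in>?K. c i * w i k)"
        by (intro bexI[of _ "\<lambda>i. b i + b i0 * ?d i"]) simp_all
    qed (use K w in auto)
    from min[OF this] show False using card_Diff1_less[OF K i0] by simp
  qed
  then show ?thesis using g by blast
qed

section \<open>Existence of minimal graded free resolutions\<close>

text \<open>A stage holds a basis, its degrees, and the graded submodule that the next differential
  must have as image: the ideal in position 0, later the kernel of the preceding
  differential.\<close>

type_synonym ('x, 'k) stage = "nat set \<times> (nat \<Rightarrow> int) \<times> (nat \<Rightarrow> ('x, 'k) mpoly) set"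

text \<open>The absence of constant terms in N makes the next differential minimal, as its columns
  will lie in N.\<close>

definition good_stage :: "'x set \<Rightarrow> ('x, 'k::field) stage \<Rightarrow> bool" where
  "good_stage V x \<longleftrightarrow> (case x of (S, e, N) \<Rightarrow>
     finite S \<and> gsub V S e N \<and> (\<forall>v\<in>N. \<forall>k. lkp (v k) 0 = 0))"

definition next_stage ::
  "'x set \<Rightarrow> ('x, 'k::field) stage \<Rightarrow> ('x, 'k) stage \<Rightarrow> (nat \<Rightarrow> nat \<Rightarrow> ('x, 'k) mpoly) \<Rightarrow> bool" where
  "next_stage V x y D \<longleftrightarrow> (case x of (S, e, N) \<Rightarrow> case y of (S', e', N') \<Rightarrow>
     (\<forall>s\<in>S. \<forall>t\<in>S'. D s t \<in> polys V \<and> homog (e' t - e s) (D s t) \<and> lkp (D s t) 0 = 0) \<and>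
     (\<forall>v\<in>pvecs V. (\<forall>k. k \<notin> S \<longrightarrow> v k = 0) \<longrightarrow>
        v \<in> N \<longleftrightarrow> (\<exists>w\<in>pvecs V. \<forall>s\<in>S. v s = (\<Sum>t\<in>S'. D s t * w t))) \<and>
     N' = {w \<in> pvecs V. (\<forall>k. k \<notin> S' \<longrightarrow> w k = 0) \<and> (\<forall>s\<in>S. (\<Sum>t\<in>S'. D s t * w t) = 0)})"

text \<open>The columns of the new matrix are a minimal homogeneous system of generators of N.
  Minimality says that relations among them have no constant terms, which is the invariant for the
  kernel N'.\<close>

lemma next_stage_ex:
  fixes x :: "('x::linorder, 'k::field) stage"
  assumes V: "finite V" and x: "good_stage V x"
  shows "\<exists>y. good_stage V y \<and> (\<exists>D. next_stage V x y D)"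
proof -
  obtain S e N where x': "x = (S, e, N)" by (cases x)
  have S: "finite S" and N: "gsub V S e N" and N0: "\<And>v k. v \<in> N \<Longrightarrow> lkp (v k) 0 = 0"
    using x by (auto simp: good_stage_def x')
  obtain K :: "nat set" and w f where g: "gens V e N K w f"
    and min: "\<forall>c\<in>pvecs V. (\<forall>k. (\<Sum>i\<in>K. c i * w i k) = 0) \<longrightarrow> (\<forall>i\<in>K. lkp (c i) 0 = 0)"
    using minimal_gens_ex[OF V S N] by blast
  have K: "finite K" and w: "\<And>i. i \<in> K \<Longrightarrow> w i \<in> N" "\<And>i. i \<in> K \<Longrightarrow> vhomog e (f i) (w i)"
    and gen: "\<And>v. v \<in> N \<Longrightarrow> \<exists>c\<in>pvecs V. \<forall>k. v k = (\<Sum>i\<in>K. c i * w i k)"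
    using g by (auto simp: gens_def)
  define D where "D s t = w t s" for s t
  define N' where "N' = {c \<in> pvecs V. (\<forall>k. k \<notin> K \<longrightarrow> c k = 0) \<and> (\<forall>s\<in>S. (\<Sum>t\<in>K. D s t * c t) = 0)}"
  have D: "D s t \<in> polys V" "homog (f t - e s) (D s t)" "lkp (D s t) 0 = 0" if "t \<in> K" for s t
    using gsubD(1)[OF N w(1)[OF that]] w(2)[OF that] N0[OF w(1)[OF that]] by (auto simp: D_def pvecs_def vhomog_def)
  have "gsub V K f N'"
    unfolding gsub_def
  proof (intro conjI ballI allI impI)
    fix v d assume v: "v \<in> N'"
    have "(\<Sum>t\<in>K. D s t * hcomp (d - f t) (v t)) = 0" if "s \<in> S" for s
    proof -
      have "hcomp (d - e s) (D s t * v t) = D s t * hcomp (d - f t) (v t)" if "t \<in> K" for t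
        using hcomp_mult_homog[OF D(2)[OF that], of "d - e s" s "v t"] by simp
      then have "(\<Sum>t\<in>K. D s t * hcomp (d - f t) (v t)) = hcomp (d - e s) (\<Sum>t\<in>K. D s t * v t)"
        by (simp add: hcomp_sum)
      then show ?thesis using v that by (simp add: N'_def)
    qed
    then show "(\<lambda>k. hcomp (d - f k) (v k)) \<in> N'" using v by (auto simp: N'_def pvecs_def)
  next
    fix r :: "('x, 'k) mpoly" and v assume "r \<in> polys V" "v \<in> N'"
    then show "(\<lambda>k. r * v k) \<in> N'"
      by (auto simp: N'_def pvecs_def mult.left_commute[of _ r] sum_distrib_left[symmetric])
  qed (auto simp: N'_def pvecs_def sum.distrib algebra_simps)
  moreover have "lkp (v k) 0 = 0" if v: "v \<in> N'" for v k
  proof (cases "k \<in> K")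
    case True
    have "(\<Sum>i\<in>K. v i * w i s) = 0" for s
    proof (cases "s \<in> S")
      case True
      then show ?thesis using v by (simp add: N'_def D_def mult.commute)
    next
      case False
      then show ?thesis using gsubD(2)[OF N w(1)] by simp
    qed
    then show ?thesis using min v True by (simp add: N'_def)
  qed (use v in \<open>simp add: N'_def\<close>)
  ultimately have "good_stage V (K, f, N')" using K by (simp add: good_stage_def)
  moreover have "next_stage V x (K, f, N') D"
    unfolding next_stage_def x' prod.case
  proof (intro conjI ballI impI)
    fix v :: "nat \<Rightarrow> ('x, 'k) mpoly" assume v: "v \<in> pvecs V" "\<forall>k. k \<notin> S \<longrightarrow> v k = 0"
    show "v \<in> N \<longleftrightarrow> (\<exists>w\<in>pvecs V. \<forall>s\<in>S. v s = (\<Sum>t\<in>K. D s t * w t))"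
    proof
      assume "v \<in> N"
      then show "\<exists>w\<in>pvecs V. \<forall>s\<in>S. v s = (\<Sum>t\<in>K. D s t * w t)"
        using gen[of v] by (simp add: D_def mult.commute) blast
    next
      assume "\<exists>w\<in>pvecs V. \<forall>s\<in>S. v s = (\<Sum>t\<in>K. D s t * w t)"
      then obtain c where c: "c \<in> pvecs V" "\<And>s. s \<in> S \<Longrightarrow> v s = (\<Sum>t\<in>K. D s t * c t)" by blast
      have "v s = (\<Sum>t\<in>K. c t * w t s)" for s
      proof (cases "s \<in> S")
        case True
        then show ?thesis using c(2) by (simp add: D_def mult.commute)
      next
        case False
        then show ?thesis using v(2) gsubD(2)[OF N w(1)] by simp
      qed
      then have "v = (\<lambda>s. \<Sum>t\<in>K. c t * w t s)" by blast
      also have "\<dots> \<in> N" using c(1) w(1) by (intro gsub_sum[OF N] gsubD(5)[OF N]) (auto simp: pvecs_def)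
      finally show "v \<in> N" .
    qed
  qed (use D in \<open>auto simp: N'_def\<close>)
  ultimately show ?thesis by blast
qed

theorem mat_res_ex:
  fixes I :: "('x::linorder, 'k::field) mpoly set"
  assumes V: "finite V" and I: "hideal V I" and proper: "I \<noteq> polys V"
  shows "\<exists>(S :: nat \<Rightarrow> nat set) dg D. mat_res V I S dg D"
proof -
  have pI: "pideal V I" and hI: "\<And>p d. p \<in> I \<Longrightarrow> hcomp d p \<in> I" using I by (auto simp: hideal_def)
  \<comment> \<open>The component of degree 0 of p also lies in I; if it were a nonzero constant, I
    would contain a unit.\<close>
  have I0: "lkp p 0 = 0" if p: "p \<in> I" for p
  proof (rule ccontr)
    assume nz: "lkp p 0 \<noteq> 0"
    have "hcomp 0 p = mterm 0 (lkp p 0)" using homog_0_const[of "hcomp 0 p"] by (simp add: lookup_hcomp)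
    then have "mterm 0 (inverse (lkp p 0)) * hcomp 0 p = 1" using nz by (simp add: mult_single)
    moreover have "mterm 0 (inverse (lkp p 0)) * hcomp 0 p \<in> I" by (rule pidealD(4)[OF pI _ hI[OF p]]) simp
    ultimately have "1 \<in> I" by simp
    then have "polys V \<subseteq> I" using pidealD(4)[OF pI, of _ 1] by auto
    then show False using proper pidealD(1)[OF pI] by blast
  qed
  define N0 where "N0 = {v :: nat \<Rightarrow> ('x, 'k) mpoly. v 0 \<in> I \<and> (\<forall>k. k \<noteq> 0 \<longrightarrow> v k = 0)}"
  define x0 where "x0 = ({0 :: nat}, \<lambda>_ :: nat. 0 :: int, N0)"
  have N0P: "v k \<in> polys V" if "v \<in> N0" for v k
    using that pidealD(1)[OF pI] by (cases "k = 0") (auto simp: N0_def)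
  have "gsub V {0} (\<lambda>_. 0) N0"
    unfolding gsub_def using N0P pidealD(2-4)[OF pI] hI by (auto simp: N0_def pvecs_def)
  moreover have "lkp (v k) 0 = 0" if "v \<in> N0" for v k
    using that I0 by (cases "k = 0") (auto simp: N0_def)
  ultimately have "good_stage V x0" by (simp add: good_stage_def x0_def)
  \<comment> \<open>The trivial premise 0 = 0 fits the shape of \<open>dependent_nat_choice\<close>,
    whose invariant may depend on n and thereby fixes the initial stage.\<close>
  then have "\<exists>x. good_stage V x \<and> (0 = 0 \<longrightarrow> x = x0)" by blast
  then have "\<exists>X. \<forall>n. (good_stage V (X n) \<and> (n = 0 \<longrightarrow> X n = x0)) \<and> (\<exists>D. next_stage V (X n) (X (Suc n)) D)"
    by (rule dependent_nat_choice) (use next_stage_ex[OF V] in blast)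
  then obtain X where X: "\<And>n. good_stage V (X n)" "X 0 = x0" "\<And>n. \<exists>D. next_stage V (X n) (X (Suc n)) D"
    by blast
  then obtain D where D: "\<And>n. next_stage V (X n) (X (Suc n)) (D n)" by metis
  define S dg N where "S n = fst (X n)" and "dg n = fst (snd (X n))" and "N n = snd (snd (X n))" for n
  have Xn: "X n = (S n, dg n, N n)" for n by (simp add: S_def dg_def N_def)
  have fin: "finite (S n)" for n using X(1)[of n] by (simp add: good_stage_def Xn)
  have ent: "D n s t \<in> polys V" "homog (dg (Suc n) t - dg n s) (D n s t)" "lkp (D n s t) 0 = 0"
    if "s \<in> S n" "t \<in> S (Suc n)" for n s t
    using D[of n] that by (simp_all add: next_stage_def Xn)
  have im: "v \<in> N n \<longleftrightarrow> (\<exists>w\<in>pvecs V. \<forall>s\<in>S n. v s = (\<Sum>t\<in>S (Suc n). D n s t * w t))"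
    if "v \<in> pvecs V" "\<And>k. k \<notin> S n \<Longrightarrow> v k = 0" for n v
    using D[of n] that by (simp add: next_stage_def Xn)
  have ker: "N (Suc n) = {w \<in> pvecs V. (\<forall>k. k \<notin> S (Suc n) \<longrightarrow> w k = 0) \<and> (\<forall>s\<in>S n. (\<Sum>t\<in>S (Suc n). D n s t * w t) = 0)}" for n
    using D[of n] by (simp add: next_stage_def Xn)
  have X0: "S 0 = {0}" "dg 0 = (\<lambda>_. 0)" "N 0 = N0" using X(2) by (simp_all add: S_def dg_def N_def x0_def)
  have I_iff: "p \<in> I \<longleftrightarrow> p \<in> (\<lambda>w. \<Sum>t\<in>S 1. D 0 0 t * w t) ` pvecs V" for p
  proof (cases "p \<in> polys V")
    case True
    define v where "v = (\<lambda>k :: nat. if k = 0 then p else 0)"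
    have "v \<in> N 0 \<longleftrightarrow> (\<exists>w\<in>pvecs V. \<forall>s\<in>S 0. v s = (\<Sum>t\<in>S (Suc 0). D 0 s t * w t))"
      using True by (intro im) (auto simp: v_def pvecs_def X0)
    then show ?thesis by (auto simp: X0 N0_def v_def)
  next
    case False
    have "(\<Sum>t\<in>S 1. D 0 0 t * w t) \<in> polys V" if "w \<in> pvecs V" for w
      using ent(1)[of 0 0] that by (intro polys_sum polys_mult) (simp_all add: X0 pvecs_def)
    then have "p \<notin> (\<lambda>w. \<Sum>t\<in>S 1. D 0 0 t * w t) ` pvecs V" using False by auto
    moreover have "p \<notin> I" using False pidealD(1)[OF pI, of p] by auto
    ultimately show ?thesis by simp
  qed
  have "I = (\<lambda>w. \<Sum>t\<in>S 1. D 0 0 t * w t) ` pvecs V" by (rule Set.set_eqI, rule I_iff)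
  then have "\<exists>o'. S 0 = {o'} \<and> dg 0 o' = 0 \<and> I = (\<lambda>w. \<Sum>t\<in>S 1. D 0 o' t * w t) ` pvecs V"
    using X0 by (intro exI[of _ 0]) simp
  moreover have "(\<forall>s\<in>S n. (\<Sum>t\<in>S (Suc n). D n s t * v t) = 0) \<longleftrightarrow>
        (\<exists>w\<in>pvecs V. \<forall>t\<in>S (Suc n). v t = (\<Sum>u\<in>S (Suc (Suc n)). D (Suc n) t u * w u))"
    if v: "v \<in> pvecs V" for n v
  proof -
    define v' where "v' k = (if k \<in> S (Suc n) then v k else 0)" for k
    have v': "v' \<in> pvecs V" "\<And>k. k \<notin> S (Suc n) \<Longrightarrow> v' k = 0" using v by (auto simp: v'_def pvecs_def)
    have "(\<forall>s\<in>S n. (\<Sum>t\<in>S (Suc n). D n s t * v t) = 0) \<longleftrightarrow> v' \<in> N (Suc n)"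
      using v' by (auto simp: ker) (auto simp: v'_def)
    also have "\<dots> \<longleftrightarrow> (\<exists>w\<in>pvecs V. \<forall>t\<in>S (Suc n). v' t = (\<Sum>u\<in>S (Suc (Suc n)). D (Suc n) t u * w u))"
      by (rule im[OF v'])
    finally show ?thesis by (simp add: v'_def)
  qed
  ultimately have "mat_res V I S dg D" unfolding mat_res_def using fin ent by blast
  then show ?thesis by blast
qed

section \<open>Ideals generated in disjoint sets of variables\<close>

text \<open>For a monomial \<open>s\<close> in variables outside \<open>A\<close>, \<open>coef A s p\<close> is the coefficient of \<open>s\<close> when \<open>p\<close> is
  read as a polynomial over the polynomials in the variables \<open>A\<close>.\<close>

definition coef :: "'x set \<Rightarrow> ('x \<Rightarrow>\<^sub>0 nat) \<Rightarrow> ('x, 'k::zero) mpoly \<Rightarrow> ('x, 'k) mpoly" where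
  "coef A s p = Abs_poly_mapping (\<lambda>m. if mkeys m \<subseteq> A then lkp p (m + s) else 0)"

lemma lookup_coef: "lkp (coef A s p) m = (if mkeys m \<subseteq> A then lkp p (m + s) else 0)"
proof -
  have "finite ((\<lambda>m. m + s) -` {m. lkp p m \<noteq> 0})"
    by (intro finite_vimageI) (auto simp: inj_on_def)
  then have "finite {m. (if mkeys m \<subseteq> A then lkp p (m + s) else 0) \<noteq> 0}"
    by (rule rev_finite_subset) auto
  then show ?thesis by (simp add: coef_def)
qed

lemma coef_in [simp]: "coef A s p \<in> polys A"
  by (simp add: in_polys_iff lookup_coef)

lemma coef_add: "coef A s (p + q) = coef A s p + coef A s q"
  for p q :: "('x, 'k::monoid_add) mpoly"
  by (rule poly_mapping_eqI) (simp add: lookup_coef lookup_add)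

lemma coef_zero [simp]: "coef A s 0 = 0"
  by (rule poly_mapping_eqI) (simp add: lookup_coef)

lemma coef_sum: "coef A s (sum f K) = (\<Sum>i\<in>K. coef A s (f i))"
  for f :: "'i \<Rightarrow> ('x, 'k::comm_monoid_add) mpoly"
  by (induction K rule: infinite_finite_induct) (auto simp: coef_add)

text \<open>A monomial in the variables A divides k + s only if it divides k, since s has no
  variable of A. Hence taking the coefficient of s is linear over the polynomials in A.\<close>

lemma coef_mult:
  fixes p g :: "('x, 'k::comm_semiring_0) mpoly"
  assumes g: "g \<in> polys A" and s: "mkeys s \<inter> A = {}"
  shows "coef A s (g * p) = g * coef A s p"
  using g
proof (induction g rule: polys_induct)
  case (single m c)
  show ?case
  proof (rule poly_mapping_eqI)
    fix k
    show "lkp (coef A s (mterm m c * p)) k = lkp (mterm m c * coef A s p) k"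
    proof (cases "mkeys k \<subseteq> A \<and> (\<exists>k'. k = m + k')")
      case True
      then obtain k' where k': "k = m + k'" "mkeys k \<subseteq> A" by blast
      then show ?thesis by (simp add: lookup_coef lookup_term_mult keys_add_nat add.assoc)
    next
      case False
      show ?thesis
      proof (cases "mkeys k \<subseteq> A")
        case True
        have "\<nexists>k'. k + s = m + k'"
        proof
          assume "\<exists>k'. k + s = m + k'"
          then have le: "lkp m x \<le> lkp k x + lkp s x" for x
            by (metis le_monomial_iff lookup_add)
          have "lkp m x \<le> lkp k x" for x
          proof (cases "x \<in> A")
            case True
            then have "lkp s x = 0" using s by (auto simp: in_keys_iff)
            then show ?thesis using le[of x] by simp
          next
            case False
            then have "lkp m x = 0" using single by (auto simp: in_keys_iff)
            then show ?thesis by simp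
          qed
          then show False using False True le_monomial_iff by blast
        qed
        moreover have "\<nexists>k'. k = m + k'" using True False by blast
        ultimately show ?thesis using True by (simp add: lookup_coef lookup_term_mult_neq)
      next
        case kA: False
        have "mterm m c * coef A s p \<in> polys A" using single by (intro polys_mult) auto
        then show ?thesis using kA by (auto simp: lookup_coef in_polys_iff)
      qed
    qed
  qed
qed (simp add: coef_add algebra_simps)

lemma coef_disjoint:
  assumes p: "p \<in> polys Y" and "X \<inter> Y = {}" and m: "mkeys m \<subseteq> Y"
  shows "coef X m p = mterm 0 (lkp p m)"
proof (rule poly_mapping_eqI)
  fix k
  have "k = 0" if "mkeys k \<subseteq> X" "lkp p (k + m) \<noteq> 0"
  proof -
    have "mkeys (k + m) \<subseteq> Y" using p that(2) by (simp add: in_polys_iff)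
    then have "mkeys k \<subseteq> Y" by (simp add: keys_add_nat)
    then have "mkeys k = {}" using assms(2) that(1) by blast
    then show ?thesis by (intro poly_mapping_eqI) (metis empty_iff in_keys_iff lookup_zero)
  qed
  then show "lkp (coef X m p) k = lkp (mterm 0 (lkp p m)) k"
    by (auto simp: lookup_coef lookup_single when_def)
qed

section \<open>Separation of variables and exactness modulo an ideal\<close>

lemma monomial_split:
  fixes m :: "'x \<Rightarrow>\<^sub>0 nat"
  assumes "mkeys m \<subseteq> X \<union> Y"
  shows "\<exists>a b. m = a + b \<and> mkeys a \<subseteq> X \<and> mkeys b \<subseteq> Y"
proof -
  define a where "a = Abs_poly_mapping (\<lambda>x. if x \<in> X then lkp m x else 0)"
  have "finite {x. (if x \<in> X then lkp m x else 0) \<noteq> 0}"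
    by (rule finite_subset[OF _ finite_lookup[of m]]) auto
  then have a: "lkp a x = (if x \<in> X then lkp m x else 0)" for x by (simp add: a_def)
  have "m = a + (m - a)" by (rule poly_mapping_eqI) (simp add: lookup_add lookup_minus a)
  moreover have "mkeys a \<subseteq> X" by (auto simp: in_keys_iff a split: if_splits)
  moreover have "mkeys (m - a) \<subseteq> Y"
    using assms by (auto simp: in_keys_iff lookup_minus a subset_iff split: if_splits)
  ultimately show ?thesis by blast
qed

text \<open>The spanning half of the fact that the ring is free over the polynomials in Y with the
  monomials in X as basis. One finite set T serves all coordinates in K, with zero coefficients
  where a monomial is absent.\<close>

lemma polys_split:
  fixes v :: "'i \<Rightarrow> ('x, 'k::comm_semiring_1) mpoly"
  assumes v: "v \<in> pvecs (X \<union> Y)" and K: "finite K"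
  shows "\<exists>T u. finite T \<and> (\<forall>s\<in>T. mkeys s \<subseteq> X) \<and> (\<forall>s. u s \<in> pvecs Y) \<and>
    (\<forall>i\<in>K. v i = (\<Sum>s\<in>T. mterm s 1 * u s i))"
proof -
  have 1: "\<exists>T u. finite T \<and> (\<forall>s\<in>T. mkeys s \<subseteq> X) \<and> (\<forall>s. u s \<in> polys Y) \<and>
    p = (\<Sum>s\<in>T. mterm s 1 * u s)" if "p \<in> polys (X \<union> Y)" for p :: "('x, 'k) mpoly"
    using that
  proof (induction p rule: polys_induct)
    case (single m c)
    then obtain a b where ab: "m = a + b" "mkeys a \<subseteq> X" "mkeys b \<subseteq> Y"
      using monomial_split by blast
    then show ?case
      by (intro exI[of _ "{a}"] exI[of _ "\<lambda>_. mterm b c"]) (simp add: mult_single)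
  next
    case (add p q)
    then obtain T u T' u' where *: "finite T" "\<forall>s\<in>T. mkeys s \<subseteq> X" "\<forall>s. u s \<in> polys Y"
      "p = (\<Sum>s\<in>T. mterm s 1 * u s)" "finite T'" "\<forall>s\<in>T'. mkeys s \<subseteq> X" "\<forall>s. u' s \<in> polys Y"
      "q = (\<Sum>s\<in>T'. mterm s 1 * u' s)" by blast
    let ?u = "\<lambda>s. (if s \<in> T then u s else 0) + (if s \<in> T' then u' s else 0)"
    have "(\<Sum>s\<in>T \<union> T'. mterm s 1 * (if s \<in> T then u s else 0)) = p"
      unfolding *(4) using *(1,5) by (intro sum.mono_neutral_cong_right) auto
    moreover have "(\<Sum>s\<in>T \<union> T'. mterm s 1 * (if s \<in> T' then u' s else 0)) = q"
      unfolding *(8) using *(1,5) by (intro sum.mono_neutral_cong_right) auto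
    ultimately have "p + q = (\<Sum>s\<in>T \<union> T'. mterm s 1 * ?u s)"
      by (simp only: distrib_left sum.distrib)
    then show ?case using *(1-3,5-7) by (intro exI[of _ "T \<union> T'"] exI[of _ ?u]) auto
  qed
  let ?P = "\<lambda>i (T, u). finite T \<and> (\<forall>s\<in>T. mkeys s \<subseteq> X) \<and> (\<forall>s. u s \<in> polys Y) \<and>
    v i = (\<Sum>s\<in>T. mterm s 1 * u s)"
  have "\<forall>i. \<exists>x. ?P i x" using 1 v by (simp add: pvecs_def)
  from choice[OF this] obtain f where f: "\<forall>i. ?P i (f i)" ..
  define T u where "T i = fst (f i)" and "u i = snd (f i)" for i
  have Tu: "finite (T i)" "s \<in> T i \<Longrightarrow> mkeys s \<subseteq> X"
    "u i s \<in> polys Y" "v i = (\<Sum>s\<in>T i. mterm s 1 * u i s)" for i s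
    using f[rule_format, of i] by (auto simp: T_def u_def split: prod.splits)
  have "v i = (\<Sum>s\<in>(\<Union>i\<in>K. T i). mterm s 1 * (if s \<in> T i then u i s else 0))" if "i \<in> K" for i
    unfolding Tu(4) using Tu(1) K that by (intro sum.mono_neutral_cong_left) auto
  then show ?thesis
    using Tu K by (intro exI[of _ "\<Union>i\<in>K. T i"] exI[of _ "\<lambda>s i. if s \<in> T i then u i s else 0"])
      (auto simp: pvecs_def)
qed

lemma pvecs_mono: "A \<subseteq> B \<Longrightarrow> v \<in> pvecs A \<Longrightarrow> v \<in> pvecs B"
  using polys_mono[of A B] by (auto simp: pvecs_def)

text \<open>This is the vanishing of \<open>Tor\<close> between ideals in disjoint variables. A cycle modulo \<open>I\<close> is written as
  \<open>\<Sum>i. q i * u i\<close> with \<open>q i\<close> in the variables \<open>X\<close> and \<open>u i\<close> over the variables \<open>Y\<close>. If the \<open>q i\<close> are linearly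
  independent modulo \<open>I\<close> over the base field, then every \<open>u i\<close> is a cycle; otherwise the number of summands
  can be reduced.\<close>

lemma exact_mod_ideal_aux:
  fixes I J :: "('x, 'k::field) mpoly set" and q :: "'a \<Rightarrow> ('x, 'k) mpoly"
  assumes disj: "X \<inter> Y = {}" and I: "pideal (X \<union> Y) I"
    and coefI: "\<And>p m. p \<in> I \<Longrightarrow> mkeys m \<subseteq> Y \<Longrightarrow> coef X m p \<in> I"
    and res: "mat_res Y J S dg D"
    and "finite K" and "\<And>i. i \<in> K \<Longrightarrow> q i \<in> polys X" and "\<And>i. i \<in> K \<Longrightarrow> u i \<in> pvecs Y"
    and "\<And>s. s \<in> S n \<Longrightarrow> (\<Sum>t\<in>S (Suc n). D n s t * (\<Sum>i\<in>K. q i * u i t)) \<in> I"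
  shows "\<exists>w\<in>pvecs (X \<union> Y). \<forall>t\<in>S (Suc n).
    (\<Sum>i\<in>K. q i * u i t) - (\<Sum>r\<in>S (Suc (Suc n)). D (Suc n) t r * w r) \<in> I"
  using assms(5-8)
proof (induction "card K" arbitrary: K u rule: less_induct)
  case less
  note D = mat_resD(3)[OF res]
  have PY: "p \<in> polys (X \<union> Y)" if "p \<in> polys Y" for p :: "('x, 'k) mpoly"
    using that polys_mono[of Y "X \<union> Y"] by blast
  have PX: "p \<in> polys (X \<union> Y)" if "p \<in> polys X" for p :: "('x, 'k) mpoly"
    using that polys_mono[of X "X \<union> Y"] by blast
  show ?case
  proof (cases "\<exists>c i0. (\<Sum>i\<in>K. mterm 0 (c i) * q i) \<in> I \<and> i0 \<in> K \<and> c i0 \<noteq> 0")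
    case True
    then obtain c i0 where c: "(\<Sum>i\<in>K. mterm 0 (c i) * q i) \<in> I" "i0 \<in> K" "c i0 \<noteq> 0" by blast
    \<comment> \<open>Normalized so that the coefficient of \<open>q i0\<close> is 1 and
      \<open>q i0\<close> can be solved for modulo I.\<close>
    define e :: "'a \<Rightarrow> ('x, 'k) mpoly" where "e i = mterm 0 (c i / c i0)" for i
    have e0: "e i0 = 1" using c(3) by (simp add: e_def)
    have eP: "e i \<in> polys A" for i A by (simp add: e_def)
    have eI: "(\<Sum>i\<in>K. e i * q i) \<in> I"
    proof -
      have "mterm 0 (inverse (c i0)) * (\<Sum>i\<in>K. mterm 0 (c i) * q i) = (\<Sum>i\<in>K. e i * q i)"
        unfolding sum_distrib_left
        by (intro sum.cong refl) (simp add: e_def mult.assoc[symmetric] mult_single divide_inverse mult.commute[of "c _"])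
      moreover have "mterm 0 (inverse (c i0)) * (\<Sum>i\<in>K. mterm 0 (c i) * q i) \<in> I"
        by (rule pidealD(4)[OF I _ c(1)]) simp
      ultimately show ?thesis by simp
    qed
    let ?K = "K - {i0}"
    \<comment> \<open>Substituting for \<open>q i0\<close> modulo I leaves the summands other than
      \<open>i0\<close>, with coefficient vectors still over Y because the e i are
      constants.\<close>
    define u' where "u' i t = u i t - e i * u i0 t" for i t
    have diff: "(\<Sum>i\<in>K. q i * u i t) = (\<Sum>i\<in>?K. q i * u' i t) + u i0 t * (\<Sum>i\<in>K. e i * q i)" for t
    proof -
      have "(\<Sum>i\<in>?K. q i * u' i t) = (\<Sum>i\<in>?K. q i * u i t) - u i0 t * (\<Sum>i\<in>?K. e i * q i)"
        by (simp add: u'_def sum_subtractf sum_distrib_left algebra_simps)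
      then show ?thesis
        using less.prems(1) c(2) e0 by (simp add: sum.remove[of K i0] algebra_simps)
    qed
    have u0: "u i0 t \<in> polys (X \<union> Y)" for t using less.prems(3)[OF c(2)] PY by (auto simp: pvecs_def)
    have "\<exists>w\<in>pvecs (X \<union> Y). \<forall>t\<in>S (Suc n).
        (\<Sum>i\<in>?K. q i * u' i t) - (\<Sum>r\<in>S (Suc (Suc n)). D (Suc n) t r * w r) \<in> I"
    proof (rule less.hyps)
      show "card ?K < card K" using card_Diff1_less[OF less.prems(1) c(2)] .
      show "u' i \<in> pvecs Y" if "i \<in> ?K" for i
        using less.prems(3) that c(2) eP by (auto simp: pvecs_def u'_def intro!: polys_diff polys_mult)
      fix s assume s: "s \<in> S n"
      have "(\<Sum>t\<in>S (Suc n). D n s t * (\<Sum>i\<in>?K. q i * u' i t)) =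
          (\<Sum>t\<in>S (Suc n). D n s t * (\<Sum>i\<in>K. q i * u i t)) -
          (\<Sum>t\<in>S (Suc n). (D n s t * u i0 t) * (\<Sum>i\<in>K. e i * q i))"
        unfolding diff by (simp only: distrib_left sum.distrib mult.assoc) simp
      also have "\<dots> \<in> I"
      proof (rule pidealD(6)[OF I less.prems(4)[OF s]])
        have "D n s t * u i0 t \<in> polys (X \<union> Y)" if "t \<in> S (Suc n)" for t
          using D[OF s that] u0 PY by (intro polys_mult) auto
        then show "(\<Sum>t\<in>S (Suc n). (D n s t * u i0 t) * (\<Sum>i\<in>K. e i * q i)) \<in> I"
          by (intro pideal_sum[OF I]) (rule pidealD(4)[OF I _ eI])
      qed
      finally show "(\<Sum>t\<in>S (Suc n). D n s t * (\<Sum>i\<in>?K. q i * u' i t)) \<in> I" .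
    qed (use less.prems in auto)
    then obtain w where w: "w \<in> pvecs (X \<union> Y)" "\<And>t. t \<in> S (Suc n) \<Longrightarrow>
        (\<Sum>i\<in>?K. q i * u' i t) - (\<Sum>r\<in>S (Suc (Suc n)). D (Suc n) t r * w r) \<in> I" by blast
    have "(\<Sum>i\<in>K. q i * u i t) - (\<Sum>r\<in>S (Suc (Suc n)). D (Suc n) t r * w r) \<in> I" if t: "t \<in> S (Suc n)" for t
    proof -
      have "((\<Sum>i\<in>?K. q i * u' i t) - (\<Sum>r\<in>S (Suc (Suc n)). D (Suc n) t r * w r)) +
          u i0 t * (\<Sum>i\<in>K. e i * q i) \<in> I"
        by (intro pidealD(3)[OF I] w(2) t pidealD(4)[OF I] u0 eI)
      then show ?thesis unfolding diff[of t] by (simp add: algebra_simps)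
    qed
    then show ?thesis using w(1) by blast
  next
    case False
    then have indep: "c i = 0" if "(\<Sum>i\<in>K. mterm 0 (c i) * q i) \<in> I" "i \<in> K" for c i
      using that by blast
    have "\<exists>w\<in>pvecs Y. \<forall>t\<in>S (Suc n). u i t = (\<Sum>r\<in>S (Suc (Suc n)). D (Suc n) t r * w r)" if i: "i \<in> K" for i
    proof (rule mat_resD(6)[OF res])
      show "u i \<in> pvecs Y" using less.prems(3) i .
      fix s assume s: "s \<in> S n"
      define p where "p i = (\<Sum>t\<in>S (Suc n). D n s t * u i t)" for i
      have pY: "p i \<in> polys Y" if "i \<in> K" for i
        unfolding p_def using D[OF s] less.prems(3)[OF that] by (intro polys_sum polys_mult) (auto simp: pvecs_def)
      have "(\<Sum>t\<in>S (Suc n). D n s t * (\<Sum>i\<in>K. q i * u i t)) = (\<Sum>t\<in>S (Suc n). \<Sum>i\<in>K. q i * (D n s t * u i t))"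
        by (simp add: sum_distrib_left mult.left_commute)
      also have "\<dots> = (\<Sum>i\<in>K. q i * p i)"
        by (subst sum.swap) (simp add: sum_distrib_left p_def)
      finally have pI: "(\<Sum>i\<in>K. q i * p i) \<in> I" using less.prems(4)[OF s] by simp
      \<comment> \<open>Taking the coefficient of m turns the cycle condition into a linear relation
        of the q i modulo I over the base field; independence then makes the coefficient of m in p i
        vanish.\<close>
      have "lkp (p i) m = 0" for m
      proof (cases "mkeys m \<subseteq> Y")
        case m: True
        have dm: "mkeys m \<inter> X = {}" using m disj by blast
        have "coef X m (\<Sum>i\<in>K. q i * p i) = (\<Sum>i\<in>K. mterm 0 (lkp (p i) m) * q i)"
          unfolding coef_sum
        proof (intro sum.cong refl)
          fix i assume i: "i \<in> K"
          show "coef X m (q i * p i) = mterm 0 (lkp (p i) m) * q i"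
            unfolding coef_mult[OF less.prems(2)[OF i] dm] coef_disjoint[OF pY[OF i] disj m] by (rule mult.commute)
        qed
        then have "(\<Sum>i\<in>K. mterm 0 (lkp (p i) m) * q i) \<in> I" using coefI[OF pI m] by simp
        then show ?thesis using indep[of "\<lambda>i. lkp (p i) m" i] i by simp
      next
        case False
        then show ?thesis using pY[OF i] by (auto simp: in_polys_iff)
      qed
      then show "(\<Sum>t\<in>S (Suc n). D n s t * u i t) = 0"
        unfolding p_def[symmetric] by (intro poly_mapping_eqI) simp
    qed
    then obtain w where w: "\<And>i. i \<in> K \<Longrightarrow> w i \<in> pvecs Y"
      "\<And>i t. i \<in> K \<Longrightarrow> t \<in> S (Suc n) \<Longrightarrow> u i t = (\<Sum>r\<in>S (Suc (Suc n)). D (Suc n) t r * w i r)" by metis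
    show ?thesis
    proof (intro bexI ballI)
      show "(\<lambda>r. \<Sum>i\<in>K. q i * w i r) \<in> pvecs (X \<union> Y)"
        using w(1) less.prems(2) PX PY by (auto simp: pvecs_def intro!: polys_sum polys_mult)
      fix t assume t: "t \<in> S (Suc n)"
      have "(\<Sum>i\<in>K. q i * u i t) = (\<Sum>i\<in>K. \<Sum>r\<in>S (Suc (Suc n)). D (Suc n) t r * (q i * w i r))"
        using w(2) t by (intro sum.cong) (auto simp: sum_distrib_left mult.left_commute)
      also have "\<dots> = (\<Sum>r\<in>S (Suc (Suc n)). D (Suc n) t r * (\<Sum>i\<in>K. q i * w i r))"
        by (subst sum.swap) (simp add: sum_distrib_left)
      finally show "(\<Sum>i\<in>K. q i * u i t) - (\<Sum>r\<in>S (Suc (Suc n)). D (Suc n) t r * (\<Sum>i\<in>K. q i * w i r)) \<in> I"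
        using pidealD(2)[OF I] by simp
    qed
  qed
qed

text \<open>The expansion of v along monomials in X provides the q i to start from.\<close>

lemma exact_mod_ideal:
  fixes I J :: "('x, 'k::field) mpoly set"
  assumes disj: "X \<inter> Y = {}" and I: "pideal (X \<union> Y) I"
    and coefI: "\<And>p m. p \<in> I \<Longrightarrow> mkeys m \<subseteq> Y \<Longrightarrow> coef X m p \<in> I"
    and res: "mat_res Y J S dg D"
    and v: "v \<in> pvecs (X \<union> Y)" and cyc: "\<And>s. s \<in> S n \<Longrightarrow> (\<Sum>t\<in>S (Suc n). D n s t * v t) \<in> I"
  shows "\<exists>w\<in>pvecs (X \<union> Y). \<forall>t\<in>S (Suc n). v t - (\<Sum>r\<in>S (Suc (Suc n)). D (Suc n) t r * w r) \<in> I"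
proof -
  obtain T u where Tu: "finite T" "\<forall>s\<in>T. mkeys s \<subseteq> X" "\<forall>s. u s \<in> pvecs Y"
    "\<forall>i\<in>S (Suc n). v i = (\<Sum>s\<in>T. mterm s 1 * u s i)"
    using polys_split[OF v mat_resD(1)[OF res, of "Suc n"]] by blast
  have "\<exists>w\<in>pvecs (X \<union> Y). \<forall>t\<in>S (Suc n).
    (\<Sum>i\<in>T. mterm i 1 * u i t) - (\<Sum>r\<in>S (Suc (Suc n)). D (Suc n) t r * w r) \<in> I"
    by (rule exact_mod_ideal_aux[OF disj I coefI res]) (use Tu cyc in auto)
  then show ?thesis using Tu(4) by simp
qed

lemma mat_res_comp_zero:
  assumes res: "mat_res V I S dg D" and s: "s \<in> S n" and u: "u \<in> S (Suc (Suc n))"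
  shows "(\<Sum>t\<in>S (Suc n). D n s t * D (Suc n) t u) = 0"
proof -
  have "(\<Sum>x\<in>S (Suc (Suc n)). D (Suc n) t x * (if x = u then 1 else 0)) = D (Suc n) t u" for t
    using mat_resD(1)[OF res, of "Suc (Suc n)"] u by (simp add: if_distrib[of "(*) _"] cong: if_cong)
  moreover have "(\<lambda>x. if x = u then 1 else 0) \<in> pvecs V" by (simp add: pvecs_def)
  ultimately show ?thesis using mat_resD(7)[OF res _ s, of "\<lambda>x. if x = u then 1 else 0"] by simp
qed

text \<open>Adjoining the variables X keeps a resolution exact: this is
  \<open>exact_mod_ideal\<close> with the zero ideal. The assumption on J says that J is the ideal
  generated by J' in the larger ring.\<close>

lemma mat_res_extend:
  fixes J J' :: "('x, 'k::field) mpoly set"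
  assumes disj: "X \<inter> Y = {}" and res: "mat_res Y J' S dg D"
    and J: "\<And>o'. S 0 = {o'} \<Longrightarrow> J = (\<lambda>w. \<Sum>t\<in>S 1. D 0 o' t * w t) ` pvecs (X \<union> Y)"
  shows "mat_res (X \<union> Y) J S dg D"
proof -
  have zero: "pideal (X \<union> Y) {0 :: ('x, 'k) mpoly}" by (simp add: pideal_def)
  have ex: "\<exists>w\<in>pvecs (X \<union> Y). \<forall>t\<in>S (Suc n). v t = (\<Sum>r\<in>S (Suc (Suc n)). D (Suc n) t r * w r)"
    if "v \<in> pvecs (X \<union> Y)" "\<forall>s\<in>S n. (\<Sum>t\<in>S (Suc n). D n s t * v t) = 0" for n v
    using exact_mod_ideal[OF disj zero _ res that(1), of n] that(2) by simp
  have cz: "(\<Sum>t\<in>S (Suc n). D n s t * v t) = 0"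
    if w: "\<And>t. t \<in> S (Suc n) \<Longrightarrow> v t = (\<Sum>u\<in>S (Suc (Suc n)). D (Suc n) t u * w u)" and s: "s \<in> S n" for n v w s
  proof -
    have "(\<Sum>t\<in>S (Suc n). D n s t * v t) = (\<Sum>t\<in>S (Suc n). \<Sum>u\<in>S (Suc (Suc n)). D n s t * D (Suc n) t u * w u)"
      using w by (intro sum.cong) (auto simp: sum_distrib_left mult.assoc)
    also have "\<dots> = (\<Sum>u\<in>S (Suc (Suc n)). (\<Sum>t\<in>S (Suc n). D n s t * D (Suc n) t u) * w u)"
      by (subst sum.swap) (simp add: sum_distrib_right)
    also have "\<dots> = 0" using mat_res_comp_zero[OF res s] by simp
    finally show ?thesis .
  qed
  obtain o' where o': "S 0 = {o'}" "dg 0 o' = 0" using mat_resD(2)[OF res] by blast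
  have "D n s t \<in> polys (X \<union> Y)" if "s \<in> S n" "t \<in> S (Suc n)" for n s t
    using mat_resD(3)[OF res that] polys_mono[of Y "X \<union> Y"] by blast
  moreover have "(\<forall>s\<in>S n. (\<Sum>t\<in>S (Suc n). D n s t * v t) = 0) \<longleftrightarrow>
      (\<exists>w\<in>pvecs (X \<union> Y). \<forall>t\<in>S (Suc n). v t = (\<Sum>u\<in>S (Suc (Suc n)). D (Suc n) t u * w u))"
    if "v \<in> pvecs (X \<union> Y)" for n v
    using ex[OF that] cz[of n v] by blast
  moreover have "\<exists>o'. S 0 = {o'} \<and> dg 0 o' = 0 \<and> J = (\<lambda>w. \<Sum>t\<in>S 1. D 0 o' t * w t) ` pvecs (X \<union> Y)"
    using o' J[OF o'(1)] by blast
  ultimately show ?thesis unfolding mat_res_def using mat_resD(1,4,5)[OF res] by simp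
qed

section \<open>The tensor product of two resolutions\<close>

text \<open>The basis element \<open>(a, k, l)\<close> in position \<open>n\<close> is the tensor product of the basis elements \<open>k\<close> in
  position \<open>a\<close> and \<open>l\<close> in position \<open>n - a\<close>.\<close>

definition tensor_index :: "(nat \<Rightarrow> 'i set) \<Rightarrow> (nat \<Rightarrow> 'j set) \<Rightarrow> nat \<Rightarrow> (nat \<times> 'i \<times> 'j) set" where
  "tensor_index S S' n = {(a, k, l). a \<le> n \<and> k \<in> S a \<and> l \<in> S' (n - a)}"

definition tensor_degree :: "(nat \<Rightarrow> 'i \<Rightarrow> int) \<Rightarrow> (nat \<Rightarrow> 'j \<Rightarrow> int) \<Rightarrow> nat \<Rightarrow> nat \<times> 'i \<times> 'j \<Rightarrow> int" where
  "tensor_degree dg dg' n = (\<lambda>(a, k, l). dg a k + dg' (n - a) l)"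

text \<open>The Koszul sign, by which the two mixed terms in the square of the differential
  cancel.\<close>

definition sign :: "nat \<Rightarrow> 'r \<Rightarrow> 'r::ab_group_add" where
  "sign a p = (if even a then p else - p)"

text \<open>Entries of the differential d (x \<otimes> y) = d x \<otimes> y + (-1)^a x \<otimes> d y
  of the total complex; rows belong to position n, columns to position n + 1.\<close>

definition tensor_matrix :: "(nat \<Rightarrow> 'i \<Rightarrow> 'i \<Rightarrow> 'r::comm_ring_1) \<Rightarrow> (nat \<Rightarrow> 'j \<Rightarrow> 'j \<Rightarrow> 'r) \<Rightarrow>
    nat \<Rightarrow> nat \<times> 'i \<times> 'j \<Rightarrow> nat \<times> 'i \<times> 'j \<Rightarrow> 'r" where
  "tensor_matrix D D' n = (\<lambda>(a, k, l) (a', k', l').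
     (if a' = Suc a \<and> l' = l then D a k k' else 0) +
     (if a' = a \<and> k' = k then sign a (D' (n - a) l l') else 0))"

text \<open>In row (a, k, l) only the columns (a + 1, k', l) and (a, k, l') can be nonzero.\<close>

lemma tensor_matrix_apply:
  fixes D :: "nat \<Rightarrow> 'i \<Rightarrow> 'i \<Rightarrow> 'r::comm_ring_1" and D' :: "nat \<Rightarrow> 'j \<Rightarrow> 'j \<Rightarrow> 'r"
  assumes fin: "finite (tensor_index S S' (Suc n))" and x: "(a, k, l) \<in> tensor_index S S' n"
  shows "(\<Sum>y\<in>tensor_index S S' (Suc n). tensor_matrix D D' n (a, k, l) y * w y) =
    (\<Sum>k'\<in>S (Suc a). D a k k' * w (Suc a, k', l)) +
    sign a (\<Sum>l'\<in>S' (Suc (n - a)). D' (n - a) l l' * w (a, k, l'))"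
proof -
  let ?T = "tensor_index S S' (Suc n)"
  have a: "a \<le> n" "k \<in> S a" "l \<in> S' (n - a)" using x by (auto simp: tensor_index_def)
  let ?f = "\<lambda>y. (if fst y = Suc a \<and> snd (snd y) = l then D a k (fst (snd y)) else 0) * w y"
  let ?g = "\<lambda>y. (if fst y = a \<and> fst (snd y) = k then sign a (D' (n - a) l (snd (snd y))) else 0) * w y"
  have "(\<Sum>y\<in>?T. tensor_matrix D D' n (a, k, l) y * w y) = (\<Sum>y\<in>?T. ?f y + ?g y)"
    by (intro sum.cong) (auto simp: tensor_matrix_def distrib_right)
  also have "\<dots> = sum ?f ?T + sum ?g ?T" by (rule sum.distrib)
  also have "sum ?f ?T = sum ?f ((\<lambda>k'. (Suc a, k', l)) ` S (Suc a))"
    using fin a by (intro sum.mono_neutral_right) (auto simp: tensor_index_def)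
  also have "\<dots> = (\<Sum>k'\<in>S (Suc a). D a k k' * w (Suc a, k', l))"
    by (subst sum.reindex) (auto simp: inj_on_def)
  also have "sum ?g ?T = sum ?g ((\<lambda>l'. (a, k, l')) ` S' (Suc (n - a)))"
    using fin a by (intro sum.mono_neutral_right) (auto simp: tensor_index_def Suc_diff_le)
  also have "\<dots> = (\<Sum>l'\<in>S' (Suc (n - a)). sign a (D' (n - a) l l') * w (a, k, l'))"
    by (subst sum.reindex) (auto simp: inj_on_def)
  also have "\<dots> = sign a (\<Sum>l'\<in>S' (Suc (n - a)). D' (n - a) l l' * w (a, k, l'))"
    by (simp add: sign_def sum_negf)
  finally show ?thesis .
qed

text \<open>The last assumption says that the second resolution stays exact modulo \<open>I\<close>. The proof of
  exactness kills the components of a cycle one \<open>a\<close> at a time, for \<open>a = 0\<close> by this assumption and for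
  \<open>a > 0\<close> by exactness of the first resolution.\<close>

theorem tensor_mat_res:
  fixes I J :: "('x, 'k::field) mpoly set" and S :: "nat \<Rightarrow> 'i set" and S' :: "nat \<Rightarrow> 'j set"
  assumes res: "mat_res V I S dg D" and res': "mat_res V J S' dg' D'"
    and flat: "\<And>n v. v \<in> pvecs V \<Longrightarrow> (\<And>s. s \<in> S' n \<Longrightarrow> (\<Sum>t\<in>S' (Suc n). D' n s t * v t) \<in> I) \<Longrightarrow>
      \<exists>w\<in>pvecs V. \<forall>t\<in>S' (Suc n). v t - (\<Sum>r\<in>S' (Suc (Suc n)). D' (Suc n) t r * w r) \<in> I"
  shows "mat_res V {p + q | p q. p \<in> I \<and> q \<in> J} (tensor_index S S') (tensor_degree dg dg') (tensor_matrix D D')"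
proof -
  let ?T = "tensor_index S S'" and ?M = "tensor_matrix D D'"
  define app where "app n w x = (case x of (a, k, l) \<Rightarrow> (\<Sum>k'\<in>S (Suc a). D a k k' * w (Suc a, k', l)) +
    sign a (\<Sum>l'\<in>S' (Suc (n - a)). D' (n - a) l l' * w (a, k, l')))"
    for n and w :: "nat \<times> 'i \<times> 'j \<Rightarrow> ('x, 'k) mpoly" and x
  have fin: "finite (?T n)" for n
  proof (rule finite_subset)
    show "?T n \<subseteq> {..n} \<times> (\<Union>a\<le>n. S a) \<times> (\<Union>a\<le>n. S' (n - a))" by (auto simp: tensor_index_def)
    show "finite ({..n} \<times> (\<Union>a\<le>n. S a) \<times> (\<Union>a\<le>n. S' (n - a)))"
      using mat_resD(1)[OF res] mat_resD(1)[OF res'] by blast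
  qed
  have M: "(\<Sum>y\<in>?T (Suc n). ?M n x y * w y) = app n w x" if "x \<in> ?T n" for n x w
    using tensor_matrix_apply[OF fin, where n = n and D = D and D' = D' and w = w] that by (cases x) (simp add: app_def)
  obtain o1 where o1: "S 0 = {o1}" "dg 0 o1 = 0" "I = (\<lambda>w. \<Sum>t\<in>S 1. D 0 o1 t * w t) ` pvecs V"
    using mat_resD(2)[OF res] by blast
  obtain o2 where o2: "S' 0 = {o2}" "dg' 0 o2 = 0" "J = (\<lambda>w. \<Sum>t\<in>S' 1. D' 0 o2 t * w t) ` pvecs V"
    using mat_resD(2)[OF res'] by blast
  have T0: "?T 0 = {(0, o1, o2)}" using o1(1) o2(1) by (auto simp: tensor_index_def)
  have app_in: "app n w x \<in> polys V" if "w \<in> pvecs V" "x \<in> ?T n" for n w x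
  proof -
    obtain a k l where x: "x = (a, k, l)" by (cases x)
    then have a: "k \<in> S a" "l \<in> S' (n - a)" using that(2) by (auto simp: tensor_index_def)
    have "(\<Sum>k'\<in>S (Suc a). D a k k' * w (Suc a, k', l)) \<in> polys V"
      using mat_resD(3)[OF res a(1)] that(1) by (intro polys_sum polys_mult) (auto simp: pvecs_def)
    moreover have "(\<Sum>l'\<in>S' (Suc (n - a)). D' (n - a) l l' * w (a, k, l')) \<in> polys V"
      using mat_resD(3)[OF res' a(2)] that(1) by (intro polys_sum polys_mult) (auto simp: pvecs_def)
    ultimately show ?thesis unfolding x app_def sign_def by auto
  qed
  have app_add: "app n (\<lambda>y. v y + w y) x = app n v x + app n w x" for n v w x
    by (cases x) (simp add: app_def sign_def sum.distrib algebra_simps)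
  have slice: "(\<lambda>k. w (f k)) \<in> pvecs V" if "w \<in> pvecs V" for w :: "'c \<Rightarrow> ('x, 'k) mpoly" and f :: "'d \<Rightarrow> 'c"
    using that by (simp add: pvecs_def)
  have comp0: "app n (app (Suc n) w) x = 0" if w: "w \<in> pvecs V" and x: "x \<in> ?T n" for n w x
  proof -
    obtain a k l where akl: "x = (a, k, l)" by (cases x)
    then have a: "a \<le> n" "k \<in> S a" "l \<in> S' (n - a)" using x by (auto simp: tensor_index_def)
    let ?b = "n - a"
    have b: "Suc n - a = Suc ?b" using a(1) by simp
    \<comment> \<open>The mixed term: it occurs with the sign of a + 1 when the first differential
      is outermost, and with the sign of a in the other order.\<close>
    let ?c = "\<Sum>k'\<in>S (Suc a). \<Sum>l'\<in>S' (Suc ?b). D a k k' * (D' ?b l l' * w (Suc a, k', l'))"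
    have "(\<Sum>k'\<in>S (Suc a). D a k k' * app (Suc n) w (Suc a, k', l)) =
        (\<Sum>k'\<in>S (Suc a). D a k k' * (\<Sum>k''\<in>S (Suc (Suc a)). D (Suc a) k' k'' * w (Suc (Suc a), k'', l))) + sign (Suc a) ?c"
      by (simp add: app_def sign_def distrib_left right_diff_distrib sum.distrib sum_subtractf sum_negf sum_distrib_left)
    also have "\<dots> = sign (Suc a) ?c"
      using mat_resD(7)[OF res slice[OF w] a(2), of "\<lambda>k''. (Suc (Suc a), k'', l)"] by simp
    finally have 1: "(\<Sum>k'\<in>S (Suc a). D a k k' * app (Suc n) w (Suc a, k', l)) = sign (Suc a) ?c" .
    have "(\<Sum>l'\<in>S' (Suc ?b). D' ?b l l' * app (Suc n) w (a, k, l')) =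
        (\<Sum>l'\<in>S' (Suc ?b). \<Sum>k'\<in>S (Suc a). D a k k' * (D' ?b l l' * w (Suc a, k', l'))) +
        sign a (\<Sum>l'\<in>S' (Suc ?b). D' ?b l l' * (\<Sum>l''\<in>S' (Suc (Suc ?b)). D' (Suc ?b) l' l'' * w (a, k, l'')))"
      by (simp add: app_def b sign_def distrib_left right_diff_distrib sum.distrib sum_subtractf sum_negf sum_distrib_left mult.left_commute)
    also have "\<dots> = ?c"
      using mat_resD(7)[OF res' slice[OF w] a(3), of "\<lambda>l''. (a, k, l'')"]
      by (subst sum.swap) (simp add: sign_def)
    finally show ?thesis using 1 by (simp add: akl app_def[of n] sign_def)
  qed
  have ex: "\<exists>w\<in>pvecs V. \<forall>x\<in>?T (Suc n). v x = app (Suc n) w x"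
    if v: "v \<in> pvecs V" and cyc: "\<And>x. x \<in> ?T n \<Longrightarrow> app n v x = 0" for n v
  proof -
    \<comment> \<open>The components in position n + 1 run from 0 to n + 1, so a = n + 2 covers all
      of them.\<close>
    have "\<exists>w\<in>pvecs V. \<forall>x\<in>?T (Suc n). fst x < a \<longrightarrow> v x = app (Suc n) w x" if "a \<le> Suc (Suc n)" for a
      using that
    proof (induction a)
      case 0
      show ?case by (intro bexI[of _ "\<lambda>_. 0"]) (auto simp: pvecs_def)
    next
      case (Suc a)
      then obtain w where w: "w \<in> pvecs V" "\<And>x. x \<in> ?T (Suc n) \<Longrightarrow> fst x < a \<Longrightarrow> v x = app (Suc n) w x"
        by auto
      define z where "z x = (if x \<in> ?T (Suc n) then v x - app (Suc n) w x else 0)" for x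
      have z: "z \<in> pvecs V" using v w(1) app_in by (auto simp: z_def pvecs_def)
      have z0: "z x = 0" if "fst x < a" for x using w(2) that by (simp add: z_def)
      have zc: "app n z x = 0" if x: "x \<in> ?T n" for x
      proof -
        have "app n z x = (\<Sum>y\<in>?T (Suc n). ?M n x y * z y)" using M[OF x] by simp
        also have "\<dots> = (\<Sum>y\<in>?T (Suc n). ?M n x y * v y) - (\<Sum>y\<in>?T (Suc n). ?M n x y * app (Suc n) w y)"
          by (simp add: z_def right_diff_distrib sum_subtractf)
        also have "\<dots> = app n v x - app n (app (Suc n) w) x" by (simp only: M[OF x])
        finally show ?thesis using cyc[OF x] comp0[OF w(1) x] by simp
      qed
      have "\<exists>w'\<in>pvecs V. \<forall>x\<in>?T (Suc n). fst x \<le> a \<longrightarrow> z x = app (Suc n) w' x"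
      proof (cases a)
        case 0
        \<comment> \<open>The cycle condition at (0, o1, l) expresses this sum as a value of the
          first differential D 0, whose image is I.\<close>
        have "(\<Sum>l'\<in>S' (Suc n). D' n l l' * z (0, o1, l')) \<in> I" if l: "l \<in> S' n" for l
        proof -
          have "app n z (0, o1, l) = 0" using zc[of "(0, o1, l)"] l o1(1) by (simp add: tensor_index_def)
          then have "(\<Sum>l'\<in>S' (Suc n). D' n l l' * z (0, o1, l')) = (\<Sum>k'\<in>S 1. D 0 o1 k' * - z (1, k', l))"
            by (simp add: app_def sign_def sum_negf eq_neg_iff_add_eq_0 add.commute)
          also have "\<dots> \<in> I"
            unfolding o1(3) using z by (intro imageI) (auto simp: pvecs_def)
          finally show ?thesis .
        qed
        then obtain w1 where w1: "w1 \<in> pvecs V"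
          "\<And>l. l \<in> S' (Suc n) \<Longrightarrow> z (0, o1, l) - (\<Sum>r\<in>S' (Suc (Suc n)). D' (Suc n) l r * w1 r) \<in> I"
          using flat[of "\<lambda>l. z (0, o1, l)" n] slice[OF z, of "\<lambda>l. (0, o1, l)"] by blast
        \<comment> \<open>What is left over lies in I, hence is D 0 of some vector; placing these
          vectors in component 1 absorbs it.\<close>
        have "\<forall>l. \<exists>y. y \<in> pvecs V \<and> (l \<in> S' (Suc n) \<longrightarrow>
            z (0, o1, l) - (\<Sum>r\<in>S' (Suc (Suc n)). D' (Suc n) l r * w1 r) = (\<Sum>k\<in>S 1. D 0 o1 k * y k))"
        proof
          fix l
          show "\<exists>y. y \<in> pvecs V \<and> (l \<in> S' (Suc n) \<longrightarrow>
            z (0, o1, l) - (\<Sum>r\<in>S' (Suc (Suc n)). D' (Suc n) l r * w1 r) = (\<Sum>k\<in>S 1. D 0 o1 k * y k))"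
          proof (cases "l \<in> S' (Suc n)")
            case True
            from w1(2)[OF this] show ?thesis unfolding o1(3) by (rule imageE) blast
          qed (intro exI[of _ "\<lambda>_. 0"], simp add: pvecs_def)
        qed
        from choice[OF this] obtain y where "\<forall>l. y l \<in> pvecs V \<and> (l \<in> S' (Suc n) \<longrightarrow>
            z (0, o1, l) - (\<Sum>r\<in>S' (Suc (Suc n)). D' (Suc n) l r * w1 r) = (\<Sum>k\<in>S 1. D 0 o1 k * y l k))" ..
        then have y: "\<And>l. y l \<in> pvecs V" "\<And>l. l \<in> S' (Suc n) \<Longrightarrow>
            z (0, o1, l) - (\<Sum>r\<in>S' (Suc (Suc n)). D' (Suc n) l r * w1 r) = (\<Sum>k\<in>S 1. D 0 o1 k * y l k)"
          by blast+
        define w' where "w' = (\<lambda>(c, k, l). if c = 0 then w1 l else if c = Suc 0 then y l k else 0)"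
        have "w' \<in> pvecs V" using w1(1) y(1) by (auto simp: pvecs_def w'_def)
        moreover have "z x = app (Suc n) w' x" if x: "x \<in> ?T (Suc n)" "fst x \<le> a" for x
        proof -
          obtain l where l: "x = (0, o1, l)" "l \<in> S' (Suc n)" using x 0 o1(1) by (auto simp: tensor_index_def)
          have "app (Suc n) w' x = (\<Sum>k\<in>S 1. D 0 o1 k * y l k) + (\<Sum>r\<in>S' (Suc (Suc n)). D' (Suc n) l r * w1 r)"
            by (simp add: l app_def w'_def sign_def)
          also have "\<dots> = z x" unfolding l(1) y(2)[OF l(2), symmetric] by simp
          finally show ?thesis by simp
        qed
        ultimately show ?thesis by blast
      next
        case (Suc c)
        then have c: "c \<le> n" using Suc.prems by simp
        have ex_y: "\<exists>y. y \<in> pvecs V \<and> (l \<in> S' (Suc n - a) \<longrightarrow>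
            (\<forall>k\<in>S a. z (a, k, l) = (\<Sum>k'\<in>S (Suc a). D a k k' * y k')))" for l
        proof (cases "l \<in> S' (Suc n - a)")
          case l: True
          \<comment> \<open>As z already vanishes in component c, the cycle condition there involves
            only the first differential applied to component a = c + 1.\<close>
          have "(\<Sum>k\<in>S (Suc c). D c k0 k * z (a, k, l)) = 0" if k0: "k0 \<in> S c" for k0
          proof -
            have "(c, k0, l) \<in> ?T n" using c k0 l Suc by (simp add: tensor_index_def)
            moreover have "z (c, k0, l') = 0" for l' using z0[of "(c, k0, l')"] Suc by simp
            ultimately show ?thesis using zc[of "(c, k0, l)"] Suc by (simp add: app_def sign_def cong: if_cong)
          qed
          then have "\<exists>y\<in>pvecs V. \<forall>k\<in>S (Suc c). z (a, k, l) = (\<Sum>k'\<in>S (Suc (Suc c)). D (Suc c) k k' * y k')"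
            using mat_resD(6)[OF res slice[OF z, of "\<lambda>k. (a, k, l)"]] by blast
          then show ?thesis using Suc by blast
        next
          case False
          then show ?thesis by (intro exI[of _ "\<lambda>_. 0"]) (auto simp: pvecs_def)
        qed
        have "\<exists>y. \<forall>l. y l \<in> pvecs V \<and> (l \<in> S' (Suc n - a) \<longrightarrow>
            (\<forall>k\<in>S a. z (a, k, l) = (\<Sum>k'\<in>S (Suc a). D a k k' * y l k')))"
          by (rule choice, rule allI, rule ex_y)
        then obtain y where "\<forall>l. y l \<in> pvecs V \<and> (l \<in> S' (Suc n - a) \<longrightarrow>
            (\<forall>k\<in>S a. z (a, k, l) = (\<Sum>k'\<in>S (Suc a). D a k k' * y l k')))" ..
        then have y: "\<And>l. y l \<in> pvecs V" "\<And>l k. l \<in> S' (Suc n - a) \<Longrightarrow> k \<in> S a \<Longrightarrow>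
            z (a, k, l) = (\<Sum>k'\<in>S (Suc a). D a k k' * y l k')" by blast+
        \<comment> \<open>A vector in component a + 1 has its boundary in components a and a + 1
          only, so the components below a stay as they are.\<close>
        define w' where "w' = (\<lambda>(c, k, l). if c = Suc a then y l k else 0)"
        have "w' \<in> pvecs V" using y(1) by (auto simp: pvecs_def w'_def)
        moreover have "z x = app (Suc n) w' x" if x: "x \<in> ?T (Suc n)" "fst x \<le> a" for x
        proof (cases "fst x = a")
          case True
          then obtain k l where kl: "x = (a, k, l)" "k \<in> S a" "l \<in> S' (Suc n - a)"
            using x(1) by (auto simp: tensor_index_def)
          then show ?thesis using y(2)[OF kl(3,2)] by (simp add: app_def w'_def sign_def)
        next
          case False
          then show ?thesis using x(2) z0[of x] by (cases x) (simp add: app_def w'_def sign_def)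
        qed
        ultimately show ?thesis by blast
      qed
      then obtain w' where w': "w' \<in> pvecs V" "\<And>x. x \<in> ?T (Suc n) \<Longrightarrow> fst x \<le> a \<Longrightarrow> z x = app (Suc n) w' x"
        by blast
      have "v x = app (Suc n) (\<lambda>y. w y + w' y) x" if x: "x \<in> ?T (Suc n)" "fst x < Suc a" for x
        using w'(2)[of x] x by (simp add: app_add z_def algebra_simps)
      moreover have "(\<lambda>y. w y + w' y) \<in> pvecs V" using w(1) w'(1) by (auto simp: pvecs_def)
      ultimately show ?case by blast
    qed
    from this[of "Suc (Suc n)"] show ?thesis by (auto simp: tensor_index_def)
  qed
  have "{p + q | p q. p \<in> I \<and> q \<in> J} = (\<lambda>w. \<Sum>y\<in>?T 1. ?M 0 (0, o1, o2) y * w y) ` pvecs V"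
  proof -
    have app0: "(\<Sum>y\<in>?T 1. ?M 0 (0, o1, o2) y * w y) =
        (\<Sum>k\<in>S 1. D 0 o1 k * w (Suc 0, k, o2)) + (\<Sum>l\<in>S' 1. D' 0 o2 l * w (0, o1, l))" for w
      using M[of "(0, o1, o2)" 0 w] T0 by (simp add: app_def sign_def)
    show ?thesis
      unfolding app0
    proof (intro equalityI subsetI)
      fix p assume "p \<in> {p + q | p q. p \<in> I \<and> q \<in> J}"
      then obtain u u' where u: "u \<in> pvecs V" "u' \<in> pvecs V"
        "p = (\<Sum>t\<in>S 1. D 0 o1 t * u t) + (\<Sum>t\<in>S' 1. D' 0 o2 t * u' t)"
        unfolding o1(3) o2(3) by blast
      then show "p \<in> (\<lambda>w. (\<Sum>k\<in>S 1. D 0 o1 k * w (Suc 0, k, o2)) + (\<Sum>l\<in>S' 1. D' 0 o2 l * w (0, o1, l))) ` pvecs V"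
        by (intro image_eqI[of _ _ "\<lambda>(c, k, l). if c = 0 then u' l else u k"]) (auto simp: pvecs_def)
    next
      fix p assume "p \<in> (\<lambda>w. (\<Sum>k\<in>S 1. D 0 o1 k * w (Suc 0, k, o2)) + (\<Sum>l\<in>S' 1. D' 0 o2 l * w (0, o1, l))) ` pvecs V"
      then obtain w where w: "w \<in> pvecs V"
        "p = (\<Sum>k\<in>S 1. D 0 o1 k * w (Suc 0, k, o2)) + (\<Sum>l\<in>S' 1. D' 0 o2 l * w (0, o1, l))" ..
      have "(\<Sum>k\<in>S 1. D 0 o1 k * w (Suc 0, k, o2)) \<in> I"
        unfolding o1(3) by (rule image_eqI[OF _ slice[OF w(1), of "\<lambda>k. (Suc 0, k, o2)"]]) simp
      moreover have "(\<Sum>l\<in>S' 1. D' 0 o2 l * w (0, o1, l)) \<in> J"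
        unfolding o2(3) by (rule image_eqI[OF _ slice[OF w(1), of "\<lambda>l. (0, o1, l)"]]) simp
      ultimately show "p \<in> {p + q | p q. p \<in> I \<and> q \<in> J}" using w(2) by blast
    qed
  qed
  then have zero: "\<exists>o'. ?T 0 = {o'} \<and> tensor_degree dg dg' 0 o' = 0 \<and>
      {p + q | p q. p \<in> I \<and> q \<in> J} = (\<lambda>w. \<Sum>y\<in>?T 1. ?M 0 o' y * w y) ` pvecs V"
    using T0 o1(2) o2(2) by (intro exI[of _ "(0, o1, o2)"]) (simp add: tensor_degree_def)
  have entries: "?M n x y \<in> polys V \<and> homog (tensor_degree dg dg' (Suc n) y - tensor_degree dg dg' n x) (?M n x y) \<and>
      lkp (?M n x y) 0 = 0" if x: "x \<in> ?T n" and y: "y \<in> ?T (Suc n)" for n x y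
  proof -
    obtain a k l a' k' l' where xy: "x = (a, k, l)" "y = (a', k', l')" by (cases x; cases y)
    have *: "a \<le> n" "k \<in> S a" "l \<in> S' (n - a)" "k' \<in> S a'" "l' \<in> S' (Suc n - a')"
      using x y by (auto simp: xy tensor_index_def)
    consider "a' = Suc a" "l' = l" | "a' = a" "k' = k" | "a' \<noteq> Suc a \<or> l' \<noteq> l" "a' \<noteq> a \<or> k' \<noteq> k" by blast
    then show ?thesis
    proof cases
      case 1
      then show ?thesis
        using mat_resD(3-5)[OF res *(2), of k'] * by (simp add: xy tensor_matrix_def tensor_degree_def)
    next
      case 2
      then have "l' \<in> S' (Suc (n - a))" using * by (simp add: Suc_diff_le)
      from mat_resD(3-5)[OF res' *(3) this] 2 *(1) show ?thesis
        by (auto simp: xy tensor_matrix_def tensor_degree_def sign_def Suc_diff_le)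
    next
      case 3
      then show ?thesis by (auto simp: xy tensor_matrix_def)
    qed
  qed
  have exact: "(\<forall>x\<in>?T n. (\<Sum>y\<in>?T (Suc n). ?M n x y * v y) = 0) \<longleftrightarrow>
      (\<exists>w\<in>pvecs V. \<forall>y\<in>?T (Suc n). v y = (\<Sum>u\<in>?T (Suc (Suc n)). ?M (Suc n) y u * w u))" (is "?L \<longleftrightarrow> ?R")
    if v: "v \<in> pvecs V" for n v
  proof
    assume ?L
    then show ?R using ex[OF v, of n] M by simp
  next
    assume ?R
    then obtain w where w: "w \<in> pvecs V" "\<And>y. y \<in> ?T (Suc n) \<Longrightarrow> v y = app (Suc n) w y" using M by auto
    show ?L
    proof
      fix x assume x: "x \<in> ?T n"
      have "(\<Sum>y\<in>?T (Suc n). ?M n x y * v y) = (\<Sum>y\<in>?T (Suc n). ?M n x y * app (Suc n) w y)"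
        using w(2) by simp
      then show "(\<Sum>y\<in>?T (Suc n). ?M n x y * v y) = 0" using M[OF x] comp0[OF w(1) x] by simp
    qed
  qed
  show ?thesis
    unfolding mat_res_def
  proof (intro conjI allI ballI)
    show "\<And>n v. v \<in> pvecs V \<Longrightarrow> (\<forall>x\<in>?T n. (\<Sum>y\<in>?T (Suc n). ?M n x y * v y) = 0) \<longleftrightarrow>
      (\<exists>w\<in>pvecs V. \<forall>y\<in>?T (Suc n). v y = (\<Sum>u\<in>?T (Suc (Suc n)). ?M (Suc n) y u * w u))"
      by (rule exact)
  qed (use fin zero entries in simp_all)
qed

section \<open>Subadditivity in terms of a matrix resolution\<close>

lemma t_max_mat_res:
  assumes "mat_res V I S dg D" and "hideal V I"
  shows "t_max V (quotient_module V I) n = (SUP s\<in>S n. ereal (of_int (dg n s)))"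
proof -
  have "betti V (quotient_module V I) n j \<noteq> 0 \<longleftrightarrow> (\<exists>s\<in>S n. j = dg n s)" for j
    using mat_resD(1)[OF assms(1)] by (auto simp: mat_res_betti(1)[OF assms] card_eq_0_iff)
  then have "{ereal (of_int j) | j. betti V (quotient_module V I) n j \<noteq> 0} = (\<lambda>s. ereal (of_int (dg n s))) ` S n"
    by auto
  then show ?thesis by (simp add: t_max_def)
qed

lemma SUP_ereal_int_finite:
  fixes f :: "'a \<Rightarrow> int"
  assumes "finite A"
  shows "A \<noteq> {} \<Longrightarrow> \<exists>a\<in>A. (SUP a\<in>A. ereal (of_int (f a))) = ereal (of_int (f a))"
    and "(SUP a\<in>A. ereal (of_int (f a))) \<noteq> \<infinity>"
proof -
  show *: "\<exists>a\<in>A. (SUP a\<in>A. ereal (of_int (f a))) = ereal (of_int (f a))" if "A \<noteq> {}"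
  proof -
    have "Max (f ` A) \<in> f ` A" using assms that by (intro Max_in) auto
    then obtain a where a: "a \<in> A" "Max (f ` A) = f a" by auto
    have "f b \<le> f a" if "b \<in> A" for b using that assms by (auto simp flip: a(2))
    then have "(SUP a\<in>A. ereal (of_int (f a))) = ereal (of_int (f a))"
      using a(1) by (intro antisym SUP_least SUP_upper) auto
    then show ?thesis using a(1) by blast
  qed
  show "(SUP a\<in>A. ereal (of_int (f a))) \<noteq> \<infinity>"
    using * by (cases "A = {}") (auto simp: bot_ereal_def)
qed

text \<open>A basis element in position a + b shows that a + b is at most the projective dimension
  and that the left side exceeds -\<infinity>. Hence neither supremum on the right is -\<infinity>,
  and both are attained at basis elements.\<close>

lemma subadditivity_mat_resD:
  assumes res: "mat_res V I S dg D" and I: "hideal V I"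
    and sub: "subadditivity V (quotient_module V I)" and s: "s \<in> S (a + b)"
  shows "\<exists>s1\<in>S a. \<exists>s2\<in>S b. dg (a + b) s \<le> dg a s1 + dg b s2"
proof -
  let ?t = "\<lambda>n. SUP s\<in>S n. ereal (of_int (dg n s))"
  have fin: "finite (S n)" for n using mat_resD(1)[OF res] .
  have "enat (a + b) \<le> proj_dim (mpoly_ring V) (quotient_module V I)"
    using mat_res_betti(2)[OF res I] s by blast
  then have "?t (a + b) \<le> ?t a + ?t b"
    using sub by (simp add: subadditivity_def t_max_mat_res[OF res I])
  then have le: "ereal (of_int (dg (a + b) s)) \<le> ?t a + ?t b"
    using SUP_upper[OF s, of "\<lambda>s. ereal (of_int (dg (a + b) s))"] by (rule order_trans[rotated])
  have ne: "?t n \<noteq> \<infinity>" for n using SUP_ereal_int_finite(2)[OF fin] .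
  have "?t a \<noteq> -\<infinity>" "?t b \<noteq> -\<infinity>"
    using le ne[of a] ne[of b] by (cases "?t a"; cases "?t b"; auto)+
  then have "S a \<noteq> {}" "S b \<noteq> {}" by (auto simp: bot_ereal_def)
  then obtain s1 s2 where "s1 \<in> S a" "?t a = ereal (of_int (dg a s1))" "s2 \<in> S b" "?t b = ereal (of_int (dg b s2))"
    using SUP_ereal_int_finite(1)[OF fin] by metis
  then show ?thesis using le by (intro bexI[of _ s1] bexI[of _ s2]) (auto simp flip: of_int_add)
qed

text \<open>Only basis elements in position a + b require a bound: without any, the supremum on the
  left is -\<infinity>.\<close>

lemma subadditivity_mat_resI:
  assumes res: "mat_res V I S dg D" and I: "hideal V I"
    and sub: "\<And>a b s. s \<in> S (a + b) \<Longrightarrow> \<exists>s1\<in>S a. \<exists>s2\<in>S b. dg (a + b) s \<le> dg a s1 + dg b s2"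
  shows "subadditivity V (quotient_module V I)"
  unfolding subadditivity_def t_max_mat_res[OF res I]
proof (intro allI impI SUP_least)
  fix a b s assume "s \<in> S (a + b)"
  then obtain s1 s2 where s12: "s1 \<in> S a" "s2 \<in> S b" "dg (a + b) s \<le> dg a s1 + dg b s2" using sub by blast
  then have "ereal (of_int (dg (a + b) s)) \<le> ereal (of_int (dg a s1)) + ereal (of_int (dg b s2))"
    by (simp flip: of_int_add)
  also have "\<dots> \<le> (SUP s\<in>S a. ereal (of_int (dg a s))) + (SUP s\<in>S b. ereal (of_int (dg b s)))"
    using s12 by (intro add_mono SUP_upper)
  finally show "ereal (of_int (dg (a + b) s)) \<le> \<dots>" .
qed

text \<open>The quotient is zero and is resolved by zero modules, so every Betti number vanishes and
  every \<open>t_max\<close> is -\<infinity>.\<close>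

lemma subadditivity_unit_ideal:
  fixes V :: "'x set"
  shows "subadditivity V (quotient_module V (polys V :: ('x, 'k::field) mpoly set))"
proof -
  let ?I = "polys V :: ('x, 'k) mpoly set"
  let ?M = "quotient_module V ?I"
  have I: "hideal V ?I" by (auto simp: hideal_def pideal_def)
  then have pI: "pideal V ?I" by (simp add: hideal_def)
  note q = quotient_module_simps[OF pI]
  have cos: "coset V ?I p = coset V ?I 0" if "p \<in> polys V" for p
    using that by (simp add: q(6))
  have car: "carrier ?M = {coset V ?I 0}"
    using cos polys_zero[of V] unfolding q(1) by blast
  have F: "carrier (graded_free V []) = {\<lambda>k. 0 :: ('x, 'k) mpoly}"
    by (auto simp: carrier_graded_free)
  have "minimal_graded_free_resolution V ?M (\<lambda>_. []) (\<lambda>_. coset V ?I 0) (\<lambda>_ _ _. 0)"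
    unfolding minimal_graded_free_resolution_def resolution_def a_kernel_def' F
  proof (intro conjI allI ballI)
    show "(\<lambda>_. coset V ?I 0) \<in> mod_hom (mpoly_ring V) (graded_free V []) ?M"
      by (rule mod_homI) (auto simp: car q)
    show "graded_map (graded_free V []) ?M (\<lambda>_. coset V ?I 0)"
      by (auto simp: graded_map_def q mpoly_part_iff)
    show "graded_map (graded_free V []) (graded_free V []) (\<lambda>_ _. 0 :: ('x, 'k) mpoly)"
      by (auto simp: graded_map_def gpart_graded_free F)
    show "(\<lambda>_ _. 0) \<in> mod_hom (mpoly_ring V) (graded_free V []) (graded_free V [])"
      by (rule mod_homI) (auto simp: carrier_graded_free)
  qed (auto simp: car q irrelevant_ideal_iff)
  from betti_eq_count[OF I this] show ?thesis
    by (simp add: subadditivity_def t_max_def bot_ereal_def)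
qed

section \<open>Sums of ideals in disjoint variables\<close>

text \<open>The map \<open>coef X m\<close> is linear over the polynomials in X, so it sends every
  multiple of a generator g to a multiple of g.\<close>

lemma coef_genideal:
  fixes G :: "('x, 'k::field) mpoly set"
  assumes disj: "X \<inter> Y = {}" and G: "G \<subseteq> polys X" and p: "p \<in> Idl\<^bsub>mpoly_ring (X \<union> Y)\<^esub> G"
    and m: "mkeys m \<subseteq> Y"
  shows "coef X m p \<in> Idl\<^bsub>mpoly_ring (X \<union> Y)\<^esub> G"
proof -
  let ?R = "mpoly_ring (X \<union> Y) :: ('x, 'k) mpoly ring" and ?V = "X \<union> Y"
  interpret cring ?R by (rule cring_mpoly_ring)
  have XV: "polys X \<subseteq> (polys ?V :: ('x, 'k) mpoly set)" by (rule polys_mono) simp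
  have G': "G \<subseteq> carrier ?R" using G XV by simp
  let ?I = "Idl\<^bsub>?R\<^esub> G"
  have I: "pideal ?V ?I" using genideal_ideal[OF G'] ideal_iff_pideal by blast
  have dm: "mkeys m \<inter> X = {}" using m disj by blast
  \<comment> \<open>The multiplier r is built in because \<open>coef X m\<close> is not linear over
    the whole ring, so the elements with coefficient in the ideal do not visibly form an ideal
    themselves.\<close>
  let ?C = "{p \<in> polys ?V. \<forall>r\<in>polys ?V. coef X m (r * p) \<in> ?I}"
  have "pideal ?V ?C"
    unfolding pideal_def
  proof (intro conjI ballI)
    fix r p :: "('x, 'k) mpoly" assume r: "r \<in> polys ?V" and p: "p \<in> ?C"
    have "coef X m (r' * (r * p)) \<in> ?I" if "r' \<in> polys ?V" for r'
      using p polys_mult[OF that r] by (simp add: mult.assoc[symmetric])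
    then show "r * p \<in> ?C" using r p by auto
  qed (use pidealD(2,3)[OF I] in \<open>auto simp: distrib_left coef_add\<close>)
  moreover have "G \<subseteq> ?C"
  proof
    fix g assume g: "g \<in> G"
    then have gX: "g \<in> polys X" using G by blast
    have "coef X m (r * g) \<in> ?I" for r
    proof -
      have "coef X m (r * g) = coef X m r * g"
        using coef_mult[OF gX dm, of r] by (simp only: mult.commute)
      moreover have "coef X m r \<in> polys ?V" "g \<in> ?I"
        using coef_in XV genideal_self[OF G'] g by blast+
      ultimately show ?thesis using pidealD(4)[OF I] by simp
    qed
    then show "g \<in> ?C" using gX XV by blast
  qed
  ultimately have "?I \<subseteq> ?C" using genideal_minimal ideal_iff_pideal by blast
  then have "\<forall>r\<in>polys ?V. coef X m (r * p) \<in> ?I" using p by blast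
  then have "coef X m (1 * p) \<in> ?I" using polys_one by (rule bspec)
  then show ?thesis by simp
qed

lemma hideal_sum:
  fixes I J :: "('x, 'k::field) mpoly set"
  assumes "hideal V I" "hideal V J"
  shows "hideal V {p + q | p q. p \<in> I \<and> q \<in> J}"
proof -
  have I: "pideal V I" and J: "pideal V J" using assms by (simp_all add: hideal_def)
  show ?thesis
    unfolding hideal_def pideal_def
  proof (intro conjI ballI allI)
    show "{p + q | p q. p \<in> I \<and> q \<in> J} \<subseteq> polys V" using pidealD(1)[OF I] pidealD(1)[OF J] by auto
    show "0 \<in> {p + q | p q. p \<in> I \<and> q \<in> J}" using pidealD(2)[OF I] pidealD(2)[OF J] by force
  next
    fix x y assume "x \<in> {p + q | p q. p \<in> I \<and> q \<in> J}" "y \<in> {p + q | p q. p \<in> I \<and> q \<in> J}"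
    then obtain p q p' q' where *: "p \<in> I" "q \<in> J" "p' \<in> I" "q' \<in> J" "x = p + q" "y = p' + q'" by blast
    have "x + y = (p + p') + (q + q')" using * by (simp add: algebra_simps)
    then show "x + y \<in> {p + q | p q. p \<in> I \<and> q \<in> J}"
      using pidealD(3)[OF I *(1,3)] pidealD(3)[OF J *(2,4)] by blast
  next
    fix r x :: "('x, 'k) mpoly" assume r: "r \<in> polys V" and "x \<in> {p + q | p q. p \<in> I \<and> q \<in> J}"
    then obtain p q where *: "p \<in> I" "q \<in> J" "x = p + q" by blast
    then show "r * x \<in> {p + q | p q. p \<in> I \<and> q \<in> J}"
      using pidealD(4)[OF I r *(1)] pidealD(4)[OF J r *(2)] distrib_left[of r p q] by blast
  next
    fix x d assume "x \<in> {p + q | p q. p \<in> I \<and> q \<in> J}"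
    then obtain p q where "p \<in> I" "q \<in> J" "x = p + q" by blast
    then have "hcomp d p \<in> I" "hcomp d q \<in> J" "hcomp d x = hcomp d p + hcomp d q"
      using assms by (auto simp: hideal_def hcomp_add)
    then show "hcomp d x \<in> {p + q | p q. p \<in> I \<and> q \<in> J}" by blast
  qed
qed

text \<open>J is the extension of its contraction J' to the polynomials in Y, since its generators
  lie there. A minimal resolution over the smaller ring therefore remains one after the variables X
  are adjoined.\<close>

lemma mat_res_in_subring:
  fixes J :: "('x::linorder, 'k::field) mpoly set"
  assumes fin: "finite Y" and disj: "X \<inter> Y = {}" and J: "hideal (X \<union> Y) J" "J \<noteq> polys (X \<union> Y)"
    and H: "H \<subseteq> polys Y" "J = Idl\<^bsub>mpoly_ring (X \<union> Y)\<^esub> H"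
  shows "\<exists>J' (S :: nat \<Rightarrow> nat set) dg D. mat_res Y J' S dg D \<and> mat_res (X \<union> Y) J S dg D"
proof -
  let ?R = "mpoly_ring (X \<union> Y) :: ('x, 'k) mpoly ring" and ?V = "X \<union> Y"
  interpret cring ?R by (rule cring_mpoly_ring)
  have YV: "polys Y \<subseteq> (polys ?V :: ('x, 'k) mpoly set)" by (rule polys_mono) simp
  have pJ: "pideal ?V J" and hJ: "\<And>p d. p \<in> J \<Longrightarrow> hcomp d p \<in> J" using J(1) by (auto simp: hideal_def)
  define J' where "J' = J \<inter> polys Y"
  have "hideal Y J'"
    using pidealD(2-4)[OF pJ] hJ YV by (auto simp: hideal_def pideal_def J'_def)
  moreover have "J' \<noteq> polys Y"
  proof
    assume "J' = polys Y"
    then have "1 \<in> J'" using polys_one by simp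
    then have "1 \<in> J" by (simp add: J'_def)
    then have "polys ?V \<subseteq> J" using pidealD(4)[OF pJ, of _ 1] by auto
    then show False using J(2) pidealD(1)[OF pJ] by blast
  qed
  ultimately obtain S :: "nat \<Rightarrow> nat set" and dg D where res: "mat_res Y J' S dg D"
    using mat_res_ex[OF fin] by blast
  have "mat_res ?V J S dg D"
  proof (rule mat_res_extend[OF disj res])
    fix o' assume o': "S 0 = {o'}"
    let ?im = "\<lambda>A. (\<lambda>w. \<Sum>t\<in>S 1. D 0 o' t * w t) ` pvecs A"
    have J'im: "J' = ?im Y" using mat_resD(2)[OF res] o' by auto
    have D: "D 0 o' t \<in> polys Y" if "t \<in> S 1" for t using mat_resD(3)[OF res] o' that by simp
    \<comment> \<open>The entries of D 0 are the images of unit vectors.\<close>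
    have DJ: "D 0 o' t \<in> J" if t: "t \<in> S 1" for t
    proof -
      have "D 0 o' t = (\<Sum>u\<in>S 1. D 0 o' u * (if u = t then 1 else 0))"
        using mat_resD(1)[OF res, of 1] t by (simp add: if_distrib[of "(*) _"] cong: if_cong)
      then have "D 0 o' t \<in> ?im Y"
        by (rule image_eqI[where x = "\<lambda>u. if u = t then 1 else 0"]) (simp add: pvecs_def)
      then have "D 0 o' t \<in> J'" unfolding J'im .
      then show ?thesis by (simp add: J'_def)
    qed
    have "pideal ?V (?im ?V)"
      unfolding pideal_def
    proof (intro conjI ballI)
      show "?im ?V \<subseteq> polys ?V" using D YV by (auto simp: pvecs_def intro!: polys_sum polys_mult)
      show "0 \<in> ?im ?V" by (intro image_eqI[of _ _ "\<lambda>_. 0"]) (auto simp: pvecs_def)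
    next
      fix x y assume "x \<in> ?im ?V" "y \<in> ?im ?V"
      then obtain v w where "v \<in> pvecs ?V" "x = (\<Sum>t\<in>S 1. D 0 o' t * v t)" "w \<in> pvecs ?V" "y = (\<Sum>t\<in>S 1. D 0 o' t * w t)"
        by blast
      then show "x + y \<in> ?im ?V"
        by (intro image_eqI[of _ _ "\<lambda>t. v t + w t"]) (auto simp: pvecs_def distrib_left sum.distrib)
    next
      fix r x :: "('x, 'k) mpoly" assume "r \<in> polys ?V" "x \<in> ?im ?V"
      then obtain v where "r \<in> polys ?V" "v \<in> pvecs ?V" "x = (\<Sum>t\<in>S 1. D 0 o' t * v t)" by blast
      then show "r * x \<in> ?im ?V"
        by (intro image_eqI[of _ _ "\<lambda>t. r * v t"]) (auto simp: pvecs_def sum_distrib_left mult.left_commute)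
    qed
    moreover have "H \<subseteq> ?im ?V"
    proof
      fix h assume h: "h \<in> H"
      have "H \<subseteq> carrier ?R" using H(1) YV by simp
      from genideal_self[OF this] have "h \<in> J" using h H(2) by blast
      then have "h \<in> ?im Y" using h H(1) J'im by (auto simp: J'_def)
      moreover have "pvecs Y \<subseteq> pvecs ?V" using pvecs_mono[of Y ?V] by blast
      ultimately show "h \<in> ?im ?V" by blast
    qed
    ultimately have "J \<subseteq> ?im ?V" unfolding H(2) using genideal_minimal ideal_iff_pideal by blast
    moreover have "?im ?V \<subseteq> J"
    proof
      fix x assume "x \<in> ?im ?V"
      then obtain w where w: "w \<in> pvecs ?V" "x = (\<Sum>t\<in>S 1. D 0 o' t * w t)" ..
      have "w t * D 0 o' t \<in> J" if "t \<in> S 1" for t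
        using pidealD(4)[OF pJ _ DJ[OF that]] w(1) by (simp add: pvecs_def)
      then show "x \<in> J" unfolding w(2) by (intro pideal_sum[OF pJ]) (simp add: mult.commute)
    qed
    ultimately show "J = ?im ?V" by (rule equalityI)
  qed
  then show ?thesis using res by blast
qed

lemma subadditivity_sum_disjoint:
  fixes I J :: "('x::linorder, 'k::field) mpoly set"
  assumes fin: "finite (X \<union> Y)" and disj: "X \<inter> Y = {}"
    and I: "hideal (X \<union> Y) I" and J: "hideal (X \<union> Y) J"
    and G: "G \<subseteq> polys X" "I = Idl\<^bsub>mpoly_ring (X \<union> Y)\<^esub> G"
    and H: "H \<subseteq> polys Y" "J = Idl\<^bsub>mpoly_ring (X \<union> Y)\<^esub> H"
    and subI: "subadditivity (X \<union> Y) (quotient_module (X \<union> Y) I)"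
    and subJ: "subadditivity (X \<union> Y) (quotient_module (X \<union> Y) J)"
  shows "subadditivity (X \<union> Y) (quotient_module (X \<union> Y) {p + q | p q. p \<in> I \<and> q \<in> J})"
proof -
  let ?V = "X \<union> Y" and ?IJ = "{p + q | p q. p \<in> I \<and> q \<in> J}"
  have pI: "pideal ?V I" and pJ: "pideal ?V J" using I J by (simp_all add: hideal_def)
  show ?thesis
  proof (cases "I = polys ?V \<or> J = polys ?V")
    case True
    have "I \<subseteq> ?IJ" "J \<subseteq> ?IJ" using pidealD(2)[OF pI] pidealD(2)[OF pJ] by force+
    moreover have "?IJ \<subseteq> polys ?V" using hideal_sum[OF I J] by (simp add: hideal_def pideal_def)
    ultimately have "?IJ = polys ?V" using True by blast
    then show ?thesis using subadditivity_unit_ideal by metis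
  next
    case False
    obtain S :: "nat \<Rightarrow> nat set" and dg D where res: "mat_res ?V I S dg D"
      using mat_res_ex[OF fin I] False by blast
    obtain J' and S' :: "nat \<Rightarrow> nat set" and dg' D' where
      resY: "mat_res Y J' S' dg' D'" and res': "mat_res ?V J S' dg' D'"
      using mat_res_in_subring[OF _ disj J _ H] fin False by blast
    let ?T = "tensor_index S S'" and ?dgT = "tensor_degree dg dg'"
    have resT: "mat_res ?V ?IJ ?T ?dgT (tensor_matrix D D')"
    proof (rule tensor_mat_res[OF res res'])
      fix n v assume "v \<in> pvecs ?V" "\<And>s. s \<in> S' n \<Longrightarrow> (\<Sum>t\<in>S' (Suc n). D' n s t * v t) \<in> I"
      then show "\<exists>w\<in>pvecs ?V. \<forall>t\<in>S' (Suc n). v t - (\<Sum>r\<in>S' (Suc (Suc n)). D' (Suc n) t r * w r) \<in> I"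
        using coef_genideal[OF disj G(1)] G(2) by (intro exact_mod_ideal[OF disj pI _ resY]) auto
    qed
    show ?thesis
    proof (rule subadditivity_mat_resI[OF resT hideal_sum[OF I J]])
      fix a b s assume "s \<in> ?T (a + b)"
      then obtain c k l where s: "s = (c, k, l)" "c \<le> a + b" "k \<in> S c" "l \<in> S' (a + b - c)"
        by (auto simp: tensor_index_def)
      \<comment> \<open>As much of c as possible goes to a. Then c2 \<le> b because c \<le> a + b,
        and d1, d2 are what is missing up to a and b, with sum a + b - c.\<close>
      define c1 c2 where "c1 = min c a" and "c2 = c - c1"
      define d1 d2 where "d1 = a - c1" and "d2 = b - c2"
      have cd: "c = c1 + c2" "a + b - c = d1 + d2" "c1 \<le> a" "c2 \<le> b"
        using s(2) by (auto simp: c1_def c2_def d1_def d2_def)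
      obtain k1 k2 where k: "k1 \<in> S c1" "k2 \<in> S c2" "dg c k \<le> dg c1 k1 + dg c2 k2"
        using subadditivity_mat_resD[OF res I subI, of k c1 c2] s(3) cd(1) by auto
      obtain l1 l2 where l: "l1 \<in> S' d1" "l2 \<in> S' d2" "dg' (a + b - c) l \<le> dg' d1 l1 + dg' d2 l2"
        using subadditivity_mat_resD[OF res' J subJ, of l d1 d2] s(4) cd(2) by auto
      show "\<exists>s1\<in>?T a. \<exists>s2\<in>?T b. ?dgT (a + b) s \<le> ?dgT a s1 + ?dgT b s2"
      proof (intro bexI)
        show "?dgT (a + b) s \<le> ?dgT a (c1, k1, l1) + ?dgT b (c2, k2, l2)"
          using k(3) l(3) s(1) by (simp add: tensor_degree_def d1_def d2_def)
        show "(c1, k1, l1) \<in> ?T a" "(c2, k2, l2) \<in> ?T b"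
          using k l cd by (auto simp: tensor_index_def d1_def d2_def)
      qed
    qed
  qed
qed

theorem theorem2p5:
  fixes n :: nat and I J :: "(nat, 'k::field) mpoly set"
  defines "V \<equiv> {1..n}"
  defines "R \<equiv> mpoly_ring V :: (nat, 'k) mpoly ring"
  assumes "homogeneous_ideal V I" and "homogeneous_ideal V J"
    and "\<exists>G H. minimal_generating_set R G I \<and> minimal_generating_set R H J \<and>
           (\<Union>g\<in>G. vars g) \<inter> (\<Union>h\<in>H. vars h) = {}"
    and "subadditivity V (quotient_module V I)"
    and "subadditivity V (quotient_module V J)"
  shows "subadditivity V (quotient_module V (I <+>\<^bsub>R\<^esub> J))"
proof -
  obtain G H where GH: "minimal_generating_set R G I" "minimal_generating_set R H J"
    "(\<Union>g\<in>G. vars g) \<inter> (\<Union>h\<in>H. vars h) = {}" using assms(5) by blast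
  \<comment> \<open>Y also takes up the variables occurring in neither set of generators, so that X
    and Y partition V.\<close>
  define X Y where "X = (\<Union>g\<in>G. vars g)" and "Y = V - X"
  have G: "G \<subseteq> polys V" "I = Idl\<^bsub>R\<^esub> G" and H: "H \<subseteq> polys V" "J = Idl\<^bsub>R\<^esub> H"
    using GH(1,2) by (auto simp: minimal_generating_set_def R_def)
  have XY: "X \<union> Y = V" "X \<inter> Y = {}" using G(1) by (auto simp: X_def Y_def polys_def)
  have "G \<subseteq> polys X" by (auto simp: X_def polys_def)
  moreover have "H \<subseteq> polys Y" using H(1) GH(3) by (fastforce simp: X_def Y_def polys_def)
  moreover have "I <+>\<^bsub>R\<^esub> J = {p + q | p q. p \<in> I \<and> q \<in> J}"
    by (auto simp: set_add_def' R_def)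
  ultimately show ?thesis
    using subadditivity_sum_disjoint[of X Y I J G H] homogeneous_ideal_imp_hideal[OF assms(3)]
      homogeneous_ideal_imp_hideal[OF assms(4)] G(2) H(2) assms(6,7) XY
    by (simp add: R_def V_def)
qed

end
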